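(* Let $C$ be a proper polyhedral cone, let $F$ be a face of $C$ and let $d\geqslant1$. If $C^{\min}$ is $d$-subhomogeneous, then $F^{\min}$ is $d$-subhomogeneous, where $F$ is regarded as a proper polyhedral cone in its linear span $\operatorname{span}F$.
   Context: A proper polyhedral cone $C\subseteq V$ in a finite-dimensional real vector space is a finitely generated convex cone that is pointed ($C\cap(-C)=\{0\}$) and has nonempty interior. A face of $C$ is a convex subcone $F\subseteq C$ such that $c_1,c_2\in C$ and $c_1+c_2\in F$ imply $c_1,c_2\in F$. Minimal operator system: for each proper polyhedral cone $C\subseteq V$ considered, an interior point $u$ of $C$ in $V$ is (arbitrarily) fixed. With $\operatorname{Her}_s$ the complex Hermitian $s\times s$ matrices and $\operatorname{Her}_s(V)=\operatorname{Her}_s\otimes_{\mathbb R}V$, set $C_s^{\min}=\operatorname{cone}\{A\otimes c\mid A\in\operatorname{Her}_s,\ A\geqslant0,\ c\in C\}\subseteq\operatorname{Her}_s(V)$ and $C^{\min}=(V,(C_s^{\min})_{s\geqslant1},u)$, with matrix order unit $I_s\otimes u$ at level $s$. It is called $d$-subhomogeneous if it admits a unital complete order embedding into $\operatorname{Mat}_d(\mathcal A)$ for some commutative $C^*$-algebra $\mathcal A$ (the zero algebra is allowed, so that the zero cone in the zero space is trivially $d$-subhomogeneous), i.e. a real-linear map $\Phi$ from $V$ to the Hermitian elements of $\operatorname{Mat}_d(\mathcal A)$ with $\Phi(u)=1$ such that for all $s\geqslant1$ and $X\in\operatorname{Her}_s(V)$: $X\in C_s^{\min}$ if and only if $(\mathrm{id}\otimes\Phi)(X)\geqslant0$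 in $\operatorname{Mat}_s(\operatorname{Mat}_d(\mathcal A))$. *)

theory Defs
  imports
    "HOL-Analysis.Analysis"
    "HOL-Algebra.Module"
    "Jordan_Normal_Form.Schur_Decomposition"
begin

hide_const (open) VectorSpace.subspace

section \<open>Polyhedral cones\<close>

text \<open>Vector spaces are linear subspaces \<open>V\<close> of a Euclidean space, so that the span of a face, and
  the zero space, are again instances. Interiors are taken relative to \<open>V\<close>.\<close>

definition cone_interior :: "'v::euclidean_space set \<Rightarrow> 'v set \<Rightarrow> 'v set" where
  "cone_interior V C = top_of_set V interior_of C"

definition proper_polyhedral_cone :: "'v::euclidean_space set \<Rightarrow> 'v set \<Rightarrow> bool" where
  "proper_polyhedral_cone V C \<longleftrightarrow>
     subspace V \<and> C \<subseteq> V \<and>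
     (\<exists>S. finite S \<and> C = convex_cone hull S) \<and>
     C \<inter> uminus ` C = {0} \<and>
     cone_interior V C \<noteq> {}"

text \<open>This is not \<open>F face_of C\<close>, which is the notion for general convex sets.\<close>

definition face_of_cone :: "'v::euclidean_space set \<Rightarrow> 'v set \<Rightarrow> bool" where
  "face_of_cone F C \<longleftrightarrow>
     F \<subseteq> C \<and> convex_cone F \<and>
     (\<forall>c1\<in>C. \<forall>c2\<in>C. c1 + c2 \<in> F \<longrightarrow> c1 \<in> F \<and> c2 \<in> F)"

section \<open>Commutative C*-algebras and matrix algebras over them\<close>

abbreviation complex_ring :: "complex ring" where
  "complex_ring \<equiv> \<lparr>carrier = UNIV, mult = (*), one = 1, zero = 0, add = (+)\<rparr>"

record 'a star_alg = "(complex, 'a) module" +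
  adj :: "'a \<Rightarrow> 'a"

record 'a cstar_alg = "'a star_alg" +
  cnorm :: "'a \<Rightarrow> real"

text \<open>Commutativity and the existence of a unit are part of \<^locale>\<open>algebra\<close>; the unit may be zero,
  so the zero algebra is included.\<close>

locale comm_cstar_algebra = algebra complex_ring A
  for A :: "('a, 'b) cstar_alg_scheme" (structure) +
  assumes adj_closed: "x \<in> carrier A \<Longrightarrow> adj A x \<in> carrier A"
    and adj_adj: "x \<in> carrier A \<Longrightarrow> adj A (adj A x) = x"
    and adj_add: "\<lbrakk>x \<in> carrier A; y \<in> carrier A\<rbrakk> \<Longrightarrow>
      adj A (x \<oplus>\<^bsub>A\<^esub> y) = adj A x \<oplus>\<^bsub>A\<^esub> adj A y"
    and adj_smult: "x \<in> carrier A \<Longrightarrow> adj A (c \<odot>\<^bsub>A\<^esub> x) = cnj c \<odot>\<^bsub>A\<^esub> adj A x"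
    and adj_mult: "\<lbrakk>x \<in> carrier A; y \<in> carrier A\<rbrakk> \<Longrightarrow>
      adj A (x \<otimes>\<^bsub>A\<^esub> y) = adj A y \<otimes>\<^bsub>A\<^esub> adj A x"
    and cnorm_nonneg: "x \<in> carrier A \<Longrightarrow> 0 \<le> cnorm A x"
    and cnorm_eq_0_iff: "x \<in> carrier A \<Longrightarrow> cnorm A x = 0 \<longleftrightarrow> x = \<zero>\<^bsub>A\<^esub>"
    and cnorm_triangle: "\<lbrakk>x \<in> carrier A; y \<in> carrier A\<rbrakk> \<Longrightarrow>
      cnorm A (x \<oplus>\<^bsub>A\<^esub> y) \<le> cnorm A x + cnorm A y"
    and cnorm_smult: "x \<in> carrier A \<Longrightarrow> cnorm A (c \<odot>\<^bsub>A\<^esub> x) = cmod c * cnorm A x"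
    and cnorm_mult: "\<lbrakk>x \<in> carrier A; y \<in> carrier A\<rbrakk> \<Longrightarrow>
      cnorm A (x \<otimes>\<^bsub>A\<^esub> y) \<le> cnorm A x * cnorm A y"
    and cstar_identity: "x \<in> carrier A \<Longrightarrow> cnorm A (adj A x \<otimes>\<^bsub>A\<^esub> x) = (cnorm A x)\<^sup>2"
    and cnorm_complete: "\<lbrakk>\<And>n::nat. f n \<in> carrier A;
        \<And>e. e > 0 \<Longrightarrow> \<exists>N. \<forall>m\<ge>N. \<forall>n\<ge>N. cnorm A (f m \<ominus>\<^bsub>A\<^esub> f n) < e\<rbrakk> \<Longrightarrow>
      \<exists>l\<in>carrier A. (\<lambda>n. cnorm A (f n \<ominus>\<^bsub>A\<^esub> l)) \<longlonglongrightarrow> 0"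

text \<open>The *-algebra of \<open>n \<times> n\<close> matrices over \<open>A\<close>. The construction can be iterated. A
  C*-norm is not recorded: it is unique, and only the *-algebra structure enters below.\<close>

definition mat_alg :: "nat \<Rightarrow> ('a, 'b) star_alg_scheme \<Rightarrow> 'a mat star_alg" where
  "mat_alg n A =
    \<lparr>carrier = {X \<in> carrier_mat n n. \<forall>i<n. \<forall>j<n. X $$ (i, j) \<in> carrier A},
     mult = (\<lambda>X Y. Matrix.mat n n (\<lambda>(i, j).
       finsum A (\<lambda>k. X $$ (i, k) \<otimes>\<^bsub>A\<^esub> Y $$ (k, j)) {..<n})),
     one = Matrix.mat n n (\<lambda>(i, j). if i = j then \<one>\<^bsub>A\<^esub> else \<zero>\<^bsub>A\<^esub>),
     zero = Matrix.mat n n (\<lambda>(i, j). \<zero>\<^bsub>A\<^esub>),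
     add = (\<lambda>X Y. Matrix.mat n n (\<lambda>(i, j). X $$ (i, j) \<oplus>\<^bsub>A\<^esub> Y $$ (i, j))),
     smult = (\<lambda>c X. Matrix.mat n n (\<lambda>(i, j). c \<odot>\<^bsub>A\<^esub> X $$ (i, j))),
     adj = (\<lambda>X. Matrix.mat n n (\<lambda>(i, j). adj A (X $$ (j, i))))\<rparr>"

definition hermitian_elems :: "('a, 'b) star_alg_scheme \<Rightarrow> 'a set" where
  "hermitian_elems B = {x \<in> carrier B. adj B x = x}"

text \<open>The positive elements of a C*-algebra are the elements \<open>y* y\<close>.\<close>

definition positive_elems :: "('a, 'b) star_alg_scheme \<Rightarrow> 'a set" where
  "positive_elems B = {adj B y \<otimes>\<^bsub>B\<^esub> y |y. y \<in> carrier B}"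

section \<open>Hermitian matrices over a real vector space\<close>

definition psd_mats :: "nat \<Rightarrow> complex mat set" where
  "psd_mats s = {A \<in> carrier_mat s s. mat_adjoint A = A \<and>
     (\<forall>v\<in>carrier_vec s. 0 \<le> Re ((A *\<^sub>v v) \<bullet>c v))}"

text \<open>\<open>Her\<^sub>s \<otimes> V\<close> is realised as the space of Hermitian \<open>s \<times> s\<close> matrices over the complexification
  of \<open>V\<close>, in which the pair \<open>(a, b)\<close> stands for \<open>a + \<i> b\<close>.\<close>

definition Her :: "nat \<Rightarrow> 'v::real_vector set \<Rightarrow> ('v \<times> 'v) mat set" where
  "Her s V = {X \<in> carrier_mat s s. \<forall>i<s. \<forall>j<s.
     X $$ (i, j) \<in> V \<times> V \<and>
     X $$ (j, i) = (fst (X $$ (i, j)), - snd (X $$ (i, j)))}"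

definition elem_tensor :: "complex mat \<Rightarrow> 'v::real_vector \<Rightarrow> ('v \<times> 'v) mat" where
  "elem_tensor A c = Matrix.mat (dim_row A) (dim_col A)
     (\<lambda>(i, j). (Re (A $$ (i, j)) *\<^sub>R c, Im (A $$ (i, j)) *\<^sub>R c))"

text \<open>\<open>id \<otimes> \<Phi>\<close> for a real-linear map \<open>\<Phi>\<close> into a *-algebra \<open>B\<close>: entrywise application of the
  complex-linear extension of \<open>\<Phi>\<close>.\<close>

definition ampl :: "('a, 'b) star_alg_scheme \<Rightarrow> ('v \<Rightarrow> 'a) \<Rightarrow> ('v \<times> 'v) mat \<Rightarrow> 'a mat" where
  "ampl B \<Phi> X = Matrix.mat (dim_row X) (dim_col X)
     (\<lambda>(i, j). \<Phi> (fst (X $$ (i, j))) \<oplus>\<^bsub>B\<^esub> \<i> \<odot>\<^bsub>B\<^esub> \<Phi> (snd (X $$ (i, j))))"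

text \<open>On elementary tensors this is \<open>M \<otimes> c \<mapsto> M \<otimes> \<Phi> c\<close>.\<close>

lemma ampl_elem_tensor:
  fixes A :: "('a, 'b) cstar_alg_scheme" and \<Phi> :: "'v::real_vector \<Rightarrow> 'a mat"
  assumes "comm_cstar_algebra A"
    and c: "\<Phi> c \<in> carrier (mat_alg d A)"
    and scale: "\<And>r. \<Phi> (r *\<^sub>R c) = complex_of_real r \<odot>\<^bsub>mat_alg d A\<^esub> \<Phi> c"
  shows "ampl (mat_alg d A) \<Phi> (elem_tensor M c) =
    Matrix.mat (dim_row M) (dim_col M) (\<lambda>(i, j). M $$ (i, j) \<odot>\<^bsub>mat_alg d A\<^esub> \<Phi> c)"
proof -
  interpret comm_cstar_algebra A by fact
  have "(complex_of_real (Re z) \<odot>\<^bsub>A\<^esub> x) \<oplus>\<^bsub>A\<^esub> (\<i> \<odot>\<^bsub>A\<^esub> (complex_of_real (Im z) \<odot>\<^bsub>A\<^esub> x)) = z \<odot>\<^bsub>A\<^esub> x"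
    if x: "x \<in> carrier A" for z x
  proof -
    have "(complex_of_real (Re z) \<odot>\<^bsub>A\<^esub> x) \<oplus>\<^bsub>A\<^esub> (\<i> \<odot>\<^bsub>A\<^esub> (complex_of_real (Im z) \<odot>\<^bsub>A\<^esub> x))
        = (complex_of_real (Re z) + \<i> * complex_of_real (Im z)) \<odot>\<^bsub>A\<^esub> x"
      using x smult_l_distr smult_assoc1 by simp
    then show ?thesis by (simp add: complex_eq[symmetric])
  qed
  then have "\<Phi> (Re z *\<^sub>R c) \<oplus>\<^bsub>mat_alg d A\<^esub> \<i> \<odot>\<^bsub>mat_alg d A\<^esub> \<Phi> (Im z *\<^sub>R c) = z \<odot>\<^bsub>mat_alg d A\<^esub> \<Phi> c"
    for z
    using c unfolding scale by (intro eq_matI) (auto simp: mat_alg_def)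
  then show ?thesis
    unfolding ampl_def elem_tensor_def by (intro eq_matI) auto
qed

section \<open>Operator systems\<close>

text \<open>The data \<open>(V, (C\<^sub>s)\<^sub>s, u)\<close> of an operator system.\<close>

record 'v op_system =
  op_space :: "'v set"
  op_cones :: "nat \<Rightarrow> ('v \<times> 'v) mat set"
  order_unit :: 'v

definition min_cone :: "'v::real_vector set \<Rightarrow> nat \<Rightarrow> ('v \<times> 'v) mat set" where
  "min_cone C s = {Matrix.mat s s (\<lambda>(i, j). \<Sum>l<k. r l *\<^sub>R (elem_tensor (A l) (c l) $$ (i, j)))
     |(k::nat) r A c. \<forall>l<k. 0 \<le> r l \<and> A l \<in> psd_mats s \<and> c l \<in> C}"

definition min_system :: "'v::real_vector set \<Rightarrow> 'v set \<Rightarrow> 'v \<Rightarrow> 'v op_system" where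
  "min_system V C u = \<lparr>op_space = V, op_cones = min_cone C, order_unit = u\<rparr>"

definition unital_complete_order_embedding ::
    "'v::real_vector op_system \<Rightarrow> nat \<Rightarrow> ('a, 'b) star_alg_scheme \<Rightarrow> ('v \<Rightarrow> 'a mat) \<Rightarrow> bool" where
  "unital_complete_order_embedding S d A \<Phi> \<longleftrightarrow>
     (let B = mat_alg d A; V = op_space S in
       (\<forall>v\<in>V. \<Phi> v \<in> hermitian_elems B) \<and>
       (\<forall>v\<in>V. \<forall>w\<in>V. \<Phi> (v + w) = \<Phi> v \<oplus>\<^bsub>B\<^esub> \<Phi> w) \<and>
       (\<forall>v\<in>V. \<forall>r. \<Phi> (r *\<^sub>R v) = complex_of_real r \<odot>\<^bsub>B\<^esub> \<Phi> v) \<and>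
       \<Phi> (order_unit S) = \<one>\<^bsub>B\<^esub> \<and>
       (\<forall>s\<ge>1. \<forall>X\<in>Her s V.
          X \<in> op_cones S s \<longleftrightarrow> ampl B \<Phi> X \<in> positive_elems (mat_alg s B)))"

text \<open>HOL cannot quantify over types inside a formula, so the C*-algebras range over those with
  carrier a subset of the type \<open>'a\<close>, which is an explicit parameter.\<close>

definition subhomogeneous ::
    "'a itself \<Rightarrow> nat \<Rightarrow> 'v::real_vector op_system \<Rightarrow> bool" where
  "subhomogeneous _ d S \<longleftrightarrow>
     (\<exists>(A :: 'a cstar_alg) \<Phi>. comm_cstar_algebra A \<and> unital_complete_order_embedding S d A \<Phi>)"

end

theory Submission
  imports Defs
begin

text \<open>
By Gelfand theory, membership in \<open>C\<^sub>s\<^sup>m\<^sup>i\<^sup>n\<close> is detected by the maps \<open>\<xi> \<circ> \<Phi> : V \<rightarrow> Her\<^sub>d\<close>, where \<open>\<xi>\<close> runs through the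
characters of the commutative C*-algebra; they are positive on \<open>C\<close>. The face property gives
\<open>F\<^sub>s\<^sup>m\<^sup>i\<^sup>n = C\<^sub>s\<^sup>m\<^sup>i\<^sup>n \<inter> Her\<^sub>s(span F)\<close>, so the same maps detect \<open>F\<^sub>s\<^sup>m\<^sup>i\<^sup>n\<close>. Adding a small multiple of a positive
functional and normalising by a congruence makes them unital at the chosen interior point \<open>w\<close> of \<open>F\<close>. The
unital positive maps \<open>span F \<rightarrow> Her\<^sub>d\<close> form a separable space, hence countably many of them suffice, and they
define an embedding into the \<open>d \<times> d\<close> matrices over the algebra of bounded functions on a countable
set. This algebra has the cardinality of the continuum, so it can be realised on the given type.
\<close>

section \<open>Kernels on finite index sets\<close>

text \<open>The embedding of \<open>C\<close> cannot simply be restricted to \<open>span F\<close>: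
  \<open>w\<close> lies in \<open>F\<close> and usually not in the interior of \<open>C\<close>, so
  \<open>\<Phi> w\<close> may be singular at some characters and \<open>\<Phi>\<close> cannot be
  normalised as a whole by an inverse square root. Therefore each map is treated separately, with a
  perturbation that depends on the matrix to be excluded. Enlarging the family of maps does no harm:
  a map that is positive on \<open>F\<close> is positive on the minimal cones of \<open>F\<close> at
  every level, because these are generated by elementary tensors. So all unital positive maps may be
  used at once, and since \<open>w\<close> is an order unit of \<open>F\<close>, their values at a
  fixed vector are uniformly bounded. Positive elements are defined as products of an adjoint with
  its element, so positive matrices given at each character need a common square root with entries
  in the algebra; this is the purpose of the explicit iteration. Finally, the new algebra must live
  on the same type as the old one: a nonzero algebra contains a copy of the complex numbers, which
  leaves room for continuum many elements, and the zero algebra occurs only for the zero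
  cone.\<close>

definition ip_on :: "'i set \<Rightarrow> ('i \<Rightarrow> complex) \<Rightarrow> ('i \<Rightarrow> complex) \<Rightarrow> complex" where
  "ip_on I x y = (\<Sum>i\<in>I. cnj (x i) * y i)"

text \<open>Operators are kernels over an arbitrary index set, so that pairs can serve as indices:
  matrices with matrix entries then need no separate treatment.\<close>

definition ap_on :: "'i set \<Rightarrow> ('i \<Rightarrow> 'i \<Rightarrow> complex) \<Rightarrow> ('i \<Rightarrow> complex) \<Rightarrow> 'i \<Rightarrow> complex" where
  "ap_on I K x i = (\<Sum>j\<in>I. K i j * x j)"

definition kernel_mult :: "'i set \<Rightarrow> ('i \<Rightarrow> 'i \<Rightarrow> complex) \<Rightarrow> ('i \<Rightarrow> 'i \<Rightarrow> complex) \<Rightarrow> 'i \<Rightarrow> 'i \<Rightarrow> complex" where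
  "kernel_mult I K L i j = (\<Sum>l\<in>I. K i l * L l j)"

definition herm_on :: "'i set \<Rightarrow> ('i \<Rightarrow> 'i \<Rightarrow> complex) \<Rightarrow> bool" where
  "herm_on I K \<longleftrightarrow> (\<forall>i\<in>I. \<forall>j\<in>I. K j i = cnj (K i j))"

definition psd_on :: "'i set \<Rightarrow> ('i \<Rightarrow> 'i \<Rightarrow> complex) \<Rightarrow> bool" where
  "psd_on I K \<longleftrightarrow> herm_on I K \<and> (\<forall>x. 0 \<le> Re (ip_on I x (ap_on I K x)))"

text \<open>The operator norm on the Hilbert space of functions on \<open>I\<close> is at most
  \<open>c\<close>.\<close>

definition op_bound :: "'i set \<Rightarrow> real \<Rightarrow> ('i \<Rightarrow> 'i \<Rightarrow> complex) \<Rightarrow> bool" where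
  "op_bound I c K \<longleftrightarrow> (\<forall>x. L2_set (\<lambda>i. cmod (ap_on I K x i)) I \<le> c * L2_set (\<lambda>i. cmod (x i)) I)"

lemma herm_onI: "(\<And>i j. i \<in> I \<Longrightarrow> j \<in> I \<Longrightarrow> cnj (K i j) = K j i) \<Longrightarrow> herm_on I K"
  unfolding herm_on_def by metis

lemma herm_onD: "herm_on I K \<Longrightarrow> i \<in> I \<Longrightarrow> j \<in> I \<Longrightarrow> cnj (K i j) = K j i"
  unfolding herm_on_def by metis

lemma psd_onD: "psd_on I K \<Longrightarrow> herm_on I K" "psd_on I K \<Longrightarrow> 0 \<le> Re (ip_on I x (ap_on I K x))"
  unfolding psd_on_def by auto

lemma ip_on_cong: "(\<And>i. i \<in> I \<Longrightarrow> x i = x' i) \<Longrightarrow> (\<And>i. i \<in> I \<Longrightarrow> y i = y' i) \<Longrightarrow> ip_on I x y = ip_on I x' y'"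
  unfolding ip_on_def by (intro sum.cong) auto

lemma ap_on_cong: "(\<And>i j. i \<in> I \<Longrightarrow> j \<in> I \<Longrightarrow> K i j = L i j) \<Longrightarrow> i \<in> I \<Longrightarrow> ap_on I K x i = ap_on I L x i"
  unfolding ap_on_def by (intro sum.cong) auto

lemma psd_on_cong: 
  assumes "\<And>i j. i \<in> I \<Longrightarrow> j \<in> I \<Longrightarrow> K i j = L i j"
  shows "psd_on I K \<longleftrightarrow> psd_on I L"
proof -
  have "ip_on I x (ap_on I K x) = ip_on I x (ap_on I L x)" for x
    by (rule ip_on_cong) (auto intro: ap_on_cong assms)
  then show ?thesis unfolding psd_on_def herm_on_def using assms by auto
qed

lemma ip_on_self: "ip_on I x x = complex_of_real ((L2_set (\<lambda>i. cmod (x i)) I)\<^sup>2)"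
proof -
  have "(L2_set (\<lambda>i. cmod (x i)) I)\<^sup>2 = (\<Sum>i\<in>I. (cmod (x i))\<^sup>2)"
    by (simp add: L2_set_def sum_nonneg)
  then show ?thesis unfolding ip_on_def
    by (simp add: complex_norm_square mult.commute del: of_real_power)
qed

lemma ip_on_diff_left: "ip_on I (\<lambda>i. x i - x' i) y = ip_on I x y - ip_on I x' y"
  and ip_on_diff_right: "ip_on I x (\<lambda>i. y i - y' i) = ip_on I x y - ip_on I x y'"
  by (simp_all add: ip_on_def algebra_simps sum.distrib sum_subtractf)

lemma ap_on_diff: "ap_on I K (\<lambda>i. x i - y i) = (\<lambda>i. ap_on I K x i - ap_on I K y i)"
  by (simp add: ap_on_def fun_eq_iff algebra_simps sum_subtractf)

lemma ap_on_kernel_mult: 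
  assumes "finite I" shows "ap_on I (kernel_mult I K L) x = ap_on I K (ap_on I L x)"
proof
  fix i
  have "ap_on I (kernel_mult I K L) x i = (\<Sum>j\<in>I. \<Sum>l\<in>I. K i l * L l j * x j)"
    by (simp add: ap_on_def kernel_mult_def sum_distrib_right)
  also have "\<dots> = (\<Sum>l\<in>I. \<Sum>j\<in>I. K i l * L l j * x j)" by (rule sum.swap)
  also have "\<dots> = ap_on I K (ap_on I L x) i" by (simp add: ap_on_def sum_distrib_left mult.assoc)
  finally show "ap_on I (kernel_mult I K L) x i = ap_on I K (ap_on I L x) i" .
qed

lemma ip_on_ap_on: "ip_on I x (ap_on I K y) = (\<Sum>i\<in>I. \<Sum>j\<in>I. cnj (x i) * K i j * y j)"
  by (simp add: ip_on_def ap_on_def sum_distrib_left mult.assoc)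

lemma herm_on_ip_on: 
  assumes "herm_on I K" shows "ip_on I x (ap_on I K y) = ip_on I (ap_on I K x) y"
proof -
  have "ip_on I (ap_on I K x) y = (\<Sum>j\<in>I. \<Sum>i\<in>I. cnj (K j i) * cnj (x i) * y j)"
    by (simp add: ip_on_def ap_on_def sum_distrib_right)
  also have "\<dots> = (\<Sum>i\<in>I. \<Sum>j\<in>I. cnj (K j i) * cnj (x i) * y j)" by (rule sum.swap)
  also have "\<dots> = (\<Sum>i\<in>I. \<Sum>j\<in>I. cnj (x i) * K i j * y j)"
  proof (intro sum.cong refl)
    fix i j assume "i \<in> I" "j \<in> I"
    then have "K i j = cnj (K j i)" using assms unfolding herm_on_def by blast
    then show "cnj (K j i) * cnj (x i) * y j = cnj (x i) * K i j * y j" by simp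
  qed
  finally show ?thesis by (simp add: ip_on_ap_on)
qed

lemma op_bound_mult:
  assumes "finite I" "0 \<le> c" "op_bound I c K" "op_bound I c' L"
  shows "op_bound I (c * c') (kernel_mult I K L)"
  unfolding op_bound_def
proof
  fix x
  have "L2_set (\<lambda>i. cmod (ap_on I (kernel_mult I K L) x i)) I \<le> c * L2_set (\<lambda>i. cmod (ap_on I L x i)) I"
    using assms(3) unfolding op_bound_def ap_on_kernel_mult[OF assms(1)] by blast
  also have "\<dots> \<le> c * (c' * L2_set (\<lambda>i. cmod (x i)) I)"
    using assms(2,4) unfolding op_bound_def by (intro mult_left_mono) auto
  finally show "L2_set (\<lambda>i. cmod (ap_on I (kernel_mult I K L) x i)) I \<le> c * c' * L2_set (\<lambda>i. cmod (x i)) I"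
    by (simp add: mult.assoc)
qed

lemma op_bound_add:
  assumes "op_bound I c K" "op_bound I c' L"
  shows "op_bound I (c + c') (\<lambda>i j. K i j + L i j)"
  unfolding op_bound_def
proof
  fix x
  have "L2_set (\<lambda>i. cmod (ap_on I (\<lambda>i j. K i j + L i j) x i)) I
      \<le> L2_set (\<lambda>i. cmod (ap_on I K x i) + cmod (ap_on I L x i)) I"
    by (intro L2_set_mono) (simp_all add: ap_on_def algebra_simps sum.distrib norm_triangle_ineq)
  also have "\<dots> \<le> L2_set (\<lambda>i. cmod (ap_on I K x i)) I + L2_set (\<lambda>i. cmod (ap_on I L x i)) I"
    by (rule L2_set_triangle_ineq)
  also have "\<dots> \<le> c * L2_set (\<lambda>i. cmod (x i)) I + c' * L2_set (\<lambda>i. cmod (x i)) I"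
    using assms unfolding op_bound_def by (intro add_mono) auto
  finally show "L2_set (\<lambda>i. cmod (ap_on I (\<lambda>i j. K i j + L i j) x i)) I \<le> (c + c') * L2_set (\<lambda>i. cmod (x i)) I"
    by (simp add: algebra_simps)
qed

lemma op_bound_scale:
  assumes "op_bound I c K" 
  shows "op_bound I (cmod a * c) (\<lambda>i j. a * K i j)"
  unfolding op_bound_def
proof
  fix x
  have "(\<lambda>i. cmod (ap_on I (\<lambda>i j. a * K i j) x i)) = (\<lambda>i. cmod a * cmod (ap_on I K x i))"
    unfolding norm_mult[symmetric] by (simp add: ap_on_def fun_eq_iff sum_distrib_left mult.assoc)
  then show "L2_set (\<lambda>i. cmod (ap_on I (\<lambda>i j. a * K i j) x i)) I \<le> cmod a * c * L2_set (\<lambda>i. cmod (x i)) I"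
    using assms unfolding op_bound_def by (simp add: L2_set_right_distrib[symmetric] mult.assoc mult_left_mono)
qed

lemma op_bound_entry:
  assumes "finite I" "op_bound I c K" "i \<in> I" "j \<in> I" shows "cmod (K i j) \<le> c"
proof -
  define e where "e = (\<lambda>l. if l = j then 1 else 0 :: complex)"
  have "cmod (K i j) = cmod (ap_on I K e i)"
    using assms by (simp add: ap_on_def e_def if_distrib[of "(*) _"] cong: if_cong)
  also have "\<dots> \<le> L2_set (\<lambda>i. cmod (ap_on I K e i)) I"
    using assms by (intro member_le_L2_set) auto
  also have "\<dots> \<le> c * L2_set (\<lambda>i. cmod (e i)) I" using assms unfolding op_bound_def by blast
  also have "L2_set (\<lambda>i. cmod (e i)) I = 1"
  proof -
    have "(\<Sum>i\<in>I. (cmod (e i))\<^sup>2) = (\<Sum>i\<in>I. if i = j then 1 else 0)"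
      by (rule sum.cong) (auto simp: e_def)
    then show ?thesis using assms by (simp add: L2_set_def)
  qed
  finally show ?thesis by simp
qed

section \<open>Contractions and the square root iteration\<close>

definition kdelta :: "'i \<Rightarrow> 'i \<Rightarrow> complex" where
  "kdelta i j = (if i = j then 1 else 0)"

lemma ap_on_kdelta: "finite I \<Longrightarrow> i \<in> I \<Longrightarrow> ap_on I kdelta x i = x i"
  by (simp add: ap_on_def kdelta_def if_distrib[of "\<lambda>a. a * _"] cong: if_cong)

text \<open>The estimate is \<open>K - K\<^sup>2 = K (1 - K) K + (1 - K) K (1 - K) \<ge> 0\<close>.\<close>

lemma psd_contraction:
  assumes fin: "finite I" and K: "psd_on I K" and L: "psd_on I (\<lambda>i j. kdelta i j - K i j)"
  shows "op_bound I 1 K"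
  unfolding op_bound_def
proof
  fix x
  define y where "y = ap_on I K x"
  define z where "z = (\<lambda>i. x i - y i)"
  have apL: "ap_on I (\<lambda>i j. kdelta i j - K i j) v i = v i - ap_on I K v i" if "i \<in> I" for v i
    using ap_on_kdelta[OF fin that, of v] by (simp add: ap_on_def algebra_simps sum_subtractf)
  have "ip_on I y (ap_on I (\<lambda>i j. kdelta i j - K i j) y) = ip_on I y y - ip_on I y (ap_on I K y)"
    unfolding ip_on_diff_right[symmetric] by (rule ip_on_cong) (simp_all add: apL)
  then have 1: "Re (ip_on I y (ap_on I K y)) \<le> Re (ip_on I y y)"
    using L unfolding psd_on_def by (auto dest!: spec[where x=y])
  have 2: "0 \<le> Re (ip_on I z (ap_on I K z))" and 3: "0 \<le> Re (ip_on I x (ap_on I (\<lambda>i j. kdelta i j - K i j) x))"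
    using K L unfolding psd_on_def by auto
  have herm: "herm_on I K" using K unfolding psd_on_def by auto
  have yKx: "ip_on I x (ap_on I K y) = ip_on I y y" unfolding y_def by (rule herm_on_ip_on[OF herm])
  have zK: "ap_on I K z = (\<lambda>i. y i - ap_on I K y i)"
    unfolding z_def ap_on_diff by (simp add: y_def)
  have "ip_on I z (ap_on I K z) = ip_on I x y - ip_on I y y - (ip_on I y y - ip_on I y (ap_on I K y))"
    unfolding zK ip_on_diff_right by (simp add: z_def ip_on_diff_left yKx)
  \<comment> \<open>Facts 1 and 2 are the two summands of the identity evaluated at
    \<open>x\<close>; their sum says \<open>K^2 \<le> K\<close> there. Fact 3 is
    \<open>K \<le> 1\<close>.\<close>
  with 1 2 have 4: "Re (ip_on I y y) \<le> Re (ip_on I x y)" by simp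
  have "ip_on I x (ap_on I (\<lambda>i j. kdelta i j - K i j) x) = ip_on I x x - ip_on I x y"
    unfolding ip_on_diff_right[symmetric] by (rule ip_on_cong) (simp_all add: apL y_def)
  with 3 4 have "Re (ip_on I y y) \<le> Re (ip_on I x x)" by simp
  then have "(L2_set (\<lambda>i. cmod (y i)) I)\<^sup>2 \<le> (L2_set (\<lambda>i. cmod (x i)) I)\<^sup>2"
    by (simp add: ip_on_self del: of_real_power)
  then show "L2_set (\<lambda>i. cmod (ap_on I K x i)) I \<le> 1 * L2_set (\<lambda>i. cmod (x i)) I"
    unfolding y_def mult_1 by (rule power2_le_imp_le) (rule L2_set_nonneg)
qed

text \<open>The iteration \<open>W \<mapsto> (Z + W\<^sup>2) / 2\<close> from \<open>0\<close> converges to \<open>1 - sqrt (1 - Z)\<close> whenever \<open>\<parallel>Z\<parallel> \<le> 1\<close>: it is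
  dominated by the scalar iteration at \<open>Z = 1\<close>. This gives square roots without spectral theory.\<close>

fun scalar_iter :: "nat \<Rightarrow> real" where
  "scalar_iter 0 = 0"
| "scalar_iter (Suc k) = (1 + (scalar_iter k)\<^sup>2) / 2"

lemma scalar_iter_bounds: "0 \<le> scalar_iter k \<and> scalar_iter k \<le> 1"
  by (induction k) (auto simp: power_le_one)

text \<open>The increment is \<open>(1 - t)^2 / 2\<close> for
  \<open>t = scalar_iter k\<close>.\<close>

lemma scalar_iter_mono: "scalar_iter k \<le> scalar_iter (Suc k)"
proof -
  have "0 \<le> (1 - scalar_iter k)\<^sup>2" by simp
  then show ?thesis by (simp add: power2_eq_square algebra_simps)
qed

lemma convergent_scalar_iter: "convergent scalar_iter"
proof -
  have "incseq scalar_iter" by (rule incseq_SucI) (rule scalar_iter_mono)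
  then show ?thesis
    using scalar_iter_bounds by (metis incseq_convergent convergentI)
qed

fun kernel_iter :: "'i set \<Rightarrow> ('i \<Rightarrow> 'i \<Rightarrow> complex) \<Rightarrow> nat \<Rightarrow> 'i \<Rightarrow> 'i \<Rightarrow> complex" where
  "kernel_iter I Z 0 i j = 0"
| "kernel_iter I Z (Suc k) i j = (1/2) * (Z i j + kernel_mult I (kernel_iter I Z k) (kernel_iter I Z k) i j)"

lemma kernel_iter_bound:
  assumes "finite I" "op_bound I 1 Z" shows "op_bound I (scalar_iter k) (kernel_iter I Z k)"
proof (induction k)
  case 0
  show ?case by (simp add: op_bound_def ap_on_def L2_set_def)
next
  case (Suc k)
  have "op_bound I (cmod (1/2) * (1 + scalar_iter k * scalar_iter k)) (\<lambda>i j. (1/2) * (Z i j + kernel_mult I (kernel_iter I Z k) (kernel_iter I Z k) i j))"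
    using assms Suc scalar_iter_bounds by (intro op_bound_scale op_bound_add op_bound_mult) auto
  moreover have "kernel_iter I Z (Suc k) = (\<lambda>i j. (1/2) * (Z i j + kernel_mult I (kernel_iter I Z k) (kernel_iter I Z k) i j))"
    by (intro ext) simp
  moreover have "cmod (1/2) * (1 + scalar_iter k * scalar_iter k) = scalar_iter (Suc k)"
    by (simp add: power2_eq_square)
  ultimately show ?case by (simp only:)
qed

text \<open>By \<open>W^2 - V^2 = W (W - V) + (W - V) V\<close>, the norms of the increments are
  dominated by the recursion that the scalar increments satisfy with equality.\<close>

lemma kernel_iter_step:
  assumes "finite I" "op_bound I 1 Z" 
  shows "op_bound I (scalar_iter (Suc k) - scalar_iter k) (\<lambda>i j. kernel_iter I Z (Suc k) i j - kernel_iter I Z k i j)"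
proof (induction k)
  case 0
  show ?case using op_bound_scale[OF assms(2), of "1/2"] by (simp add: kernel_mult_def)
next
  case (Suc k)
  let ?W = "kernel_iter I Z (Suc k)" and ?V = "kernel_iter I Z k"
  have "op_bound I (cmod (1/2) * (scalar_iter (Suc k) * (scalar_iter (Suc k) - scalar_iter k) + (scalar_iter (Suc k) - scalar_iter k) * scalar_iter k))
      (\<lambda>i j. (1/2) * (kernel_mult I ?W (\<lambda>i j. ?W i j - ?V i j) i j + kernel_mult I (\<lambda>i j. ?W i j - ?V i j) ?V i j))"
    using scalar_iter_bounds[of "Suc k"] scalar_iter_mono[of k]
    by (intro op_bound_scale op_bound_add op_bound_mult[OF assms(1) _ kernel_iter_bound[OF assms] Suc] op_bound_mult[OF assms(1) _ Suc kernel_iter_bound[OF assms]])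
      (simp_all del: scalar_iter.simps)
  moreover have "(\<lambda>i j. (1/2) * (kernel_mult I ?W (\<lambda>i j. ?W i j - ?V i j) i j + kernel_mult I (\<lambda>i j. ?W i j - ?V i j) ?V i j))
      = (\<lambda>i j. (1/2) * (kernel_mult I ?W ?W i j - kernel_mult I ?V ?V i j))"
    unfolding kernel_mult_def sum.distrib[symmetric] sum_subtractf[symmetric] 
    by (intro ext arg_cong[where f="\<lambda>x. 1/2 * x"] sum.cong refl) (simp add: algebra_simps del: kernel_iter.simps)
  moreover have "(1/2) * (kernel_mult I ?W ?W i j - kernel_mult I ?V ?V i j) = kernel_iter I Z (Suc (Suc k)) i j - ?W i j" for i j
    by (simp only: kernel_iter.simps(2)) (simp add: algebra_simps)
  moreover have "cmod (1/2) * (scalar_iter (Suc k) * (scalar_iter (Suc k) - scalar_iter k) + (scalar_iter (Suc k) - scalar_iter k) * scalar_iter k)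
      = ((scalar_iter (Suc k))\<^sup>2 - (scalar_iter k)\<^sup>2) / 2"
    by (simp only: power2_eq_square) (simp add: field_simps del: scalar_iter.simps)
  moreover have "((scalar_iter (Suc k))\<^sup>2 - (scalar_iter k)\<^sup>2) / 2 = scalar_iter (Suc (Suc k)) - scalar_iter (Suc k)"
    by (simp only: scalar_iter.simps(2)) (simp add: field_simps)
  ultimately show ?case by (simp only:)
qed

lemma kernel_iter_diff:
  assumes "finite I" "op_bound I 1 Z" "k \<le> m"
  shows "op_bound I (scalar_iter m - scalar_iter k) (\<lambda>i j. kernel_iter I Z m i j - kernel_iter I Z k i j)"
  using assms(3)
proof (induction m rule: dec_induct)
  case base
  show ?case by (simp add: op_bound_def ap_on_def L2_set_def)
next
  case (step m)
  have "op_bound I ((scalar_iter (Suc m) - scalar_iter m) + (scalar_iter m - scalar_iter k))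
     (\<lambda>i j. (kernel_iter I Z (Suc m) i j - kernel_iter I Z m i j) + (kernel_iter I Z m i j - kernel_iter I Z k i j))"
    by (intro op_bound_add kernel_iter_step assms step)
  then show ?case by (simp del: kernel_iter.simps scalar_iter.simps)
qed

text \<open>The rate on the right does not depend on \<open>Z\<close>. This makes the convergence
  uniform over all characters, which is what convergence in the C*-norm requires.\<close>

lemma kernel_iter_entry:
  assumes "finite I" "op_bound I 1 Z" "i \<in> I" "j \<in> I"
  shows "cmod (kernel_iter I Z m i j - kernel_iter I Z k i j) \<le> \<bar>scalar_iter m - scalar_iter k\<bar>"
proof (cases "k \<le> m")
  case True
  then show ?thesis using op_bound_entry[OF assms(1) kernel_iter_diff[OF assms(1,2) True] assms(3,4)] by simp
next
  case False
  then have "m \<le> k" by simp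
  then show ?thesis using op_bound_entry[OF assms(1) kernel_iter_diff[OF assms(1,2) \<open>m \<le> k\<close>] assms(3,4)]
    by (simp add: norm_minus_commute)
qed

lemma herm_on_kernel_iter: "herm_on I Z \<Longrightarrow> herm_on I (kernel_iter I Z k)"
proof (induction k)
  case 0
  show ?case by (simp add: herm_on_def)
next
  case (Suc k)
  have km: "kernel_mult I (kernel_iter I Z k) (kernel_iter I Z k) j i = cnj (kernel_mult I (kernel_iter I Z k) (kernel_iter I Z k) i j)" if "i \<in> I" "j \<in> I" for i j
    unfolding kernel_mult_def cnj_sum complex_cnj_mult
  proof (rule sum.cong[OF refl])
    fix l assume "l \<in> I"
    then have "kernel_iter I Z k l i = cnj (kernel_iter I Z k i l)" "kernel_iter I Z k j l = cnj (kernel_iter I Z k l j)"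
      using Suc that unfolding herm_on_def by blast+
    then show "kernel_iter I Z k j l * kernel_iter I Z k l i = cnj (kernel_iter I Z k i l) * cnj (kernel_iter I Z k l j)" by simp
  qed
  show ?case
    unfolding herm_on_def
  proof (intro ballI)
    fix i j assume ij: "i \<in> I" "j \<in> I"
    have "Z j i = cnj (Z i j)" using Suc.prems ij unfolding herm_on_def by blast
    with km[OF ij] show "kernel_iter I Z (Suc k) j i = cnj (kernel_iter I Z (Suc k) i j)"
      unfolding kernel_iter.simps complex_cnj_mult complex_cnj_add by simp
  qed
qed

section \<open>Gelfand theory\<close>

definition star_char :: "('a, 'b) cstar_alg_scheme \<Rightarrow> ('a \<Rightarrow> complex) \<Rightarrow> bool" where
  "star_char A \<xi> \<longleftrightarrow>
     (\<forall>x\<in>carrier A. \<forall>y\<in>carrier A. \<xi> (x \<oplus>\<^bsub>A\<^esub> y) = \<xi> x + \<xi> y \<and> \<xi> (x \<otimes>\<^bsub>A\<^esub> y) = \<xi> x * \<xi> y) \<and>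
     (\<forall>x\<in>carrier A. \<forall>c. \<xi> (c \<odot>\<^bsub>A\<^esub> x) = c * \<xi> x) \<and> \<xi> \<one>\<^bsub>A\<^esub> = 1 \<and>
     (\<forall>x\<in>carrier A. \<xi> (adj A x) = cnj (\<xi> x) \<and> cmod (\<xi> x) \<le> cnorm A x)"

text \<open>A set of characters that computes the norm. All characters of the given algebra form
  such a set, and so do the point evaluations of an algebra of bounded functions, so positivity can
  be characterised once for both. For empty \<open>X\<close> the restriction to
  \<open>c \<ge> 0\<close> makes the condition say that the algebra is zero.\<close>

definition norming :: "('a, 'b) cstar_alg_scheme \<Rightarrow> ('a \<Rightarrow> complex) set \<Rightarrow> bool" where
  "norming A X \<longleftrightarrow> (\<forall>\<xi>\<in>X. star_char A \<xi>) \<and>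
     (\<forall>x\<in>carrier A. \<forall>c\<ge>0. (\<forall>\<xi>\<in>X. cmod (\<xi> x) \<le> c) \<longrightarrow> cnorm A x \<le> c)"

lemma le_mult_INF:
  fixes h :: "'b \<Rightarrow> real"
  assumes "C \<noteq> {}" "0 \<le> a" "\<And>p. p \<in> C \<Longrightarrow> z \<le> a * h p"
  shows "z \<le> a * (INF p\<in>C. h p)"
proof (cases "a = 0")
  case True
  then show ?thesis using assms by auto
next
  case False
  then have "z / a \<le> (INF p\<in>C. h p)"
    using assms by (intro cINF_greatest) (auto simp: divide_simps mult.commute)
  then show ?thesis using False assms(2) by (simp add: divide_simps mult.commute split: if_splits)
qed

context comm_cstar_algebra
begin

section \<open>Arithmetic of scalars, adjoint and norm\<close>

lemma smult_cl [simp, intro]: "x \<in> carrier A \<Longrightarrow> c \<odot> x \<in> carrier A"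
  by (rule smult_closed) simp_all

lemma smult_add_left: "x \<in> carrier A \<Longrightarrow> (c + d) \<odot> x = c \<odot> x \<oplus> d \<odot> x"
  using smult_l_distr[of c d x] by simp

lemma smult_add_right: "x \<in> carrier A \<Longrightarrow> y \<in> carrier A \<Longrightarrow> c \<odot> (x \<oplus> y) = c \<odot> x \<oplus> c \<odot> y"
  using smult_r_distr[of c x y] by simp

lemma smult_smult: "x \<in> carrier A \<Longrightarrow> c \<odot> (d \<odot> x) = (c * d) \<odot> x"
  using smult_assoc1[of c d x] by simp

lemma smult_1 [simp]: "x \<in> carrier A \<Longrightarrow> 1 \<odot> x = x"
  using smult_one[of x] by simp

lemma smult_0 [simp]: "x \<in> carrier A \<Longrightarrow> 0 \<odot> x = \<zero>"
  using smult_l_null[of x] by simp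

lemma smult_minus_1: "x \<in> carrier A \<Longrightarrow> (-1) \<odot> x = \<ominus> x"
proof -
  assume x: "x \<in> carrier A"
  have "x \<oplus> (-1) \<odot> x = \<zero>"
    using smult_add_left[OF x, of 1 "-1"] x by simp
  then show ?thesis using x by (metis add.inv_equality a_comm smult_cl)
qed

lemma minus_eq_smult: "x \<in> carrier A \<Longrightarrow> y \<in> carrier A \<Longrightarrow> x \<ominus> y = x \<oplus> (-1) \<odot> y"
  by (simp add: smult_minus_1 a_minus_def)

lemma smult_mult_left: "x \<in> carrier A \<Longrightarrow> y \<in> carrier A \<Longrightarrow> (c \<odot> x) \<otimes> y = c \<odot> (x \<otimes> y)"
  using smult_assoc2[of c x y] by simp

lemma smult_mult_right: "x \<in> carrier A \<Longrightarrow> y \<in> carrier A \<Longrightarrow> x \<otimes> (c \<odot> y) = c \<odot> (x \<otimes> y)"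
  using smult_mult_left[of y x c] by (simp add: m_comm)

lemma adj_one: "adj A \<one> = \<one>"
proof -
  have "adj A (\<one> \<otimes> adj A \<one>) = adj A (adj A \<one>) \<otimes> adj A \<one>"
    by (rule adj_mult) (simp_all add: adj_closed)
  then show ?thesis by (simp add: adj_adj adj_closed)
qed

lemma cnorm_one:
  assumes "\<one> \<noteq> \<zero>" shows "cnorm A \<one> = 1"
proof -
  have "cnorm A \<one> = (cnorm A \<one>)\<^sup>2"
    using cstar_identity[of \<one>] by (simp add: adj_one)
  moreover have "cnorm A \<one> \<noteq> 0" using assms by (simp add: cnorm_eq_0_iff)
  ultimately show ?thesis by (simp add: power2_eq_square)
qed

text \<open>This is the source of the cardinality argument: a type that carries a nonzero algebra
  has at least continuum many elements.\<close>

lemma inj_scalars: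
  assumes "\<one> \<noteq> \<zero>" shows "inj (\<lambda>c. c \<odot> \<one>)"
proof (rule injI)
  fix c c' :: complex assume eq: "c \<odot> \<one> = c' \<odot> \<one>"
  have "(c - c') \<odot> \<one> = c' \<odot> \<one> \<oplus> (- c') \<odot> \<one>"
    using smult_add_left[of \<one> c "- c'"] eq by simp
  also have "\<dots> = \<zero>" using smult_add_left[of \<one> c' "- c'"] by simp
  finally have "cmod (c - c') * cnorm A \<one> = cnorm A \<zero>" using cnorm_smult[of \<one> "c - c'"] by simp
  moreover have "cnorm A \<zero> = 0" by (simp add: cnorm_eq_0_iff)
  ultimately show "c = c'" by (simp add: cnorm_one[OF assms])
qed

text \<open>By commutativity the C*-identity for \<open>x \<otimes> x\<close> involves the square of
  the self-adjoint element \<open>h = adj A x \<otimes> x\<close>, and it can be applied again to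
  \<open>h\<close> and to \<open>x\<close>.\<close>

lemma cnorm_square:
  assumes x: "x \<in> carrier A" shows "cnorm A (x \<otimes> x) = (cnorm A x)\<^sup>2"
proof -
  let ?h = "adj A x \<otimes> x"
  note cl = x adj_closed[OF x]
  have h: "adj A ?h = ?h" using cl by (simp add: adj_mult adj_adj)
  have "(cnorm A (x \<otimes> x))\<^sup>2 = cnorm A (adj A (x \<otimes> x) \<otimes> (x \<otimes> x))"
    using cl by (simp add: cstar_identity)
  also have "adj A (x \<otimes> x) \<otimes> (x \<otimes> x) = adj A ?h \<otimes> ?h"
    unfolding h using cl by (simp add: adj_mult m_ac)
  also have "cnorm A (adj A ?h \<otimes> ?h) = (cnorm A ?h)\<^sup>2"
    using cl by (simp add: cstar_identity)
  also have "cnorm A ?h = (cnorm A x)\<^sup>2" using cl by (simp add: cstar_identity)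
  finally show ?thesis
    by (rule power2_eq_imp_eq) (use cl in \<open>simp_all add: cnorm_nonneg\<close>)
qed

text \<open>Values outside the carrier are fixed so that seminorms can be compared as functions on
  the whole type.\<close>

definition square_seminorm :: "('a \<Rightarrow> real) \<Rightarrow> bool" where
  "square_seminorm p \<longleftrightarrow> (\<forall>x. x \<notin> carrier A \<longrightarrow> p x = 0) \<and> p \<one> = 1 \<and>
     (\<forall>x\<in>carrier A. 0 \<le> p x \<and> p x \<le> cnorm A x \<and> p (x \<otimes> x) = (p x)\<^sup>2 \<and> (\<forall>c. p (c \<odot> x) = cmod c * p x)) \<and>
     (\<forall>x\<in>carrier A. \<forall>y\<in>carrier A. p (x \<oplus> y) \<le> p x + p y \<and> p (x \<otimes> y) \<le> p x * p y)"

lemma square_seminormD: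
  assumes "square_seminorm p" "x \<in> carrier A"
  shows "0 \<le> p x" "p x \<le> cnorm A x" "p (x \<otimes> x) = (p x)\<^sup>2" "p (c \<odot> x) = cmod c * p x" "p \<one> = 1"
    "y \<in> carrier A \<Longrightarrow> p (x \<oplus> y) \<le> p x + p y" "y \<in> carrier A \<Longrightarrow> p (x \<otimes> y) \<le> p x * p y"
  using assms unfolding square_seminorm_def by auto

text \<open>Equality is available only for exponents that are powers of two, since squaring is the
  only operation on which \<open>p\<close> is assumed multiplicative.\<close>

lemma square_seminorm_pow2:
  assumes "square_seminorm p" "b \<in> carrier A"
  shows "p (b [^] ((2::nat) ^ k)) = p b ^ (2 ^ k)"
proof (induction k)
  case 0
  then show ?case using assms by simp
next
  case (Suc k)
  have "b [^] ((2::nat) ^ Suc k) = b [^] ((2::nat) ^ k) \<otimes> b [^] ((2::nat) ^ k)"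
    using assms by (simp add: nat_pow_mult mult_2)
  then show ?case
    using square_seminormD(3)[OF assms(1), of "b [^] ((2::nat) ^ k)"] assms Suc
    by (simp add: power_mult[symmetric] mult.commute)
qed

text \<open>A minimal seminorm is multiplicative, because localising at \<open>b\<close> does not increase it. The property
  \<open>p (x\<^sup>2) = (p x)\<^sup>2\<close>, which holds for C*-norms, keeps \<open>p \<one> = 1\<close> under localisation.\<close>

lemma square_seminorm_localize:
  assumes p: "square_seminorm p" and b: "b \<in> carrier A" and pb: "p b > 0"
  obtains q where "square_seminorm q" "\<And>x. q x \<le> p x" "\<And>x. x \<in> carrier A \<Longrightarrow> q (x \<otimes> b) = q x * p b"
    "\<And>x. x \<in> carrier A \<Longrightarrow> (\<lambda>n. p (x \<otimes> b [^] (n::nat)) / p b ^ n) \<longlonglongrightarrow> q x"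
proof -
  \<comment> \<open>Submultiplicativity makes \<open>s x\<close> decreasing; its limit is the
    localisation of \<open>p\<close> at \<open>b\<close>.\<close>
  define s where "s = (\<lambda>x n. p (x \<otimes> b [^] (n::nat)) / p b ^ n)"
  have bn [simp]: "b [^] (n::nat) \<in> carrier A" for n using b by simp
  have s0: "0 \<le> s x n" if "x \<in> carrier A" for x n
    unfolding s_def using square_seminormD(1)[OF p] that pb by simp
  have dec: "s x (Suc n) \<le> s x n" if x: "x \<in> carrier A" for x n
  proof -
    have "p (x \<otimes> b [^] Suc n) \<le> p (x \<otimes> b [^] n) * p b"
      using square_seminormD(7)[OF p, of "x \<otimes> b [^] n" b] x b by (simp add: m_assoc)
    then show ?thesis unfolding s_def using pb by (simp add: divide_simps mult.commute mult.left_commute)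
  qed
  have conv: "convergent (s x)" if x: "x \<in> carrier A" for x
  proof -
    have "decseq (s x)" using dec[OF x] by (rule decseq_SucI)
    then show ?thesis using s0[OF x] by (metis decseq_convergent convergentI)
  qed
  define q where "q = (\<lambda>x. if x \<in> carrier A then lim (s x) else 0)"
  have lim: "s x \<longlonglongrightarrow> q x" if "x \<in> carrier A" for x
    using conv[OF that] that by (simp add: q_def convergent_LIMSEQ_iff)
  have s_at0: "s x 0 = p x" if "x \<in> carrier A" for x using that by (simp add: s_def)
  have le: "q x \<le> p x" for x
  proof (cases "x \<in> carrier A")
    case True
    have "s x n \<le> p x" for n
    proof (induction n)
      case (Suc n) then show ?case using dec[OF True, of n] by linarith
    qed (simp add: s_at0 True)
    then show ?thesis using lim[OF True] by (meson LIMSEQ_le_const2)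
  next
    case False
    then show ?thesis using p by (simp add: q_def square_seminorm_def)
  qed
  have one: "q \<one> = 1"
  proof -
    \<comment> \<open>Along exponents \<open>2^k\<close> the quotient is exactly 1, which determines
      the limit.\<close>
    have "(\<lambda>k. s \<one> (2 ^ k)) \<longlonglongrightarrow> q \<one>"
      using LIMSEQ_subseq_LIMSEQ[OF lim[of \<one>], of "\<lambda>k. 2 ^ k"]
      by (simp add: strict_mono_def comp_def)
    moreover have "s \<one> (2 ^ k) = 1" for k
      using square_seminorm_pow2[OF p b, of k] pb by (simp add: s_def)
    ultimately show ?thesis by (simp add: LIMSEQ_const_iff)
  qed
  \<comment> \<open>Doubling the exponent lets \<open>b^(2n)\<close> be shared equally between the
    two factors of a product.\<close>
  have lim2: "(\<lambda>n. s x (n + n)) \<longlonglongrightarrow> q x" if "x \<in> carrier A" for x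
    using LIMSEQ_subseq_LIMSEQ[OF lim[OF that], of "\<lambda>n. n + n"] by (simp add: strict_mono_def comp_def)
  have split: "x \<otimes> y \<otimes> b [^] (n + n) = (x \<otimes> b [^] n) \<otimes> (y \<otimes> b [^] n)"
    if "x \<in> carrier A" "y \<in> carrier A" for x y and n :: nat
    using that b by (simp add: nat_pow_mult[symmetric] m_ac)
  have sq: "q (x \<otimes> x) = (q x)\<^sup>2" if x: "x \<in> carrier A" for x
  proof (rule LIMSEQ_unique[OF lim2])
    have "s (x \<otimes> x) (n + n) = (s x n)\<^sup>2" for n
      unfolding s_def split[OF x x] using x square_seminormD(3)[OF p, of "x \<otimes> b [^] n"]
      by (simp add: power_divide power_add power2_eq_square)
    then show "(\<lambda>n. s (x \<otimes> x) (n + n)) \<longlonglongrightarrow> (q x)\<^sup>2"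
      using tendsto_power[OF lim[OF x], of 2] by simp
  qed (use x in simp)
  have mul: "q (x \<otimes> y) \<le> q x * q y" if x: "x \<in> carrier A" and y: "y \<in> carrier A" for x y
  proof (rule LIMSEQ_le[OF lim2 tendsto_mult[OF lim[OF x] lim[OF y]]])
    have "s (x \<otimes> y) (n + n) \<le> s x n * s y n" for n
      unfolding s_def split[OF x y] using x y square_seminormD(7)[OF p, of "x \<otimes> b [^] n" "y \<otimes> b [^] n"] pb
      by (simp add: power_add divide_right_mono)
    then show "\<exists>N. \<forall>n\<ge>N. s (x \<otimes> y) (n + n) \<le> s x n * s y n" by blast
  qed (use x y in simp)
  have add: "q (x \<oplus> y) \<le> q x + q y" if x: "x \<in> carrier A" and y: "y \<in> carrier A" for x y
  proof (rule LIMSEQ_le[OF lim tendsto_add[OF lim[OF x] lim[OF y]]])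
    have "s (x \<oplus> y) n \<le> s x n + s y n" for n
      unfolding s_def using x y square_seminormD(6)[OF p, of "x \<otimes> b [^] n" "y \<otimes> b [^] n"] pb
      by (simp add: l_distr divide_right_mono add_divide_distrib[symmetric])
    then show "\<exists>N. \<forall>n\<ge>N. s (x \<oplus> y) n \<le> s x n + s y n" by blast
  qed (use x y in simp)
  have hom: "q (c \<odot> x) = cmod c * q x" if x: "x \<in> carrier A" for c x
  proof (rule LIMSEQ_unique[OF lim])
    have "s (c \<odot> x) = (\<lambda>n. cmod c * s x n)"
    proof
      fix n
      show "s (c \<odot> x) n = cmod c * s x n"
        unfolding s_def using x square_seminormD(4)[OF p, of "x \<otimes> b [^] n" c] by (simp add: smult_mult_left)
    qed
    then show "s (c \<odot> x) \<longlonglongrightarrow> cmod c * q x"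
      using tendsto_mult_left[OF lim[OF x], of "cmod c"] by simp
  qed (use x in simp)
  have bm: "q (x \<otimes> b) = q x * p b" if x: "x \<in> carrier A" for x
  proof (rule LIMSEQ_unique[OF lim])
    have "s (x \<otimes> b) = (\<lambda>n. s x (Suc n) * p b)"
    proof
      fix n
      have "x \<otimes> b \<otimes> b [^] n = x \<otimes> b [^] Suc n" using x b by (simp add: m_ac)
      then show "s (x \<otimes> b) n = s x (Suc n) * p b" unfolding s_def using pb by simp
    qed
    then show "s (x \<otimes> b) \<longlonglongrightarrow> q x * p b"
      using tendsto_mult_right[OF LIMSEQ_Suc[OF lim[OF x]], of "p b"] by simp
  qed (use x b in simp)
  have nonneg: "0 \<le> q x" if "x \<in> carrier A" for x
    using lim[OF that] s0[OF that] by (meson LIMSEQ_le_const)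
  show ?thesis
  proof (rule that)
    show "square_seminorm q"
      unfolding square_seminorm_def using one nonneg sq hom add mul order_trans[OF le square_seminormD(2)[OF p]]
      by (simp add: q_def)
  qed (use le bm lim s_def in auto)
qed

text \<open>Shrinking a seminorm could lose its value at \<open>f\<close>. Membership in
  \<open>S\<close> protects it: \<open>x = \<one>\<close> gives \<open>p f = cnorm A f\<close>. The
  norm localised at \<open>f\<close> shows that \<open>S\<close> is nonempty, pointwise infima of
  nonempty chains stay in \<open>S\<close>, and so does the localisation of a member at any
  \<open>y\<close> with positive seminorm.\<close>

lemma square_seminorm_multiplicative_exists:
  assumes f: "f \<in> carrier A" and nf: "cnorm A f > 0"
  obtains p where "square_seminorm p" "p f = cnorm A f"
    "\<And>x y. x \<in> carrier A \<Longrightarrow> y \<in> carrier A \<Longrightarrow> p (x \<otimes> y) = p x * p y"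
proof -
  define S where "S = {p. square_seminorm p \<and> (\<forall>x\<in>carrier A. p (x \<otimes> f) = p x * cnorm A f)}"
  \<comment> \<open>The order is reversed, so that Zorn's lemma yields a minimal seminorm.\<close>
  define P where "P = (\<lambda>p q :: 'a \<Rightarrow> real. \<forall>x. q x \<le> p x)"
  have ne: "\<one> \<noteq> \<zero>"
  proof
    assume "\<one> = \<zero>"
    then have "f = \<zero>" using f by (metis l_null r_one m_comm zero_closed one_closed)
    then show False using nf f by (simp add: cnorm_eq_0_iff[symmetric])
  qed
  let ?N = "\<lambda>x. if x \<in> carrier A then cnorm A x else 0"
  have N: "square_seminorm ?N"
    unfolding square_seminorm_def
    by (simp add: cnorm_one[OF ne] cnorm_nonneg cnorm_square cnorm_smult cnorm_triangle cnorm_mult)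
  have "?N f > 0" using f nf by simp
  then obtain p0 where "square_seminorm p0" "\<And>x. x \<in> carrier A \<Longrightarrow> p0 (x \<otimes> f) = p0 x * ?N f"
    by (rule square_seminorm_localize[OF N f]) blast
  then have p0: "p0 \<in> S" using f unfolding S_def by simp
  have po: "partial_order_on S (relation_of P S)"
    by (rule partial_order_on_relation_ofI) (auto simp: P_def fun_eq_iff intro: order_trans antisym)
  have "\<exists>u\<in>S. \<forall>a\<in>C. P a u" if C: "C \<in> Chains (relation_of P S)" for C
  proof (cases "C = {}")
    case True
    then show ?thesis using p0 by blast
  next
    case ne: False
    have CS: "C \<subseteq> S" and tot: "\<And>p q. p \<in> C \<Longrightarrow> q \<in> C \<Longrightarrow> P p q \<or> P q p"
      using C unfolding Chains_def relation_of_def by auto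
    have sq: "square_seminorm p" and pf: "x \<in> carrier A \<Longrightarrow> p (x \<otimes> f) = p x * cnorm A f" if "p \<in> C" for p x
      using that CS unfolding S_def by auto
    have nn: "0 \<le> p x" if "p \<in> C" for p x
      using sq[OF that] unfolding square_seminorm_def by (cases "x \<in> carrier A") auto
    define q where "q = (\<lambda>x. INF p\<in>C. p x)"
    have bdd: "bdd_below ((\<lambda>p. p x) ` C)" for x using nn by (intro bdd_belowI2[of _ 0]) auto
    have qle: "q x \<le> p x" if "p \<in> C" for p x
      unfolding q_def using that by (intro cINF_lower bdd)
    have qge: "z \<le> q x" if "\<And>p. p \<in> C \<Longrightarrow> z \<le> p x" for z x
      unfolding q_def using that ne by (intro cINF_greatest)
    have q0: "0 \<le> q x" for x using nn by (intro qge)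
    obtain p1 where p1: "p1 \<in> C" using ne by blast
    \<comment> \<open>Two members of the chain have a common lower member. This allows an inequality
      for one \<open>p\<close> to be passed to two infima taken independently.\<close>
    have lower: "\<exists>p\<in>C. p x \<le> r x \<and> p y \<le> r' y" if "r \<in> C" "r' \<in> C" for r r' x y
      using tot[OF that] that unfolding P_def by blast
    have out: "q x = 0" if "x \<notin> carrier A" for x
    proof -
      have "p1 x = 0" using sq[OF p1] that unfolding square_seminorm_def by blast
      then show ?thesis using qle[OF p1, of x] q0[of x] by simp
    qed
    have one: "q \<one> = 1" 
    proof (rule antisym)
      show "q \<one> \<le> 1" using qle[OF p1, of \<one>] square_seminormD(5)[OF sq[OF p1] one_closed] by simp
      show "1 \<le> q \<one>" by (rule qge) (simp add: square_seminormD(5)[OF sq one_closed])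
    qed
    have mul: "q (x \<otimes> y) \<le> q x * q y" if x: "x \<in> carrier A" and y: "y \<in> carrier A" for x y
    proof -
      have 1: "q (x \<otimes> y) \<le> r x * r' y" if "r \<in> C" "r' \<in> C" for r r'
      proof -
        from lower[OF that] obtain p where p: "p \<in> C" "p x \<le> r x" "p y \<le> r' y" by blast
        have "q (x \<otimes> y) \<le> p x * p y" using qle[OF p(1)] square_seminormD(7)[OF sq[OF p(1)] x y] order_trans by blast
        also have "\<dots> \<le> r x * r' y" using p nn that by (intro mult_mono) auto
        finally show ?thesis .
      qed
      have 2: "q (x \<otimes> y) \<le> q y * r x" if "r \<in> C" for r
        using le_mult_INF[OF ne nn[OF that], of "q (x \<otimes> y)" x "\<lambda>p. p y"] 1[OF that]
        unfolding q_def by (simp add: mult.commute)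
      show ?thesis
        using le_mult_INF[OF ne q0[of y], of "q (x \<otimes> y)" "\<lambda>p. p x"] 2 
        unfolding q_def[of, symmetric] by (simp add: mult.commute q_def)
    qed
    have add: "q (x \<oplus> y) \<le> q x + q y" if x: "x \<in> carrier A" and y: "y \<in> carrier A" for x y
    proof -
      have 1: "q (x \<oplus> y) - r' y \<le> r x" if "r \<in> C" "r' \<in> C" for r r'
      proof -
        from lower[OF that] obtain p where p: "p \<in> C" "p x \<le> r x" "p y \<le> r' y" by blast
        have "q (x \<oplus> y) \<le> p x + p y" using qle[OF p(1)] square_seminormD(6)[OF sq[OF p(1)] x y] order_trans by blast
        then show ?thesis using p by simp
      qed
      have "q (x \<oplus> y) - q x \<le> r' y" if "r' \<in> C" for r'
        using qge[of "q (x \<oplus> y) - r' y" x] 1[OF _ that] by force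
      then show ?thesis using qge[of "q (x \<oplus> y) - q x" y] by force
    qed
    have hom: "q (c \<odot> x) = cmod c * q x" if x: "x \<in> carrier A" for c x
    proof (rule antisym)
      show "q (c \<odot> x) \<le> cmod c * q x"
        unfolding q_def[of] by (rule le_mult_INF[OF ne]) (use qle square_seminormD(4)[OF sq x] in \<open>auto simp: q_def\<close>)
      show "cmod c * q x \<le> q (c \<odot> x)"
        by (rule qge) (simp add: square_seminormD(4)[OF sq x] mult_left_mono qle)
    qed
    have qf: "q (x \<otimes> f) = q x * cnorm A f" if x: "x \<in> carrier A" for x
    proof (rule antisym)
      have "q (x \<otimes> f) \<le> cnorm A f * p x" if "p \<in> C" for p
        using qle[OF that, of "x \<otimes> f"] pf[OF that x] by (simp add: mult.commute)
      then have "q (x \<otimes> f) \<le> cnorm A f * (INF p\<in>C. p x)"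
        by (intro le_mult_INF[OF ne]) (use nf in auto)
      then show "q (x \<otimes> f) \<le> q x * cnorm A f" by (simp add: q_def mult.commute)
      show "q x * cnorm A f \<le> q (x \<otimes> f)"
        by (rule qge) (use nf in \<open>simp add: pf x mult_right_mono qle\<close>)
    qed
    have sqr: "q (x \<otimes> x) = (q x)\<^sup>2" if x: "x \<in> carrier A" for x
    proof (rule antisym)
      show "q (x \<otimes> x) \<le> (q x)\<^sup>2" using mul[OF x x] by (simp add: power2_eq_square)
      show "(q x)\<^sup>2 \<le> q (x \<otimes> x)"
        by (rule qge) (simp add: square_seminormD(3)[OF sq x] power_mono q0 qle)
    qed
    have "square_seminorm q"
      unfolding square_seminorm_def
      by (intro conjI ballI allI impI out one q0 order_trans[OF qle[OF p1] square_seminormD(2)[OF sq[OF p1]]] sqr hom add mul)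
    then have "q \<in> S" unfolding S_def using qf by blast
    then show ?thesis using qle unfolding P_def by blast
  qed
  from predicate_Zorn[OF po this] obtain p
    where p: "p \<in> S" and min: "\<And>q. q \<in> S \<Longrightarrow> P p q \<Longrightarrow> q = p" by blast
  have sp: "square_seminorm p" and pf: "\<And>x. x \<in> carrier A \<Longrightarrow> p (x \<otimes> f) = p x * cnorm A f"
    using p unfolding S_def by auto
  show ?thesis
  proof
    show "square_seminorm p" by fact
    show "p f = cnorm A f" using pf[of \<one>] f square_seminormD(5)[OF sp f] by simp
    fix x y assume x: "x \<in> carrier A" and y: "y \<in> carrier A"
    show "p (x \<otimes> y) = p x * p y"
    proof (cases "p y = 0")
      case True
      then show ?thesis using square_seminormD(7)[OF sp x y] square_seminormD(1)[OF sp, of "x \<otimes> y"] x y by simp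
    next
      case False
      then have py: "p y > 0" using square_seminormD(1)[OF sp y] by simp
      obtain q where q: "square_seminorm q" "\<And>x. q x \<le> p x"
        "\<And>x. x \<in> carrier A \<Longrightarrow> q (x \<otimes> y) = q x * p y"
        "\<And>x. x \<in> carrier A \<Longrightarrow> (\<lambda>n. p (x \<otimes> y [^] (n::nat)) / p y ^ n) \<longlonglongrightarrow> q x"
        by (rule square_seminorm_localize[OF sp y py]) blast
      \<comment> \<open>The localisation at \<open>y\<close> stays in \<open>S\<close>, because
        multiplication by \<open>f\<close> commutes with multiplication by powers of
        \<open>y\<close>. Minimality then forces \<open>q = p\<close>, and \<open>q\<close> is
        multiplicative in the factor \<open>y\<close>.\<close>
      have "q (x \<otimes> f) = q x * cnorm A f" if x: "x \<in> carrier A" for x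
      proof (rule LIMSEQ_unique)
        show "(\<lambda>n. p (x \<otimes> f \<otimes> y [^] (n::nat)) / p y ^ n) \<longlonglongrightarrow> q (x \<otimes> f)"
          using q(4)[of "x \<otimes> f"] x f by simp
        have "p (x \<otimes> f \<otimes> y [^] (n::nat)) = p (x \<otimes> y [^] n) * cnorm A f" for n
          using pf[of "x \<otimes> y [^] n"] x y f by (simp add: m_ac)
        then show "(\<lambda>n. p (x \<otimes> f \<otimes> y [^] (n::nat)) / p y ^ n) \<longlonglongrightarrow> q x * cnorm A f"
          using tendsto_mult_right[of _ "q x" sequentially "cnorm A f"] q(4)[of x] x by fastforce
      qed
      then have "q = p" using min[of q] q unfolding S_def P_def by simp
      then show ?thesis using q(3)[OF x] by simp
    qed
  qed
qed

section \<open>The Gelfand-Mazur theorem and the construction of characters\<close>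

definition shift :: "'a \<Rightarrow> complex \<Rightarrow> 'a" where
  "shift x l = x \<oplus> (- l) \<odot> \<one>"

lemma shift_closed [simp, intro]: "x \<in> carrier A \<Longrightarrow> shift x l \<in> carrier A"
  by (simp add: shift_def)

lemma shift_shift:
  assumes "x \<in> carrier A" shows "shift (shift x l) h = shift x (l + h)"
  using assms smult_add_left[of \<one> "- l" "- h"] by (simp add: shift_def a_assoc)

lemma shift_0: "x \<in> carrier A \<Longrightarrow> shift x 0 = x"
  by (simp add: shift_def)

lemma shift_mult_shift:
  assumes x: "x \<in> carrier A" and y: "y \<in> carrier A"
  shows "shift (x \<otimes> y) (l * m) = shift x l \<otimes> y \<oplus> l \<odot> shift y m"
proof -
  have "shift x l \<otimes> y = x \<otimes> y \<oplus> (- l) \<odot> y"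
    using x y by (simp add: shift_def l_distr smult_mult_left)
  moreover have "l \<odot> shift y m = l \<odot> y \<oplus> (- (l * m)) \<odot> \<one>"
    using y smult_add_right[of y "(- m) \<odot> \<one>" l] by (simp add: shift_def smult_smult)
  moreover have "(- l) \<odot> y \<oplus> l \<odot> y = \<zero>"
    using smult_add_left[OF y, of "- l" l] y by simp
  ultimately show ?thesis
    using x y by (simp add: shift_def a_assoc[symmetric]) (simp add: a_assoc)
qed

lemma shift_square:
  assumes x: "x \<in> carrier A"
  shows "shift x l \<otimes> shift x (- l) = shift (x \<otimes> x) (l\<^sup>2)"
proof -
  have "shift x l \<otimes> shift x (- l) = x \<otimes> x \<oplus> l \<odot> x \<oplus> ((- l) \<odot> x \<oplus> (- (l * l)) \<odot> \<one>)"
    using x by (simp add: shift_def l_distr r_distr smult_mult_left smult_mult_right smult_smult smult_add_right a_ac)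
  also have "\<dots> = x \<otimes> x \<oplus> (l \<odot> x \<oplus> (- l) \<odot> x) \<oplus> (- (l * l)) \<odot> \<one>"
    using x by (simp add: a_assoc)
  also have "l \<odot> x \<oplus> (- l) \<odot> x = \<zero>"
    using smult_add_left[OF x, of l "- l"] x by simp
  finally show ?thesis using x by (simp add: shift_def power2_eq_square)
qed

lemma square_seminorm_smult_one: "square_seminorm p \<Longrightarrow> p (c \<odot> \<one>) = cmod c"
  using square_seminormD(4,5)[of p \<one>] by simp

lemma square_seminorm_shift_le:
  assumes "square_seminorm p" "x \<in> carrier A" shows "p (shift x l) \<le> p x + cmod l"
  using square_seminormD(6)[OF assms, of "(- l) \<odot> \<one>"] square_seminorm_smult_one[OF assms(1), of "- l"]
  by (simp add: shift_def)

lemma square_seminorm_shift_ge: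
  assumes "square_seminorm p" "x \<in> carrier A" shows "cmod l \<le> p (shift x l) + p x"
proof -
  have "(- l) \<odot> \<one> = shift x l \<oplus> (-1) \<odot> x"
    using assms(2) by (simp add: shift_def a_ac smult_minus_1 r_neg2)
  then show ?thesis
    using square_seminormD(6)[OF assms(1) shift_closed, OF assms(2), of "(-1) \<odot> x" l]
      square_seminorm_smult_one[OF assms(1), of "- l"] square_seminormD(4)[OF assms, of "-1"] assms(2) by simp
qed

text \<open>Elementary Gelfand-Mazur theorem: if \<open>l \<mapsto> p (x - l)\<close> had a positive minimum \<open>m\<close>, then, by
  \<open>x\<^sup>N - h\<^sup>N = (x - h) \<cdot> \<dots>\<close> with \<open>N = 2^k\<close>, it would be constant on discs of radius \<open>m\<close> around
  minimisers, hence everywhere.\<close>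

lemma gelfand_mazur:
  assumes p: "square_seminorm p" and mult: "\<And>x y. x \<in> carrier A \<Longrightarrow> y \<in> carrier A \<Longrightarrow> p (x \<otimes> y) = p x * p y"
    and a: "a \<in> carrier A"
  shows "\<exists>l. p (shift a l) = 0"
proof -
  define g where "g = (\<lambda>l. p (shift a l))"
  have g0: "0 \<le> g l" for l unfolding g_def using square_seminormD(1)[OF p] a by simp
  have lip1: "g l \<le> g l' + cmod (l - l')" for l l'
    using square_seminorm_shift_le[OF p shift_closed[OF a], of l' "l - l'"] a
    by (simp add: g_def shift_shift)
  have lip: "dist (g l) (g l') \<le> dist l l'" for l l'
    using lip1[of l l'] lip1[of l' l] by (simp add: dist_norm norm_minus_commute)
  have "continuous_on UNIV g"
    unfolding continuous_on_iff using lip by (metis le_less_trans)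
  then have "continuous_on (cball 0 (2 * p a)) g" by (rule continuous_on_subset) simp
  moreover have pa: "0 \<le> p a" using square_seminormD(1)[OF p a] .
  ultimately obtain l0 where l0: "l0 \<in> cball 0 (2 * p a)" "\<And>l. l \<in> cball 0 (2 * p a) \<Longrightarrow> g l0 \<le> g l"
    using continuous_attains_inf[of "cball 0 (2 * p a)" g] by auto
  define m where "m = g l0"
  \<comment> \<open>Outside the ball \<open>g l\<close> exceeds \<open>p a = g 0\<close>, so the
    minimum over the ball is global.\<close>
  have min: "m \<le> g l" for l
  proof (cases "cmod l \<le> 2 * p a")
    case True
    then show ?thesis using l0 by (simp add: m_def)
  next
    case False
    then have "p a \<le> g l" using square_seminorm_shift_ge[OF p a, of l] by (simp add: g_def)
    moreover have "m \<le> g 0" using l0(2)[of 0] pa by (simp add: m_def)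
    ultimately show ?thesis using a by (simp add: g_def shift_0)
  qed
  have "m = 0"
  proof (rule ccontr)
    assume "m \<noteq> 0"
    then have m: "m > 0" using g0[of l0] by (simp add: m_def)
    have step: "g (l + h) = m" if l: "g l = m" and h: "cmod h < m" for l h
    proof -
      define x where "x = shift a l"
      have x: "x \<in> carrier A" and px: "p x = m" using a l by (simp_all add: x_def g_def)
      have xm: "m \<le> p (shift x h)" for h using min[of "l + h"] a by (simp add: x_def g_def shift_shift)
      define X where "X = (\<lambda>k. x [^] ((2::nat) ^ k))"
      have Xc: "X k \<in> carrier A" for k unfolding X_def using x by simp
      have XS: "X (Suc k) = X k \<otimes> X k" for k
        unfolding X_def using x by (simp add: nat_pow_mult mult_2)
      \<comment> \<open>Repeated complex square roots split \<open>x^(2^k) - c\<close> into linear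
        factors, and \<open>p\<close> is at least \<open>m\<close> on each of them.\<close>
      have 1: "m ^ (2 ^ k) \<le> p (shift (X k) c)" for k c
      proof (induction k arbitrary: c)
        case 0
        then show ?case using xm x by (simp add: X_def)
      next
        case (Suc k)
        have "p (shift (X (Suc k)) c) = p (shift (X k) (csqrt c)) * p (shift (X k) (- csqrt c))"
          using shift_square[OF Xc, of k "csqrt c"] Xc by (simp add: XS mult[symmetric])
        also have "\<dots> \<ge> m ^ (2 ^ k) * m ^ (2 ^ k)"
          using Suc m by (intro mult_mono) (auto intro: square_seminormD(1)[OF p] simp: Xc)
        finally show ?case by (simp add: power_mult power2_eq_square mult.commute[of 2])
      qed
      \<comment> \<open>With \<open>N = 2^k\<close>, the factor \<open>x - h\<close> of
        \<open>x^N - h^N\<close> is kept and the other \<open>N - 1\<close> factors are bounded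
        below by \<open>m\<close>. The extra factor \<open>m\<close> on both sides avoids the
        exponent \<open>N - 1\<close>.\<close>
      have 2: "p (shift x h) * m ^ (2 ^ k) \<le> m * p (shift (X k) (h ^ (2 ^ k)))" for k
      proof (induction k)
        case 0
        then show ?case using x by (simp add: X_def mult.commute)
      next
        case (Suc k)
        let ?c = "h ^ (2 ^ k)"
        have "p (shift x h) * m ^ (2 ^ Suc k) = (p (shift x h) * m ^ (2 ^ k)) * m ^ (2 ^ k)"
          by (simp add: power_mult power2_eq_square mult.commute[of 2])
        also have "\<dots> \<le> (m * p (shift (X k) ?c)) * p (shift (X k) (- ?c))"
          by (rule mult_mono[OF Suc 1]) (use m square_seminormD(1)[OF p] Xc x in auto)
        also have "\<dots> = m * p (shift (X (Suc k)) (?c\<^sup>2))"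
          using shift_square[OF Xc, of k ?c] Xc by (simp add: XS mult[symmetric] mult.assoc)
        also have "?c\<^sup>2 = h ^ (2 ^ Suc k)" by (simp add: power_mult[symmetric] mult.commute)
        finally show ?case .
      qed
      have 3: "p (shift x h) \<le> m + m * (cmod h / m) ^ (2 ^ k)" for k
      proof -
        have "p (shift (X k) (h ^ (2 ^ k))) \<le> m ^ (2 ^ k) + cmod h ^ (2 ^ k)"
          using square_seminorm_shift_le[OF p Xc, of k "h ^ (2 ^ k)"] square_seminorm_pow2[OF p x, of k]
          by (simp add: X_def px norm_power)
        then have "m * p (shift (X k) (h ^ (2 ^ k))) \<le> m * (m ^ (2 ^ k) + cmod h ^ (2 ^ k))"
          using m by simp
        with 2[of k] have "p (shift x h) * m ^ (2 ^ k) \<le> m * (m ^ (2 ^ k) + cmod h ^ (2 ^ k))" by linarith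
        then have "p (shift x h) \<le> m * (m ^ (2 ^ k) + cmod h ^ (2 ^ k)) / m ^ (2 ^ k)"
          using m by (simp add: pos_le_divide_eq)
        also have "\<dots> = m + m * (cmod h / m) ^ (2 ^ k)"
          using m by (simp add: power_divide field_simps)
        finally show ?thesis .
      qed
      have "(\<lambda>n. (cmod h / m) ^ n) \<longlonglongrightarrow> 0" using h m by (intro LIMSEQ_realpow_zero) auto
      from LIMSEQ_subseq_LIMSEQ[OF this, of "\<lambda>k. 2 ^ k"]
      have "(\<lambda>k. (cmod h / m) ^ (2 ^ k)) \<longlonglongrightarrow> 0" by (simp add: strict_mono_def comp_def)
      then have "(\<lambda>k. m + m * (cmod h / m) ^ (2 ^ k)) \<longlonglongrightarrow> m + m * 0" by (intro tendsto_intros)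
      then have "p (shift x h) \<le> m"
        using 3 by (intro LIMSEQ_le_const[where X = "\<lambda>k. m + m * (cmod h / m) ^ (2 ^ k)"]) auto
      then show ?thesis using xm[of h] a by (simp add: g_def x_def shift_shift)
    qed
    \<comment> \<open>Steps of length \<open>m / 2\<close>, inside the radius \<open>m\<close>, lead
      arbitrarily far from \<open>l0\<close> while \<open>g\<close> stays equal to \<open>m\<close>.
      This contradicts \<open>cmod l \<le> g l + p a\<close>.\<close>
    have const: "g (l0 + of_nat n * of_real (m / 2)) = m" for n
    proof (induction n)
      case 0
      then show ?case by (simp add: m_def)
    next
      case (Suc n)
      have "cmod (of_real (m / 2)) < m" using m by simp
      from step[OF Suc this] show ?case by (simp add: algebra_simps add_divide_distrib)
    qed
    obtain n where n: "real n * (m / 2) > m + p a + cmod l0"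
      using m reals_Archimedean3[of "m / 2"] by (metis half_gt_zero)
    have "real n * (m / 2) = cmod (of_nat n * of_real (m / 2))" using m by (simp add: norm_mult)
    also have "\<dots> \<le> cmod (l0 + of_nat n * of_real (m / 2)) + cmod l0"
      by (metis add.commute add_diff_cancel_left' norm_triangle_ineq4 add.commute)
    also have "cmod (l0 + of_nat n * of_real (m / 2)) \<le> m + p a"
      using square_seminorm_shift_ge[OF p a, of "l0 + of_nat n * of_real (m / 2)"] const[of n] by (simp add: g_def)
    finally show False using n by simp
  qed
  then show ?thesis unfolding m_def g_def by blast
qed

text \<open>The character sends \<open>x\<close> to the scalar \<open>l\<close> at which
  \<open>p (x - l)\<close> vanishes. Such a scalar exists by \<open>gelfand_mazur\<close> and is
  unique by the triangle inequality; each algebraic law follows by exhibiting the expected value as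
  a zero.\<close>

lemma square_seminorm_multiplicative_char:
  assumes p: "square_seminorm p" and mult: "\<And>x y. x \<in> carrier A \<Longrightarrow> y \<in> carrier A \<Longrightarrow> p (x \<otimes> y) = p x * p y"
  obtains \<xi> where "star_char A \<xi>" "\<And>x. x \<in> carrier A \<Longrightarrow> cmod (\<xi> x) = p x"
proof -
  define \<xi> where "\<xi> = (\<lambda>x. SOME l. p (shift x l) = 0)"
  have ex: "p (shift x (\<xi> x)) = 0" if "x \<in> carrier A" for x
    unfolding \<xi>_def by (rule someI_ex) (rule gelfand_mazur[OF p mult that])
  have uniq: "\<xi> x = l" if x: "x \<in> carrier A" and l: "p (shift x l) = 0" for x l
  proof -
    have "cmod (\<xi> x - l) \<le> p (shift (shift x l) (\<xi> x - l)) + p (shift x l)"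
      using x by (intro square_seminorm_shift_ge p) simp
    also have "\<dots> = 0" using ex[OF x] l x by (simp add: shift_shift)
    finally show ?thesis by simp
  qed
  have uniq0: "\<xi> x = l" if "x \<in> carrier A" "p (shift x l) \<le> 0" for x l
    using uniq[OF that(1)] that square_seminormD(1)[OF p, of "shift x l"] by force
  have norm: "cmod (\<xi> x) = p x" if x: "x \<in> carrier A" for x
  proof (rule antisym)
    show "cmod (\<xi> x) \<le> p x" using square_seminorm_shift_ge[OF p x, of "\<xi> x"] ex[OF x] by simp
    show "p x \<le> cmod (\<xi> x)"
      using square_seminorm_shift_le[OF p shift_closed[OF x], of "\<xi> x" "- \<xi> x"] ex[OF x] x
      by (simp add: shift_shift shift_0)
  qed
  have add: "\<xi> (x \<oplus> y) = \<xi> x + \<xi> y" if x: "x \<in> carrier A" and y: "y \<in> carrier A" for x y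
  proof (rule uniq0)
    have "shift (x \<oplus> y) (\<xi> x + \<xi> y) = shift x (\<xi> x) \<oplus> shift y (\<xi> y)"
      using x y smult_add_left[of \<one> "- \<xi> x" "- \<xi> y"] by (simp add: shift_def a_ac)
    then show "p (shift (x \<oplus> y) (\<xi> x + \<xi> y)) \<le> 0"
      using square_seminormD(6)[OF p, of "shift x (\<xi> x)" "shift y (\<xi> y)"] ex x y by simp
  qed (use x y in simp)
  have scale: "\<xi> (c \<odot> x) = c * \<xi> x" if x: "x \<in> carrier A" for c x
  proof (rule uniq0)
    have "shift (c \<odot> x) (c * \<xi> x) = c \<odot> shift x (\<xi> x)"
      using x by (simp add: shift_def smult_add_right smult_smult)
    then show "p (shift (c \<odot> x) (c * \<xi> x)) \<le> 0"
      using square_seminormD(4)[OF p, of "shift x (\<xi> x)" c] ex x by simp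
  qed (use x in simp)
  have mul: "\<xi> (x \<otimes> y) = \<xi> x * \<xi> y" if x: "x \<in> carrier A" and y: "y \<in> carrier A" for x y
  proof (rule uniq0)
    show "p (shift (x \<otimes> y) (\<xi> x * \<xi> y)) \<le> 0"
      using square_seminormD(6)[OF p, of "shift x (\<xi> x) \<otimes> y" "\<xi> x \<odot> shift y (\<xi> y)"]
        square_seminormD(4)[OF p, of "shift y (\<xi> y)" "\<xi> x"] ex x y
      by (simp add: shift_mult_shift[OF x y] mult)
  qed (use x y in simp)
  have one: "\<xi> \<one> = 1"
    by (rule uniq0) (use square_seminorm_smult_one[OF p, of 0] smult_add_left[of \<one> 1 "-1"] in \<open>simp_all add: shift_def\<close>)
  have real: "Im (\<xi> h) = 0" if h: "h \<in> carrier A" "adj A h = h" for h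
  proof (rule ccontr)
    assume ne: "Im (\<xi> h) \<noteq> 0"
    define b where "b = Im (\<xi> h)"
    \<comment> \<open>The element \<open>y = h + \<i> t\<close> has
      \<open>adj A y \<otimes> y = h^2 + t^2\<close>, so the C*-identity bounds the square of its
      norm by \<open>(cnorm A h)^2 + t^2\<close>. On the other side the imaginary part of
      \<open>\<xi> y\<close> is \<open>b + t\<close>.\<close>
    have *: "(b + t)\<^sup>2 \<le> (cnorm A h)\<^sup>2 + t\<^sup>2" for t :: real
    proof -
      let ?y = "shift h (- (\<i> * of_real t))"
      have xy: "\<xi> ?y = \<xi> h + \<i> * of_real t"
        using h by (simp add: shift_def add scale one)
      have ay: "adj A ?y = shift h (\<i> * of_real t)"
        using h by (simp add: shift_def adj_add adj_smult adj_one)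
      have yc: "?y \<in> carrier A" using h by simp
      have "(b + t)\<^sup>2 \<le> (cmod (\<xi> ?y))\<^sup>2"
        unfolding xy cmod_power2 by (simp add: b_def)
      also have "\<dots> \<le> (cnorm A ?y)\<^sup>2"
        using norm[OF yc] square_seminormD(1,2)[OF p yc] by (intro power_mono) auto
      also have "\<dots> = cnorm A (shift (h \<otimes> h) ((\<i> * of_real t)\<^sup>2))"
        using cstar_identity[OF yc] shift_square[OF h(1), of "\<i> * of_real t"] by (simp add: ay)
      also have "\<dots> \<le> cnorm A (h \<otimes> h) + cnorm A ((of_real (t\<^sup>2)) \<odot> \<one>)"
        using cnorm_triangle[of "h \<otimes> h" "of_real (t\<^sup>2) \<odot> \<one>"] h
        by (simp add: shift_def power_mult_distrib)
      also have "\<dots> \<le> (cnorm A h)\<^sup>2 + t\<^sup>2"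
      proof -
        have "\<one> \<noteq> \<zero>" using square_seminormD(4)[OF p, of \<one> 0] square_seminormD(5)[OF p one_closed] by force
        then show ?thesis using h by (simp add: cnorm_square cnorm_smult cnorm_one norm_power)
      qed
      finally show ?thesis .
    qed
    have "b\<^sup>2 + 2 * b * t \<le> (cnorm A h)\<^sup>2" for t
      using *[of t] by (simp add: power2_sum)
    \<comment> \<open>This \<open>t\<close> makes \<open>2 b t\<close> exceed the bound by
      1.\<close>
    from this[of "((cnorm A h)\<^sup>2 + 1) / (2 * b)"] ne
    have "b\<^sup>2 + ((cnorm A h)\<^sup>2 + 1) \<le> (cnorm A h)\<^sup>2" by (simp add: b_def)
    then show False using zero_le_power2[of b] by linarith
  qed
  have adj: "\<xi> (adj A x) = cnj (\<xi> x)" if x: "x \<in> carrier A" for x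
  proof -
    note cl = x adj_closed[OF x]
    have "Im (\<xi> (x \<oplus> adj A x)) = 0"
      using cl by (intro real) (auto simp: adj_add adj_adj a_comm)
    moreover have "Im (\<xi> (\<i> \<odot> x \<oplus> (- \<i>) \<odot> adj A x)) = 0"
      using cl by (intro real) (auto simp: adj_add adj_smult adj_adj a_comm)
    ultimately show ?thesis using cl by (simp add: add scale complex_eq_iff)
  qed
  have "star_char A \<xi>"
    unfolding star_char_def using add mul scale one adj norm square_seminormD(2)[OF p] by simp
  then show ?thesis using norm that by blast
qed

lemma gelfand_norming: "norming A {\<xi>. star_char A \<xi>}"
proof -
  have "cnorm A x \<le> c" if x: "x \<in> carrier A" and c: "0 \<le> c" and le: "\<And>\<xi>. star_char A \<xi> \<Longrightarrow> cmod (\<xi> x) \<le> c" for x c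
  proof (cases "cnorm A x = 0")
    case False
    then have "cnorm A x > 0" using cnorm_nonneg[OF x] by simp
    then obtain p where p: "square_seminorm p" "p x = cnorm A x"
      "\<And>x y. x \<in> carrier A \<Longrightarrow> y \<in> carrier A \<Longrightarrow> p (x \<otimes> y) = p x * p y"
      by (rule square_seminorm_multiplicative_exists[OF x]) blast
    obtain \<xi> where "star_char A \<xi>" "\<And>x. x \<in> carrier A \<Longrightarrow> cmod (\<xi> x) = p x"
      by (rule square_seminorm_multiplicative_char[OF p(1)]) (rule p(3), assumption+, rule that, assumption+)
    then show ?thesis using le[of \<xi>] p(2) x by simp
  qed (use c in simp)
  then show ?thesis unfolding norming_def by simp
qed

end

section \<open>Positive matrices over a commutative C*-algebra\<close>

lemma psd_gram: "psd_on I (\<lambda>i j. \<Sum>k\<in>S. cnj (V k i) * V k j)"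
proof -
  have "0 \<le> Re (ip_on I x (ap_on I (\<lambda>i j. \<Sum>k\<in>S. cnj (V k i) * V k j) x))" for x
  proof -
    have "ip_on I x (ap_on I (\<lambda>i j. \<Sum>k\<in>S. cnj (V k i) * V k j) x)
        = (\<Sum>i\<in>I. \<Sum>j\<in>I. \<Sum>k\<in>S. cnj (V k i * x i) * (V k j * x j))"
      by (simp add: ip_on_ap_on sum_distrib_left sum_distrib_right mult_ac)
    also have "\<dots> = (\<Sum>k\<in>S. \<Sum>i\<in>I. \<Sum>j\<in>I. cnj (V k i * x i) * (V k j * x j))"
      by (subst sum.swap[of _ S]) (intro sum.cong refl sum.swap)
    also have "\<dots> = (\<Sum>k\<in>S. cnj (\<Sum>i\<in>I. V k i * x i) * (\<Sum>j\<in>I. V k j * x j))"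
      by (simp add: sum_product)
    also have "\<dots> = of_real (\<Sum>k\<in>S. (cmod (\<Sum>j\<in>I. V k j * x j))\<^sup>2)"
      by (simp only: of_real_sum complex_norm_square mult.commute)
    finally show ?thesis by (simp add: sum_nonneg)
  qed
  then show ?thesis unfolding psd_on_def herm_on_def by (simp add: mult.commute)
qed

lemma psd_scale: "psd_on I K \<Longrightarrow> 0 \<le> c \<Longrightarrow> psd_on I (\<lambda>i j. of_real c * K i j)"
proof -
  assume K: "psd_on I K" and c: "0 \<le> c"
  have "ip_on I x (ap_on I (\<lambda>i j. of_real c * K i j) x) = of_real c * ip_on I x (ap_on I K x)" for x
    by (simp add: ip_on_ap_on sum_distrib_left mult_ac)
  moreover have "herm_on I (\<lambda>i j. of_real c * K i j)"
    by (rule herm_onI) (simp add: herm_onD[OF psd_onD(1)[OF K]])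
  ultimately show ?thesis using psd_onD(2)[OF K] c unfolding psd_on_def by simp
qed

text \<open>Since \<open>M\<close> dominates the operator norm of \<open>K\<close>, both
  \<open>K / M\<close> and \<open>1 - K / M\<close> are positive, and \<open>psd_contraction\<close>
  applies. The entry bounds \<open>c\<close> take the place of \<open>K\<close> in the choice of
  \<open>M\<close>, so that one constant serves all characters; the summand 1 keeps it
  positive.\<close>

lemma psd_bounded_by_entries:
  assumes fin: "finite I" and K: "psd_on I K" and c: "\<And>i j. i \<in> I \<Longrightarrow> j \<in> I \<Longrightarrow> cmod (K i j) \<le> c i j"
    and M: "M = 1 + (\<Sum>i\<in>I. \<Sum>j\<in>I. c i j)"
  shows "op_bound I 1 (\<lambda>i j. kdelta i j - K i j / of_real M)"
proof (rule psd_contraction[OF fin])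
  have cn: "0 \<le> c i j" if "i \<in> I" "j \<in> I" for i j using c[OF that] norm_ge_zero order_trans by blast
  then have Mpos: "M > 0" unfolding M by (intro add_pos_nonneg sum_nonneg) auto
  have "psd_on I (\<lambda>i j. of_real (1 / M) * K i j)" using psd_scale[OF K, of "1 / M"] Mpos by simp
  then show "psd_on I (\<lambda>i j. kdelta i j - (kdelta i j - K i j / of_real M))" by simp
  have "0 \<le> Re (ip_on I x (ap_on I (\<lambda>i j. kdelta i j - K i j / of_real M) x))" for x
  proof -
    define L where "L = L2_set (\<lambda>i. cmod (x i)) I"
    have xl: "cmod (x i) \<le> L" if "i \<in> I" for i
      unfolding L_def using that fin by (intro member_le_L2_set)
    have L0: "0 \<le> L" by (simp add: L_def L2_set_nonneg)
    have "ip_on I x (ap_on I (\<lambda>i j. kdelta i j - K i j / of_real M) x)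
        = ip_on I x (\<lambda>i. x i - ap_on I K x i / of_real M)"
    proof (rule ip_on_cong)
      fix i assume i: "i \<in> I"
      show "ap_on I (\<lambda>i j. kdelta i j - K i j / of_real M) x i = x i - ap_on I K x i / of_real M"
        using ap_on_kdelta[OF fin i, of x] by (simp add: ap_on_def algebra_simps sum_subtractf sum_divide_distrib)
    qed simp
    also have "\<dots> = of_real (L\<^sup>2) - ip_on I x (ap_on I K x) / of_real M"
      unfolding ip_on_diff_right ip_on_self L_def by (simp add: ip_on_def sum_divide_distrib)
    finally have eq: "Re (ip_on I x (ap_on I (\<lambda>i j. kdelta i j - K i j / of_real M) x)) = L\<^sup>2 - Re (ip_on I x (ap_on I K x)) / M"
      by simp
    have "Re (ip_on I x (ap_on I K x)) \<le> cmod (ip_on I x (ap_on I K x))" by (rule complex_Re_le_cmod)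
    also have "\<dots> \<le> (\<Sum>i\<in>I. \<Sum>j\<in>I. cmod (cnj (x i) * K i j * x j))"
      unfolding ip_on_ap_on by (intro sum_norm_le order_refl)
    also have "\<dots> \<le> (\<Sum>i\<in>I. \<Sum>j\<in>I. L * c i j * L)"
      unfolding norm_mult by (intro sum_mono mult_mono) (auto simp: xl c cn L0)
    also have "\<dots> = L\<^sup>2 * (M - 1)"
      by (simp add: M sum_distrib_left power2_eq_square mult_ac)
    also have "\<dots> \<le> L\<^sup>2 * M" by (simp add: mult_left_mono)
    finally show ?thesis unfolding eq using Mpos by (simp add: pos_divide_le_eq)
  qed
  moreover have "herm_on I (\<lambda>i j. kdelta i j - K i j / of_real M)"
    by (rule herm_onI) (simp add: herm_onD[OF psd_onD(1)[OF K]] kdelta_def)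
  ultimately show "psd_on I (\<lambda>i j. kdelta i j - K i j / of_real M)" unfolding psd_on_def by blast
qed

lemma star_charD:
  assumes "star_char A \<xi>" "x \<in> carrier A"
  shows "y \<in> carrier A \<Longrightarrow> \<xi> (x \<oplus>\<^bsub>A\<^esub> y) = \<xi> x + \<xi> y" "y \<in> carrier A \<Longrightarrow> \<xi> (x \<otimes>\<^bsub>A\<^esub> y) = \<xi> x * \<xi> y"
    "\<xi> (c \<odot>\<^bsub>A\<^esub> x) = c * \<xi> x" "\<xi> \<one>\<^bsub>A\<^esub> = 1" "\<xi> (adj A x) = cnj (\<xi> x)" "cmod (\<xi> x) \<le> cnorm A x"
  using assms unfolding star_char_def by auto

context comm_cstar_algebra
begin

lemma star_char_zero: "star_char A \<xi> \<Longrightarrow> \<xi> \<zero> = 0"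
  using star_charD(3)[of A \<xi> \<one> 0] by simp

lemma star_char_minus: "star_char A \<xi> \<Longrightarrow> x \<in> carrier A \<Longrightarrow> y \<in> carrier A \<Longrightarrow> \<xi> (x \<ominus> y) = \<xi> x - \<xi> y"
  by (simp add: minus_eq_smult star_charD)

lemma star_char_finsum:
  assumes "star_char A \<xi>" "finite S" "\<And>k. k \<in> S \<Longrightarrow> f k \<in> carrier A"
  shows "\<xi> (finsum A f S) = (\<Sum>k\<in>S. \<xi> (f k))"
  using assms(2,3)
proof (induction S rule: finite_induct)
  case empty
  then show ?case by (simp add: star_char_zero assms(1))
next
  case (insert k S)
  have "finsum A f (insert k S) = f k \<oplus> finsum A f S"
    using insert by (intro finsum_insert) auto
  moreover have "finsum A f S \<in> carrier A" using insert by (intro finsum_closed) auto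
  ultimately show ?case using insert by (simp add: star_charD(1)[OF assms(1)])
qed

lemma norming_eqI:
  assumes "norming A X" "x \<in> carrier A" "y \<in> carrier A" "\<And>\<xi>. \<xi> \<in> X \<Longrightarrow> \<xi> x = \<xi> y"
  shows "x = y"
proof -
  have "cnorm A (x \<ominus> y) \<le> 0"
    using assms unfolding norming_def by (auto simp: star_char_minus)
  then have "x \<ominus> y = \<zero>" using assms cnorm_nonneg[of "x \<ominus> y"] by (simp add: cnorm_eq_0_iff[symmetric])
  moreover have "x = (x \<ominus> y) \<oplus> y" using assms by (simp add: a_minus_def a_assoc l_neg)
  ultimately show ?thesis using assms by simp
qed

fun alg_iter :: "'i set \<Rightarrow> ('i \<Rightarrow> 'i \<Rightarrow> 'a) \<Rightarrow> nat \<Rightarrow> 'i \<Rightarrow> 'i \<Rightarrow> 'a" where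
  "alg_iter I Z 0 i j = \<zero>"
| "alg_iter I Z (Suc k) i j = (1/2) \<odot> (Z i j \<oplus> finsum A (\<lambda>l. alg_iter I Z k i l \<otimes> alg_iter I Z k l j) I)"

lemma alg_iter_closed:
  assumes "\<And>i j. i \<in> I \<Longrightarrow> j \<in> I \<Longrightarrow> Z i j \<in> carrier A"
  shows "i \<in> I \<Longrightarrow> j \<in> I \<Longrightarrow> alg_iter I Z k i j \<in> carrier A"
proof (induction k arbitrary: i j)
  case (Suc k)
  then have "finsum A (\<lambda>l. alg_iter I Z k i l \<otimes> alg_iter I Z k l j) I \<in> carrier A"
    by (intro finsum_closed) auto
  then show ?case using assms Suc by simp
qed simp

lemma star_char_alg_iter:
  assumes "finite I" "star_char A \<xi>" "\<And>i j. i \<in> I \<Longrightarrow> j \<in> I \<Longrightarrow> Z i j \<in> carrier A"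
  shows "i \<in> I \<Longrightarrow> j \<in> I \<Longrightarrow> \<xi> (alg_iter I Z k i j) = kernel_iter I (\<lambda>i j. \<xi> (Z i j)) k i j"
proof (induction k arbitrary: i j)
  case 0
  then show ?case by (simp add: star_char_zero assms)
next
  case (Suc k)
  note cl = alg_iter_closed[of I Z, OF assms(3)]
  have "finsum A (\<lambda>l. alg_iter I Z k i l \<otimes> alg_iter I Z k l j) I \<in> carrier A"
    using Suc cl by (intro finsum_closed) auto
  moreover have "\<xi> (finsum A (\<lambda>l. alg_iter I Z k i l \<otimes> alg_iter I Z k l j) I)
      = (\<Sum>l\<in>I. \<xi> (alg_iter I Z k i l \<otimes> alg_iter I Z k l j))"
    using Suc cl assms by (intro star_char_finsum) auto
  moreover have "\<dots> = kernel_mult I (kernel_iter I (\<lambda>i j. \<xi> (Z i j)) k) (kernel_iter I (\<lambda>i j. \<xi> (Z i j)) k) i j"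
    unfolding kernel_mult_def using Suc cl by (intro sum.cong) (auto simp: star_charD(2)[OF assms(2)])
  ultimately show ?case using Suc assms(3) by (simp add: star_charD(1,3)[OF assms(2)])
qed

text \<open>An estimate that is uniform over a norming set is an estimate in norm, so completeness
  of the algebra produces the limit. The sequence \<open>g\<close> carries the common rate.\<close>

lemma norming_complete:
  assumes X: "norming A X" and f: "\<And>n. f n \<in> carrier A" and g: "convergent (g :: nat \<Rightarrow> real)"
    and le: "\<And>\<xi> m n. \<xi> \<in> X \<Longrightarrow> cmod (\<xi> (f m) - \<xi> (f n)) \<le> \<bar>g m - g n\<bar>"
  shows "\<exists>l\<in>carrier A. \<forall>\<xi>\<in>X. (\<lambda>n. \<xi> (f n)) \<longlonglongrightarrow> \<xi> l"
proof -
  have sc: "star_char A \<xi>" if "\<xi> \<in> X" for \<xi> using X that unfolding norming_def by blast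
  have bound: "cnorm A (f m \<ominus> f n) \<le> \<bar>g m - g n\<bar>" for m n
    using X f le unfolding norming_def by (simp add: star_char_minus[OF sc])
  have "\<exists>N. \<forall>m\<ge>N. \<forall>n\<ge>N. cnorm A (f m \<ominus> f n) < e" if e: "e > 0" for e
  proof -
    have "Cauchy g" using g by (rule convergent_Cauchy)
    then obtain N where "\<forall>m\<ge>N. \<forall>n\<ge>N. \<bar>g m - g n\<bar> < e"
      unfolding Cauchy_def dist_real_def using e by blast
    then show ?thesis using bound by (meson le_less_trans)
  qed
  from cnorm_complete[OF f this] obtain l where l: "l \<in> carrier A" "(\<lambda>n. cnorm A (f n \<ominus> l)) \<longlonglongrightarrow> 0"
    by blast
  have "(\<lambda>n. \<xi> (f n)) \<longlonglongrightarrow> \<xi> l" if "\<xi> \<in> X" for \<xi>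
  proof -
    have "cmod (\<xi> (f n) - \<xi> l) \<le> cnorm A (f n \<ominus> l)" for n
      using star_charD(6)[OF sc[OF that], of "f n \<ominus> l"] f l by (simp add: star_char_minus[OF sc[OF that]])
    then have "(\<lambda>n. \<xi> (f n) - \<xi> l) \<longlonglongrightarrow> 0"
      by (intro Lim_null_comparison[OF _ l(2)]) simp
    then show ?thesis by (rule LIM_zero_cancel)
  qed
  with l show ?thesis by blast
qed

text \<open>Let \<open>W\<close> be the limit of the iteration for \<open>Z = 1 - T / M\<close>. The
  fixed point equation \<open>W = (Z + W^2) / 2\<close> means \<open>(1 - W)^2 = T / M\<close>, so
  \<open>sqrt M (1 - W)\<close> is a square root of \<open>T\<close>. The iteration runs inside the
  algebra, and at each character it becomes \<open>kernel_iter\<close>, where contractivity of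
  \<open>Z\<close> is known.\<close>

lemma psd_factorization:
  fixes I :: "'i set"
  assumes X: "norming A X" and fin: "finite I"
    and T: "\<And>i j. i \<in> I \<Longrightarrow> j \<in> I \<Longrightarrow> T i j \<in> carrier A"
    and psd: "\<And>\<xi>. \<xi> \<in> X \<Longrightarrow> psd_on I (\<lambda>i j. \<xi> (T i j))"
  obtains Y where "\<And>i j. i \<in> I \<Longrightarrow> j \<in> I \<Longrightarrow> Y i j \<in> carrier A"
    "\<And>i j \<xi>. i \<in> I \<Longrightarrow> j \<in> I \<Longrightarrow> \<xi> \<in> X \<Longrightarrow> \<xi> (T i j) = (\<Sum>k\<in>I. cnj (\<xi> (Y k i)) * \<xi> (Y k j))"
proof -
  have sc: "star_char A \<xi>" if "\<xi> \<in> X" for \<xi> using X that unfolding norming_def by blast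
  define M where "M = 1 + (\<Sum>i\<in>I. \<Sum>j\<in>I. cnorm A (T i j))"
  have Mpos: "M > 0" unfolding M_def by (intro add_pos_nonneg sum_nonneg) (auto simp: T cnorm_nonneg)
  define e where "e = (\<lambda>i j :: 'i. if i = j then \<one> else \<zero>)"
  have ec [simp]: "e i j \<in> carrier A" for i j by (simp add: e_def)
  define Z where "Z = (\<lambda>i j. e i j \<oplus> of_real (- 1 / M) \<odot> T i j)"
  have Z: "Z i j \<in> carrier A" if "i \<in> I" "j \<in> I" for i j using T[OF that] by (simp add: Z_def)
  have xid: "\<xi> (e i j) = kdelta i j" if "\<xi> \<in> X" for \<xi> i j
    using star_charD(4)[OF sc[OF that] one_closed] star_char_zero[OF sc[OF that]] by (simp add: kdelta_def e_def)
  have xZ: "\<xi> (Z i j) = kdelta i j - \<xi> (T i j) / of_real M" if "\<xi> \<in> X" "i \<in> I" "j \<in> I" for \<xi> i j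
    using T[OF that(2,3)] star_charD(1,3)[OF sc[OF that(1)]] xid[OF that(1)] by (simp add: Z_def)
  have op_bound: "op_bound I 1 (\<lambda>i j. \<xi> (Z i j))" if "\<xi> \<in> X" for \<xi>
  proof -
    have "op_bound I 1 (\<lambda>i j. kdelta i j - \<xi> (T i j) / of_real M)"
      by (rule psd_bounded_by_entries[OF fin psd[OF that] _ M_def]) (simp add: star_charD(6)[OF sc[OF that]] T)
    moreover have "L2_set (\<lambda>i. cmod (ap_on I (\<lambda>i j. \<xi> (Z i j)) x i)) I
        = L2_set (\<lambda>i. cmod (ap_on I (\<lambda>i j. kdelta i j - \<xi> (T i j) / of_real M) x i)) I" for x
    proof (intro L2_set_cong refl)
      fix i assume "i \<in> I"
      then show "cmod (ap_on I (\<lambda>i j. \<xi> (Z i j)) x i) = cmod (ap_on I (\<lambda>i j. kdelta i j - \<xi> (T i j) / of_real M) x i)"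
        using ap_on_cong[of I "\<lambda>i j. \<xi> (Z i j)" "\<lambda>i j. kdelta i j - \<xi> (T i j) / of_real M" i x] xZ[OF that] by simp
    qed
    ultimately show ?thesis unfolding op_bound_def by simp
  qed
  have herm: "herm_on I (\<lambda>i j. \<xi> (Z i j))" if "\<xi> \<in> X" for \<xi>
    by (rule herm_onI) (simp add: xZ that herm_onD[OF psd_onD(1)[OF psd[OF that]]] kdelta_def)
  have "\<exists>l\<in>carrier A. \<forall>\<xi>\<in>X. (\<lambda>n. \<xi> (alg_iter I Z n i j)) \<longlonglongrightarrow> \<xi> l" if ij: "i \<in> I" "j \<in> I" for i j
  proof (rule norming_complete[OF X _ convergent_scalar_iter])
    show "alg_iter I Z n i j \<in> carrier A" for n by (rule alg_iter_closed[OF Z ij])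
    show "cmod (\<xi> (alg_iter I Z m i j) - \<xi> (alg_iter I Z n i j)) \<le> \<bar>scalar_iter m - scalar_iter n\<bar>" if "\<xi> \<in> X" for \<xi> m n
      using kernel_iter_entry[OF fin op_bound[OF that] ij] star_char_alg_iter[OF fin sc[OF that] Z ij] by simp
  qed
  then obtain w where w: "\<And>i j. i \<in> I \<Longrightarrow> j \<in> I \<Longrightarrow> w i j \<in> carrier A"
    and wl: "\<And>i j \<xi>. i \<in> I \<Longrightarrow> j \<in> I \<Longrightarrow> \<xi> \<in> X \<Longrightarrow> (\<lambda>n. \<xi> (alg_iter I Z n i j)) \<longlonglongrightarrow> \<xi> (w i j)"
    by metis
  have lim: "(\<lambda>n. kernel_iter I (\<lambda>i j. \<xi> (Z i j)) n i j) \<longlonglongrightarrow> \<xi> (w i j)" if "i \<in> I" "j \<in> I" "\<xi> \<in> X" for i j \<xi>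
    using wl[OF that] star_char_alg_iter[of I \<xi> Z, OF fin sc[OF that(3)] Z that(1,2)] by simp
  define Y where "Y = (\<lambda>i j. of_real (sqrt M) \<odot> (e i j \<oplus> (-1) \<odot> w i j))"
  show ?thesis
  proof (rule that[of Y])
    show "Y i j \<in> carrier A" if "i \<in> I" "j \<in> I" for i j using w[OF that] by (simp add: Y_def)
    fix i j \<xi> assume i: "i \<in> I" and j: "j \<in> I" and \<xi>: "\<xi> \<in> X"
    define v where "v = (\<lambda>i j. \<xi> (w i j))"
    have xY: "\<xi> (Y k l) = of_real (sqrt M) * (kdelta k l - v k l)" if "k \<in> I" "l \<in> I" for k l
      using w[OF that] star_charD(1,3)[OF sc[OF \<xi>]] xid[OF \<xi>] by (simp add: Y_def v_def)
    \<comment> \<open>The limit is Hermitian, so the product of the adjoint of \<open>Y\<close> with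
      \<open>Y\<close> is the square of \<open>Y\<close>.\<close>
    have vh: "cnj (v k i) = v i k" if k: "k \<in> I" for k
    proof (rule LIMSEQ_unique)
      show "(\<lambda>n. cnj (kernel_iter I (\<lambda>i j. \<xi> (Z i j)) n k i)) \<longlonglongrightarrow> cnj (v k i)"
        unfolding v_def by (intro tendsto_cnj lim k i \<xi>)
      have "cnj (kernel_iter I (\<lambda>i j. \<xi> (Z i j)) n k i) = kernel_iter I (\<lambda>i j. \<xi> (Z i j)) n i k" for n
        by (rule herm_onD[OF herm_on_kernel_iter[OF herm[OF \<xi>]] k i])
      then show "(\<lambda>n. cnj (kernel_iter I (\<lambda>i j. \<xi> (Z i j)) n k i)) \<longlonglongrightarrow> v i k"
        unfolding v_def using lim[OF i k \<xi>] by simp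
    qed
    have "v i j = (1/2) * (\<xi> (Z i j) + kernel_mult I v v i j)"
    proof (rule LIMSEQ_unique)
      show "(\<lambda>n. kernel_iter I (\<lambda>i j. \<xi> (Z i j)) (Suc n) i j) \<longlonglongrightarrow> v i j"
        unfolding v_def using lim[OF i j \<xi>] by (rule LIMSEQ_Suc)
      show "(\<lambda>n. kernel_iter I (\<lambda>i j. \<xi> (Z i j)) (Suc n) i j) \<longlonglongrightarrow> (1/2) * (\<xi> (Z i j) + kernel_mult I v v i j)"
        unfolding kernel_iter.simps kernel_mult_def v_def by (intro tendsto_intros lim i j \<xi>)
    qed
    then have eq: "kernel_mult I v v i j = 2 * v i j - kdelta i j + \<xi> (T i j) / of_real M"
      using xZ[OF \<xi> i j] by (simp add: field_simps)
    have M2: "of_real (sqrt M) * of_real (sqrt M) = (of_real M :: complex)"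
      using Mpos by (simp flip: of_real_mult)
    have "(\<Sum>k\<in>I. cnj (\<xi> (Y k i)) * \<xi> (Y k j)) = (\<Sum>k\<in>I. of_real M * ((kdelta i k - v i k) * (kdelta k j - v k j)))"
    proof (rule sum.cong[OF refl])
      fix k assume k: "k \<in> I"
      have ck: "cnj (kdelta k i) = kdelta i k" by (simp add: kdelta_def)
      show "cnj (\<xi> (Y k i)) * \<xi> (Y k j) = of_real M * ((kdelta i k - v i k) * (kdelta k j - v k j))"
        unfolding M2[symmetric] by (simp add: xY i j k vh[OF k] ck)
    qed
    also have "\<dots> = of_real M * ((\<Sum>k\<in>I. kdelta i k * kdelta k j) - (\<Sum>k\<in>I. kdelta i k * v k j)
        - (\<Sum>k\<in>I. v i k * kdelta k j) + kernel_mult I v v i j)"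
      by (simp add: kernel_mult_def sum_distrib_left[symmetric] algebra_simps sum.distrib sum_subtractf)
    also have "\<dots> = of_real M * (kdelta i j - v i j - v i j + kernel_mult I v v i j)"
      using fin i j by (simp add: kdelta_def if_distrib[of "\<lambda>x. x * _"] if_distrib[of "(*) _"] cong: if_cong)
    also have "\<dots> = \<xi> (T i j)" unfolding eq using Mpos by simp
    finally show "\<xi> (T i j) = (\<Sum>k\<in>I. cnj (\<xi> (Y k i)) * \<xi> (Y k j))" by simp
  qed
qed

end

text \<open>A matrix over \<open>mat_alg d A\<close> is read as one over \<open>A\<close>, indexed
  by pairs of an outer and an inner index.\<close>

definition blocks :: "nat \<Rightarrow> nat \<Rightarrow> (nat \<times> nat) set" where
  "blocks s d = {..<s} \<times> {..<d}"

lemma finite_blocks [simp]: "finite (blocks s d)"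
  by (simp add: blocks_def)

definition entry :: "'a mat mat \<Rightarrow> nat \<times> nat \<Rightarrow> nat \<times> nat \<Rightarrow> 'a" where
  "entry T p q = T $$ (fst p, fst q) $$ (snd p, snd q)"

section \<open>Matrix algebras over matrix algebras\<close>

lemma mat_alg_carrier: "M \<in> carrier (mat_alg n A) \<longleftrightarrow> M \<in> carrier_mat n n \<and> (\<forall>i<n. \<forall>j<n. M $$ (i, j) \<in> carrier A)"
  by (auto simp: mat_alg_def)

lemma mat_alg_entry:
  assumes "i < n" "j < n"
  shows "\<zero>\<^bsub>mat_alg n A\<^esub> $$ (i, j) = \<zero>\<^bsub>A\<^esub>"
    and "\<one>\<^bsub>mat_alg n A\<^esub> $$ (i, j) = (if i = j then \<one>\<^bsub>A\<^esub> else \<zero>\<^bsub>A\<^esub>)"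
    and "(M \<oplus>\<^bsub>mat_alg n A\<^esub> N) $$ (i, j) = M $$ (i, j) \<oplus>\<^bsub>A\<^esub> N $$ (i, j)"
    and "(c \<odot>\<^bsub>mat_alg n A\<^esub> M) $$ (i, j) = c \<odot>\<^bsub>A\<^esub> M $$ (i, j)"
    and "adj (mat_alg n A) M $$ (i, j) = adj A (M $$ (j, i))"
  using assms by (simp_all add: mat_alg_def)

lemma entry_eqI:
  assumes T: "T \<in> carrier (mat_alg s (mat_alg d A))" and P: "P \<in> carrier (mat_alg s (mat_alg d A))"
    and eq: "\<And>p q. p \<in> blocks s d \<Longrightarrow> q \<in> blocks s d \<Longrightarrow> entry T p q = entry P p q"
  shows "T = P"
proof (rule eq_matI)
  show "dim_row T = dim_row P" "dim_col T = dim_col P" using T P by (auto simp: mat_alg_carrier)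
  fix i j assume "i < dim_row P" "j < dim_col P"
  then have ij: "i < s" "j < s" using P by (auto simp: mat_alg_carrier)
  then have c: "T $$ (i, j) \<in> carrier_mat d d" "P $$ (i, j) \<in> carrier_mat d d"
    using T P by (auto simp: mat_alg_carrier)
  show "T $$ (i, j) = P $$ (i, j)"
  proof (rule eq_matI)
    fix a b assume "a < dim_row (P $$ (i, j))" "b < dim_col (P $$ (i, j))"
    then have "a < d" "b < d" using c by auto
    then show "T $$ (i, j) $$ (a, b) = P $$ (i, j) $$ (a, b)"
      using eq[of "(i, a)" "(j, b)"] ij by (simp add: blocks_def entry_def)
  qed (use c in auto)
qed

context comm_cstar_algebra
begin

text \<open>Products in the outer matrix algebra are \<open>finsum\<close>s over the inner one, and
  the laws of \<open>finsum\<close> rest on this structure.\<close>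

lemma abelian_monoid_mat_alg: "abelian_monoid (mat_alg d A)"
  by (rule abelian_monoidI) (auto simp: mat_alg_def a_ac intro!: eq_matI)

lemma finsum_mat_alg:
  assumes "finite S" "\<And>k. k \<in> S \<Longrightarrow> f k \<in> carrier (mat_alg d A)" "a < d" "b < d"
  shows "finsum (mat_alg d A) f S \<in> carrier (mat_alg d A) \<and>
    finsum (mat_alg d A) f S $$ (a, b) = finsum A (\<lambda>k. f k $$ (a, b)) S"
  using assms(1,2)
proof (induction S rule: finite_induct)
  case empty
  interpret B: abelian_monoid "mat_alg d A" by (rule abelian_monoid_mat_alg)
  show ?case using assms(3,4) B.zero_closed by (simp add: mat_alg_entry)
next
  case (insert k S)
  interpret B: abelian_monoid "mat_alg d A" by (rule abelian_monoid_mat_alg)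
  have "finsum (mat_alg d A) f (insert k S) = f k \<oplus>\<^bsub>mat_alg d A\<^esub> finsum (mat_alg d A) f S"
    using insert by (intro B.finsum_insert) auto
  moreover have "finsum A (\<lambda>k. f k $$ (a, b)) (insert k S) = f k $$ (a, b) \<oplus> finsum A (\<lambda>k. f k $$ (a, b)) S"
    using insert assms(3,4) by (intro finsum_insert) (auto simp: mat_alg_carrier)
  moreover have "f k \<in> carrier (mat_alg d A)" "finsum (mat_alg d A) f S \<in> carrier (mat_alg d A)"
    using insert by auto
  ultimately show ?case using insert assms(3,4) B.a_closed
    by (auto simp: mat_alg_entry)
qed

lemma mat_alg_gram:
  assumes y: "y \<in> carrier (mat_alg s (mat_alg d A))"
  shows "adj (mat_alg s (mat_alg d A)) y \<otimes>\<^bsub>mat_alg s (mat_alg d A)\<^esub> y \<in> carrier (mat_alg s (mat_alg d A))"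
    and "\<lbrakk>star_char A \<xi>; p \<in> blocks s d; q \<in> blocks s d\<rbrakk> \<Longrightarrow>
      \<xi> (entry (adj (mat_alg s (mat_alg d A)) y \<otimes>\<^bsub>mat_alg s (mat_alg d A)\<^esub> y) p q) = (\<Sum>r\<in>blocks s d. cnj (\<xi> (entry y r p)) * \<xi> (entry y r q))"
proof -
  let ?P = "adj (mat_alg s (mat_alg d A)) y \<otimes>\<^bsub>mat_alg s (mat_alg d A)\<^esub> y"
  let ?B = "mat_alg d A"
  have yc: "y $$ (k, j) \<in> carrier ?B" if "k < s" "j < s" for k j
    using y that by (simp add: mat_alg_carrier)
  have ye: "y $$ (k, j) $$ (c, b) \<in> carrier A" if "k < s" "j < s" "c < d" "b < d" for k j c b
    using yc[OF that(1,2)] that by (simp add: mat_alg_carrier)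
  define g where "g = (\<lambda>i j k. adj ?B (y $$ (k, i)) \<otimes>\<^bsub>?B\<^esub> y $$ (k, j))"
  have ge: "g i j k $$ (a, b) = finsum A (\<lambda>c. adj A (y $$ (k, i) $$ (c, a)) \<otimes> y $$ (k, j) $$ (c, b)) {..<d}"
    if "i < s" "j < s" "k < s" "a < d" "b < d" for i j k a b
    unfolding g_def mat_alg_def using that ye by (auto intro!: finsum_cong' adj_closed)
  have gA: "finsum A (\<lambda>c. adj A (y $$ (k, i) $$ (c, a)) \<otimes> y $$ (k, j) $$ (c, b)) {..<d} \<in> carrier A"
    if "i < s" "j < s" "k < s" "a < d" "b < d" for i j k a b
    using that ye by (intro finsum_closed) (auto intro!: adj_closed)
  have gc: "g i j k \<in> carrier ?B" if "i < s" "j < s" "k < s" for i j k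
  proof -
    have "g i j k \<in> carrier_mat d d" by (simp add: g_def mat_alg_def)
    then show ?thesis using ge[OF that] gA[OF that] by (simp add: mat_alg_carrier)
  qed
  have Pij: "?P $$ (i, j) = finsum ?B (g i j) {..<s}" if "i < s" "j < s" for i j
  proof -
    interpret B: abelian_monoid "mat_alg d A" by (rule abelian_monoid_mat_alg)
    have "?P $$ (i, j) = finsum ?B (\<lambda>k. adj (mat_alg s ?B) y $$ (i, k) \<otimes>\<^bsub>?B\<^esub> y $$ (k, j)) {..<s}"
      unfolding mat_alg_def[of s] using that by simp
    also have "\<dots> = finsum ?B (g i j) {..<s}"
    proof (rule B.finsum_cong'[OF refl])
      show "g i j \<in> {..<s} \<rightarrow> carrier ?B" using gc that by auto
      show "adj (mat_alg s ?B) y $$ (i, k) \<otimes>\<^bsub>?B\<^esub> y $$ (k, j) = g i j k" if "k \<in> {..<s}" for k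
        using that \<open>i < s\<close> by (simp add: g_def mat_alg_def[of s])
    qed
    finally show ?thesis .
  qed
  have Pc: "?P \<in> carrier_mat s s" by (simp add: mat_alg_def[of s])
  have fs: "finsum ?B (g i j) {..<s} \<in> carrier ?B" if "i < s" "j < s" for i j
  proof -
    interpret B: abelian_monoid "mat_alg d A" by (rule abelian_monoid_mat_alg)
    show ?thesis using gc[OF that] by (intro B.finsum_closed) auto
  qed
  show "?P \<in> carrier (mat_alg s ?B)"
    unfolding mat_alg_carrier[of _ s] using Pc Pij fs by simp
  assume \<xi>: "star_char A \<xi>" and pq: "p \<in> blocks s d" "q \<in> blocks s d"
  obtain i a j b where ij: "p = (i, a)" "q = (j, b)" "i < s" "a < d" "j < s" "b < d"
    using pq by (auto simp: blocks_def)
  have "entry ?P p q = finsum ?B (g i j) {..<s} $$ (a, b)"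
    using Pij ij by (simp add: entry_def)
  also have "\<dots> = finsum A (\<lambda>k. g i j k $$ (a, b)) {..<s}"
    using finsum_mat_alg[of "{..<s}" "g i j" d a b] gc ij by auto
  also have "\<xi> \<dots> = (\<Sum>k<s. \<xi> (g i j k $$ (a, b)))"
    using gA ij ge by (intro star_char_finsum \<xi>) auto
  also have "\<dots> = (\<Sum>k<s. \<Sum>c<d. cnj (\<xi> (y $$ (k, i) $$ (c, a))) * \<xi> (y $$ (k, j) $$ (c, b)))"
  proof (rule sum.cong[OF refl])
    fix k assume k: "k \<in> {..<s}"
    have "\<xi> (g i j k $$ (a, b)) = (\<Sum>c<d. \<xi> (adj A (y $$ (k, i) $$ (c, a)) \<otimes> y $$ (k, j) $$ (c, b)))"
      using ge[of i j k a b] k ij ye by (auto intro!: star_char_finsum \<xi> adj_closed)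
    also have "\<dots> = (\<Sum>c<d. cnj (\<xi> (y $$ (k, i) $$ (c, a))) * \<xi> (y $$ (k, j) $$ (c, b)))"
      using k ij ye by (intro sum.cong refl) (simp add: star_charD[OF \<xi>] adj_closed)
    finally show "\<xi> (g i j k $$ (a, b)) = \<dots>" .
  qed
  finally show "\<xi> (entry ?P p q) = (\<Sum>r\<in>blocks s d. cnj (\<xi> (entry y r p)) * \<xi> (entry y r q))"
    by (simp add: blocks_def sum.cartesian_product entry_def ij split_def)
qed

text \<open>One direction is the positivity of Gram matrices. For the other,
  \<open>psd_factorization\<close> supplies entries for a factor \<open>y\<close>, and the norming
  set separates points, so that agreement at its characters gives an equality of matrices.\<close>

lemma positive_elems_iff:
  assumes X: "norming A X" and T: "T \<in> carrier (mat_alg s (mat_alg d A))"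
  shows "T \<in> positive_elems (mat_alg s (mat_alg d A)) \<longleftrightarrow>
    (\<forall>\<xi>\<in>X. psd_on (blocks s d) (\<lambda>p q. \<xi> (entry T p q)))"
proof
  have sc: "star_char A \<xi>" if "\<xi> \<in> X" for \<xi> using X that unfolding norming_def by blast
  {
    assume "T \<in> positive_elems (mat_alg s (mat_alg d A))"
    then obtain y where y: "y \<in> carrier (mat_alg s (mat_alg d A))"
      and Ty: "T = adj (mat_alg s (mat_alg d A)) y \<otimes>\<^bsub>mat_alg s (mat_alg d A)\<^esub> y"
      unfolding positive_elems_def by blast
    show "\<forall>\<xi>\<in>X. psd_on (blocks s d) (\<lambda>p q. \<xi> (entry T p q))"
    proof
      fix \<xi> assume "\<xi> \<in> X"
      show "psd_on (blocks s d) (\<lambda>p q. \<xi> (entry T p q))"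
        by (rule iffD2[OF psd_on_cong psd_gram]) (rule mat_alg_gram(2)[OF y sc[OF \<open>\<xi> \<in> X\<close>], folded Ty])
    qed
  next
    assume psd: "\<forall>\<xi>\<in>X. psd_on (blocks s d) (\<lambda>p q. \<xi> (entry T p q))"
    have Tc: "entry T p q \<in> carrier A" if "p \<in> blocks s d" "q \<in> blocks s d" for p q
      using T that by (auto simp: mat_alg_carrier blocks_def entry_def)
    obtain Y where Y: "\<And>p q. p \<in> blocks s d \<Longrightarrow> q \<in> blocks s d \<Longrightarrow> Y p q \<in> carrier A"
      and YT: "\<And>p q \<xi>. p \<in> blocks s d \<Longrightarrow> q \<in> blocks s d \<Longrightarrow> \<xi> \<in> X \<Longrightarrow>
        \<xi> (entry T p q) = (\<Sum>r\<in>blocks s d. cnj (\<xi> (Y r p)) * \<xi> (Y r q))"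
    proof (rule psd_factorization[OF X finite_blocks, of s d "entry T"])
      show "psd_on (blocks s d) (\<lambda>p q. \<xi> (entry T p q))" if "\<xi> \<in> X" for \<xi> using psd that by blast
    qed (use Tc in blast)+
    define y where "y = Matrix.mat s s (\<lambda>(i, j). Matrix.mat d d (\<lambda>(a, b). Y (i, a) (j, b)))"
    have y: "y \<in> carrier (mat_alg s (mat_alg d A))"
      using Y by (simp add: mat_alg_carrier y_def blocks_def)
    have ey: "entry y p q = Y p q" if "p \<in> blocks s d" "q \<in> blocks s d" for p q
      using that by (auto simp: y_def entry_def blocks_def)
    let ?P = "adj (mat_alg s (mat_alg d A)) y \<otimes>\<^bsub>mat_alg s (mat_alg d A)\<^esub> y"
    note P = mat_alg_gram[OF y]
    have "entry T p q = entry ?P p q" if pq: "p \<in> blocks s d" "q \<in> blocks s d" for p q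
    proof (rule norming_eqI[OF X])
      show "entry ?P p q \<in> carrier A"
        using P(1) pq by (auto simp: mat_alg_carrier blocks_def entry_def)
      show "\<xi> (entry T p q) = \<xi> (entry ?P p q)" if "\<xi> \<in> X" for \<xi>
        unfolding P(2)[OF sc[OF that] pq] YT[OF pq that] using ey pq by simp
    qed (use Tc pq in blast)
    then have "T = ?P" by (rule entry_eqI[OF T P(1)])
    then show "T \<in> positive_elems (mat_alg s (mat_alg d A))"
      unfolding positive_elems_def using y by blast
  }
qed

end

section \<open>Algebras of bounded functions\<close>

definition linf :: "'k set \<Rightarrow> ('k \<Rightarrow> complex) set" where
  "linf K = {f. (\<forall>k. k \<notin> K \<longrightarrow> f k = 0) \<and> (\<exists>B. \<forall>k. cmod (f k) \<le> B)}"

text \<open>The supremum runs over the whole index type. As the functions vanish off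
  \<open>K\<close>, this makes the norm 0 for empty \<open>K\<close>, where the supremum over
  \<open>K\<close> would be unspecified.\<close>

definition linf_alg :: "'k set \<Rightarrow> 'a set \<Rightarrow> ('a \<Rightarrow> 'k \<Rightarrow> complex) \<Rightarrow> (('k \<Rightarrow> complex) \<Rightarrow> 'a) \<Rightarrow> 'a cstar_alg" where
  "linf_alg K R D E =
    \<lparr>carrier = R, mult = (\<lambda>x y. E (\<lambda>k. D x k * D y k)), one = E (\<lambda>k. if k \<in> K then 1 else 0),
     zero = E (\<lambda>k. 0), add = (\<lambda>x y. E (\<lambda>k. D x k + D y k)), smult = (\<lambda>c x. E (\<lambda>k. c * D x k)),
     adj = (\<lambda>x. E (\<lambda>k. cnj (D x k))), cnorm = (\<lambda>x. SUP k. cmod (D x k))\<rparr>"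

text \<open>The algebra of bounded functions on \<open>K\<close>, transported along a bijection \<open>D\<close> to a subset of the given
  type. Functions are extended by \<open>0\<close> outside \<open>K\<close>.\<close>

locale linf_coding =
  fixes K :: "'k set" and R :: "'a set" and D :: "'a \<Rightarrow> 'k \<Rightarrow> complex" and E :: "('k \<Rightarrow> complex) \<Rightarrow> 'a"
  assumes D: "x \<in> R \<Longrightarrow> D x \<in> linf K" and E: "f \<in> linf K \<Longrightarrow> E f \<in> R"
    and ED: "x \<in> R \<Longrightarrow> E (D x) = x" and DE: "f \<in> linf K \<Longrightarrow> D (E f) = f"
begin

abbreviation "A \<equiv> linf_alg K R D E"

lemma linf_add: "f \<in> linf K \<Longrightarrow> g \<in> linf K \<Longrightarrow> (\<lambda>k. f k + g k) \<in> linf K"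
  unfolding linf_def by simp (metis norm_triangle_mono)

lemma linf_mult:
  assumes "f \<in> linf K" "g \<in> linf K" shows "(\<lambda>k. f k * g k) \<in> linf K"
proof -
  from assms obtain B C where B: "\<And>k. cmod (f k) \<le> B" and C: "\<And>k. cmod (g k) \<le> C"
    unfolding linf_def by blast
  have "cmod (f k * g k) \<le> B * C" for k
    unfolding norm_mult using B[of k] C[of k] order_trans[OF norm_ge_zero B] by (intro mult_mono) auto
  then show ?thesis using assms unfolding linf_def by auto
qed

lemma linf_scale:
  assumes "f \<in> linf K" shows "(\<lambda>k. c * f k) \<in> linf K"
proof -
  from assms obtain B where B: "\<And>k. cmod (f k) \<le> B" unfolding linf_def by blast
  have "cmod (c * f k) \<le> cmod c * B" for k
    unfolding norm_mult using B[of k] by (intro mult_left_mono) auto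
  then show ?thesis using assms unfolding linf_def by auto
qed

lemma linf_cnj: "f \<in> linf K \<Longrightarrow> (\<lambda>k. cnj (f k)) \<in> linf K"
  unfolding linf_def by auto

lemmas linf_ops = linf_add linf_mult linf_scale linf_cnj

lemma zero_linf: "(\<lambda>k. 0) \<in> linf K" and one_linf: "(\<lambda>k. if k \<in> K then 1 else 0) \<in> linf K"
  unfolding linf_def by (auto intro!: exI[of _ 1])

lemma D_ops:
  shows "x \<in> R \<Longrightarrow> y \<in> R \<Longrightarrow> D (x \<oplus>\<^bsub>A\<^esub> y) = (\<lambda>k. D x k + D y k)"
    "x \<in> R \<Longrightarrow> y \<in> R \<Longrightarrow> D (x \<otimes>\<^bsub>A\<^esub> y) = (\<lambda>k. D x k * D y k)"
    "x \<in> R \<Longrightarrow> D (c \<odot>\<^bsub>A\<^esub> x) = (\<lambda>k. c * D x k)"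
    "x \<in> R \<Longrightarrow> D (adj A x) = (\<lambda>k. cnj (D x k))"
    "D \<one>\<^bsub>A\<^esub> = (\<lambda>k. if k \<in> K then 1 else 0)" "D \<zero>\<^bsub>A\<^esub> = (\<lambda>k. 0)"
  by (simp_all add: linf_alg_def DE linf_ops D zero_linf one_linf)

lemma R_ops:
  shows "x \<in> R \<Longrightarrow> y \<in> R \<Longrightarrow> x \<oplus>\<^bsub>A\<^esub> y \<in> R"
    "x \<in> R \<Longrightarrow> y \<in> R \<Longrightarrow> x \<otimes>\<^bsub>A\<^esub> y \<in> R"
    "x \<in> R \<Longrightarrow> c \<odot>\<^bsub>A\<^esub> x \<in> R" "x \<in> R \<Longrightarrow> adj A x \<in> R" "\<one>\<^bsub>A\<^esub> \<in> R" "\<zero>\<^bsub>A\<^esub> \<in> R"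
  by (simp_all add: linf_alg_def E linf_ops D zero_linf one_linf)

text \<open>With \<open>D_ops\<close> this reduces every algebraic law to a pointwise identity of
  complex numbers.\<close>

lemma eqI: "x \<in> R \<Longrightarrow> y \<in> R \<Longrightarrow> (\<And>k. D x k = D y k) \<Longrightarrow> x = y"
  by (metis ED ext)

lemma off: "x \<in> R \<Longrightarrow> k \<notin> K \<Longrightarrow> D x k = 0"
  using D unfolding linf_def by blast

lemma carrier_A [simp]: "carrier A = R"
  by (simp add: linf_alg_def)

lemma cnorm_A: "cnorm A x = (SUP k. cmod (D x k))"
  by (simp add: linf_alg_def)

lemma bdd: "x \<in> R \<Longrightarrow> bdd_above (range (\<lambda>k. cmod (D x k)))"
  using D[of x] unfolding linf_def bdd_above_def by auto

lemma cnorm_upper: "x \<in> R \<Longrightarrow> cmod (D x k) \<le> cnorm A x"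
  unfolding cnorm_A by (intro cSUP_upper bdd) simp

lemma cnorm_least: "(\<And>k. cmod (D x k) \<le> c) \<Longrightarrow> cnorm A x \<le> c"
  unfolding cnorm_A by (intro cSUP_least) auto

lemma cnorm_0: "x \<in> R \<Longrightarrow> 0 \<le> cnorm A x"
  using cnorm_upper[of x undefined] norm_ge_zero order_trans by blast

lemma cring_A: "cring A"
proof (rule cringI)
  show "abelian_group A"
  proof (rule abelian_groupI)
    fix x assume x: "x \<in> carrier A"
    have "((-1) \<odot>\<^bsub>A\<^esub> x) \<oplus>\<^bsub>A\<^esub> x = \<zero>\<^bsub>A\<^esub>"
      by (rule eqI) (use x in \<open>simp_all add: D_ops R_ops\<close>)
    then show "\<exists>y\<in>carrier A. y \<oplus>\<^bsub>A\<^esub> x = \<zero>\<^bsub>A\<^esub>" using x R_ops(3) by auto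
  qed (auto intro!: eqI simp: D_ops R_ops add_ac)
  show "comm_monoid A"
    by (rule comm_monoidI) (auto intro!: eqI simp: D_ops R_ops mult_ac off)
qed (auto intro!: eqI simp: D_ops R_ops algebra_simps)

lemma D_minus: 
  assumes x: "x \<in> R" and y: "y \<in> R"
  shows "D (x \<ominus>\<^bsub>A\<^esub> y) = (\<lambda>k. D x k - D y k)" "x \<ominus>\<^bsub>A\<^esub> y \<in> R"
proof -
  interpret cring A by (rule cring_A)
  have c: "\<ominus>\<^bsub>A\<^esub> y \<in> R" using a_inv_closed[of y] y by simp
  have "D (y \<oplus>\<^bsub>A\<^esub> (\<ominus>\<^bsub>A\<^esub> y)) = (\<lambda>k. 0)" using y r_neg[of y] by (simp add: D_ops)
  then have "D y k + D (\<ominus>\<^bsub>A\<^esub> y) k = 0" for k using y c by (simp add: D_ops fun_eq_iff)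
  then have "D (\<ominus>\<^bsub>A\<^esub> y) k = - D y k" for k by (metis add.inverse_unique)
  then show "D (x \<ominus>\<^bsub>A\<^esub> y) = (\<lambda>k. D x k - D y k)" using x c by (simp add: a_minus_def D_ops)
  show "x \<ominus>\<^bsub>A\<^esub> y \<in> R" using x c by (simp add: a_minus_def R_ops)
qed

lemma linf_complete:
  assumes f: "\<And>n. f n \<in> R" and C: "\<And>e. e > 0 \<Longrightarrow> \<exists>N. \<forall>m\<ge>N. \<forall>n\<ge>N. cnorm A (f m \<ominus>\<^bsub>A\<^esub> f n) < e"
  shows "\<exists>l\<in>R. (\<lambda>n. cnorm A (f n \<ominus>\<^bsub>A\<^esub> l)) \<longlonglongrightarrow> 0"
proof -
  have C': "\<exists>N. \<forall>m\<ge>N. \<forall>n\<ge>N. \<forall>k. cmod (D (f m) k - D (f n) k) < e" if e: "e > 0" for e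
    using C[OF e] cnorm_upper[OF D_minus(2)[OF f f]] by (simp add: D_minus f) (meson le_less_trans)
  have "Cauchy (\<lambda>n. D (f n) k)" for k
    unfolding Cauchy_def dist_norm using C' by meson
  then have "convergent (\<lambda>n. D (f n) k)" for k by (simp add: Cauchy_convergent)
  then obtain g where g: "\<And>k. (\<lambda>n. D (f n) k) \<longlonglongrightarrow> g k" unfolding convergent_def by metis
  have unif: "\<exists>N. \<forall>n\<ge>N. \<forall>k. cmod (D (f n) k - g k) \<le> e" if e: "e > 0" for e
  proof -
    from C'[OF e] obtain N where N: "\<And>m n k. m \<ge> N \<Longrightarrow> n \<ge> N \<Longrightarrow> cmod (D (f m) k - D (f n) k) < e" by metis
    have "cmod (D (f n) k - g k) \<le> e" if n: "n \<ge> N" for n k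
    proof (rule LIMSEQ_le_const2)
      show "(\<lambda>m. cmod (D (f n) k - D (f m) k)) \<longlonglongrightarrow> cmod (D (f n) k - g k)"
        by (intro tendsto_intros g)
      show "\<exists>N. \<forall>m\<ge>N. cmod (D (f n) k - D (f m) k) \<le> e" using N[OF n] less_imp_le by blast
    qed
    then show ?thesis by blast
  qed
  have gl: "g \<in> linf K"
  proof -
    have "g k = 0" if "k \<notin> K" for k using g[of k] off[OF f that] by (simp add: LIMSEQ_const_iff)
    moreover from unif[of 1] obtain N where N: "\<And>k. cmod (D (f N) k - g k) \<le> 1" by auto
    have "cmod (g k) \<le> 1 + cnorm A (f N)" for k
      using N[of k] cnorm_upper[OF f, of N k] norm_triangle_ineq2[of "g k" "D (f N) k"] by (simp add: norm_minus_commute)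
    ultimately show ?thesis unfolding linf_def by blast
  qed
  have "(\<lambda>n. cnorm A (f n \<ominus>\<^bsub>A\<^esub> E g)) \<longlonglongrightarrow> 0"
  proof (rule LIMSEQ_I)
    fix e :: real assume e: "e > 0"
    from unif[of "e / 2"] e obtain N where N: "\<And>n k. n \<ge> N \<Longrightarrow> cmod (D (f n) k - g k) \<le> e / 2" by auto
    have "norm (cnorm A (f n \<ominus>\<^bsub>A\<^esub> E g) - 0) < e" if "n \<ge> N" for n
    proof -
      have "cnorm A (f n \<ominus>\<^bsub>A\<^esub> E g) \<le> e / 2"
        using N[OF that] by (intro cnorm_least) (simp add: D_minus f E gl DE)
      then show ?thesis using cnorm_0[OF D_minus(2)[OF f E[OF gl]], of n] e by simp
    qed
    then show "\<exists>N. \<forall>n\<ge>N. norm (cnorm A (f n \<ominus>\<^bsub>A\<^esub> E g) - 0) < e" by blast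
  qed
  then show ?thesis using E[OF gl] by blast
qed

lemma algebra_linf: "algebra complex_ring A"
proof (rule algebraI)
  show "cring complex_ring"
    by (intro cringI abelian_groupI comm_monoidI) (auto simp: algebra_simps intro: exI[of _ "- _"])
  show "cring A" by (rule cring_A)
qed (auto intro!: eqI simp: D_ops R_ops algebra_simps)

lemma cnorm_scale:
  assumes x: "x \<in> R" shows "cnorm A (c \<odot>\<^bsub>A\<^esub> x) = cmod c * cnorm A x"
proof (rule antisym)
  show "cnorm A (c \<odot>\<^bsub>A\<^esub> x) \<le> cmod c * cnorm A x"
    using x by (intro cnorm_least) (simp add: D_ops norm_mult mult_left_mono cnorm_upper)
  show "cmod c * cnorm A x \<le> cnorm A (c \<odot>\<^bsub>A\<^esub> x)"
  proof (cases "c = 0")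
    case False
    have "cnorm A x \<le> cnorm A (c \<odot>\<^bsub>A\<^esub> x) / cmod c"
    proof (rule cnorm_least)
      fix k
      show "cmod (D x k) \<le> cnorm A (c \<odot>\<^bsub>A\<^esub> x) / cmod c"
        using cnorm_upper[OF R_ops(3)[OF x], of c k] x False
        by (simp add: D_ops norm_mult pos_le_divide_eq mult.commute)
    qed
    then show ?thesis using False by (simp add: pos_le_divide_eq mult.commute)
  qed (use cnorm_0[OF R_ops(3)[OF x]] in simp)
qed

lemma cnorm_cstar:
  assumes x: "x \<in> R" shows "cnorm A (adj A x \<otimes>\<^bsub>A\<^esub> x) = (cnorm A x)\<^sup>2"
proof (rule antisym)
  let ?y = "adj A x \<otimes>\<^bsub>A\<^esub> x"
  have y: "?y \<in> R" using x by (simp add: R_ops)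
  have Dy: "cmod (D ?y k) = (cmod (D x k))\<^sup>2" for k
    using x by (simp add: D_ops R_ops norm_mult power2_eq_square)
  show "cnorm A ?y \<le> (cnorm A x)\<^sup>2"
    by (rule cnorm_least) (simp add: Dy power_mono cnorm_upper x)
  have "cnorm A x \<le> sqrt (cnorm A ?y)"
    by (rule cnorm_least) (rule real_le_rsqrt, use cnorm_upper[OF y] Dy in simp)
  then have "(cnorm A x)\<^sup>2 \<le> (sqrt (cnorm A ?y))\<^sup>2" by (rule power_mono) (rule cnorm_0[OF x])
  then show "(cnorm A x)\<^sup>2 \<le> cnorm A ?y" using cnorm_0[OF y] by simp
qed

lemma comm_cstar_linf: "comm_cstar_algebra A"
proof (intro comm_cstar_algebra.intro comm_cstar_algebra_axioms.intro)
  show "algebra complex_ring A" by (rule algebra_linf)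
  show "cnorm A x = 0 \<longleftrightarrow> x = \<zero>\<^bsub>A\<^esub>" if "x \<in> carrier A" for x
  proof
    assume "cnorm A x = 0"
    then show "x = \<zero>\<^bsub>A\<^esub>" using that cnorm_upper[of x] by (intro eqI) (auto simp: D_ops R_ops)
  next
    assume "x = \<zero>\<^bsub>A\<^esub>"
    then show "cnorm A x = 0" by (simp add: cnorm_A D_ops)
  qed
  show "cnorm A (x \<oplus>\<^bsub>A\<^esub> y) \<le> cnorm A x + cnorm A y" if "x \<in> carrier A" "y \<in> carrier A" for x y
    using that by (intro cnorm_least) (simp add: D_ops norm_triangle_mono cnorm_upper)
  show "cnorm A (x \<otimes>\<^bsub>A\<^esub> y) \<le> cnorm A x * cnorm A y" if "x \<in> carrier A" "y \<in> carrier A" for x y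
    using that by (intro cnorm_least) (simp add: D_ops norm_mult mult_mono cnorm_upper cnorm_0)
  show "\<exists>l\<in>carrier A. (\<lambda>n. cnorm A (f n \<ominus>\<^bsub>A\<^esub> l)) \<longlonglongrightarrow> 0"
    if "\<And>n::nat. f n \<in> carrier A"
      and "\<And>e. e > 0 \<Longrightarrow> \<exists>N. \<forall>m\<ge>N. \<forall>n\<ge>N. cnorm A (f m \<ominus>\<^bsub>A\<^esub> f n) < e" for f
    using linf_complete that by simp
qed (auto intro!: eqI simp: D_ops R_ops cnorm_0 cnorm_scale cnorm_cstar)

text \<open>Evaluation outside \<open>K\<close> kills the unit and is no character. The points of
  \<open>K\<close> suffice because the functions vanish elsewhere.\<close>

lemma norming_linf: "norming A ((\<lambda>k x. D x k) ` K)"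
  unfolding norming_def
proof (intro conjI ballI allI impI)
  fix \<xi> assume "\<xi> \<in> (\<lambda>k x. D x k) ` K"
  then show "star_char A \<xi>" unfolding star_char_def by (auto simp: D_ops cnorm_upper)
next
  fix x c assume x: "x \<in> carrier A" and c: "0 \<le> c" and "\<forall>\<xi>\<in>(\<lambda>k x. D x k) ` K. cmod (\<xi> x) \<le> c"
  then have "cmod (D x k) \<le> c" for k using off[of x k] by (cases "k \<in> K") auto
  then show "cnorm A x \<le> c" by (rule cnorm_least)
qed

end

section \<open>Positive maps and minimal cones\<close>

text \<open>The complex numbers are the bounded functions on one point, with the identity as a
  norming character, so this is the scalar case of \<open>psd_factorization\<close>.\<close>

lemma psd_sqrt:
  fixes I :: "'i set"
  assumes fin: "finite I" and K: "psd_on I K"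
  shows "\<exists>Y. \<forall>i\<in>I. \<forall>j\<in>I. K i j = (\<Sum>k\<in>I. cnj (Y k i) * Y k j)"
proof -
  interpret L: linf_coding "UNIV :: unit set" "UNIV :: complex set" "\<lambda>z _. z" "\<lambda>f. f ()"
    by unfold_locales (auto simp: linf_def)
  interpret comm_cstar_algebra L.A by (rule L.comm_cstar_linf)
  have X: "norming L.A {\<lambda>z. z}" using L.norming_linf by simp
  show ?thesis
    by (rule psd_factorization[OF X fin, of K]) (use K in auto)
qed

text \<open>Factor both kernels: the Kronecker product of two Gram kernels is the Gram kernel of the
  product family.\<close>

lemma psd_kron:
  assumes "finite I" "finite J" "psd_on I K" "psd_on J L"
  shows "psd_on (I \<times> J) (\<lambda>p q. K (fst p) (fst q) * L (snd p) (snd q))"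
proof -
  obtain Y where Y: "\<And>i j. i \<in> I \<Longrightarrow> j \<in> I \<Longrightarrow> K i j = (\<Sum>k\<in>I. cnj (Y k i) * Y k j)"
    using psd_sqrt[OF assms(1,3)] by blast
  obtain Z where Z: "\<And>i j. i \<in> J \<Longrightarrow> j \<in> J \<Longrightarrow> L i j = (\<Sum>k\<in>J. cnj (Z k i) * Z k j)"
    using psd_sqrt[OF assms(2,4)] by blast
  show ?thesis
  proof (rule iffD2[OF psd_on_cong psd_gram])
    fix p q assume pq: "p \<in> I \<times> J" "q \<in> I \<times> J"
    have "K (fst p) (fst q) * L (snd p) (snd q)
        = (\<Sum>k\<in>I. \<Sum>l\<in>J. cnj (Y k (fst p) * Z l (snd p)) * (Y k (fst q) * Z l (snd q)))"
    proof -
      have "fst p \<in> I" "fst q \<in> I" "snd p \<in> J" "snd q \<in> J" using pq by auto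
      then show ?thesis by (simp add: Y Z sum_product mult_ac)
    qed
    then show "K (fst p) (fst q) * L (snd p) (snd q)
        = (\<Sum>r\<in>I \<times> J. cnj ((\<lambda>r p. Y (fst r) (fst p) * Z (snd r) (snd p)) r p)
            * (\<lambda>r p. Y (fst r) (fst p) * Z (snd r) (snd p)) r q)"
      by (simp add: sum.cartesian_product split_def)
  qed
qed

lemma psd_zero: "psd_on I (\<lambda>i j. 0)"
  unfolding psd_on_def herm_on_def by (simp add: ip_on_def ap_on_def)

lemma psd_add: 
  assumes "psd_on I K" "psd_on I L" shows "psd_on I (\<lambda>i j. K i j + L i j)"
proof -
  have "ip_on I x (ap_on I (\<lambda>i j. K i j + L i j) x) = ip_on I x (ap_on I K x) + ip_on I x (ap_on I L x)" for x
    by (simp add: ip_on_ap_on algebra_simps sum.distrib)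
  moreover have "herm_on I (\<lambda>i j. K i j + L i j)"
    by (rule herm_onI) (simp add: herm_onD[OF psd_onD(1)[OF assms(1)]] herm_onD[OF psd_onD(1)[OF assms(2)]])
  ultimately show ?thesis using psd_onD(2)[OF assms(1)] psd_onD(2)[OF assms(2)]
    unfolding psd_on_def by simp
qed

lemma psd_sum:
  assumes "\<And>l. l \<in> S \<Longrightarrow> psd_on I (K l)"
  shows "psd_on I (\<lambda>i j. \<Sum>l\<in>S. K l i j)"
  using assms by (induction S rule: infinite_finite_induct) (auto simp: psd_zero psd_add)

lemma psd_mats_iff: "A \<in> psd_mats s \<longleftrightarrow> A \<in> carrier_mat s s \<and> psd_on {..<s} (\<lambda>i j. A $$ (i, j))"
proof (cases "A \<in> carrier_mat s s")
  case A: True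
  have 1: "mat_adjoint A = A \<longleftrightarrow> herm_on {..<s} (\<lambda>i j. A $$ (i, j))"
  proof
    assume "mat_adjoint A = A"
    show "herm_on {..<s} (\<lambda>i j. A $$ (i, j))"
    proof (rule herm_onI)
      fix i j assume "i \<in> {..<s}" "j \<in> {..<s}"
      then have "mat_adjoint A $$ (j, i) = cnj (A $$ (i, j))"
        using A by (simp add: mat_adjoint_def mat_of_rows_def)
      then show "cnj (A $$ (i, j)) = A $$ (j, i)" using \<open>mat_adjoint A = A\<close> by simp
    qed
  next
    assume h: "herm_on {..<s} (\<lambda>i j. A $$ (i, j))"
    show "mat_adjoint A = A"
      by (rule eq_matI) (use A herm_onD[OF h] in \<open>auto simp: mat_adjoint_def mat_of_rows_def\<close>)
  qed
  have form: "(A *\<^sub>v v) \<bullet>c v = ip_on {..<s} (\<lambda>i. v $ i) (ap_on {..<s} (\<lambda>i j. A $$ (i, j)) (\<lambda>i. v $ i))"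
    if "v \<in> carrier_vec s" for v
    using A that by (auto simp: scalar_prod_def ip_on_def ap_on_def mult.commute lessThan_atLeast0 intro!: sum.cong)
  have 2: "(\<forall>v\<in>carrier_vec s. 0 \<le> Re ((A *\<^sub>v v) \<bullet>c v)) \<longleftrightarrow>
      (\<forall>x. 0 \<le> Re (ip_on {..<s} x (ap_on {..<s} (\<lambda>i j. A $$ (i, j)) x)))"
  proof
    assume L: "\<forall>v\<in>carrier_vec s. 0 \<le> Re ((A *\<^sub>v v) \<bullet>c v)"
    show "\<forall>x. 0 \<le> Re (ip_on {..<s} x (ap_on {..<s} (\<lambda>i j. A $$ (i, j)) x))"
    proof
      fix x
      have "ip_on {..<s} x (ap_on {..<s} (\<lambda>i j. A $$ (i, j)) x)
          = ip_on {..<s} (\<lambda>i. vec s x $ i) (ap_on {..<s} (\<lambda>i j. A $$ (i, j)) (\<lambda>i. vec s x $ i))"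
        by (simp add: ip_on_ap_on)
      then show "0 \<le> Re (ip_on {..<s} x (ap_on {..<s} (\<lambda>i j. A $$ (i, j)) x))"
        using bspec[OF L, of "vec s x"] form[of "vec s x"] by simp
    qed
  qed (simp add: form)
  show ?thesis unfolding psd_mats_def psd_on_def using A 1 2 by simp
qed (simp add: psd_mats_def)

text \<open>Real-linear maps into the \<open>d \<times> d\<close> matrices are encoded by the vectors that represent the real and
  imaginary parts of their entries, so that they live in a separable metric space.\<close>

definition lin_map :: "(nat \<times> nat \<Rightarrow> 'v \<times> 'v) \<Rightarrow> nat \<Rightarrow> nat \<Rightarrow> 'v::euclidean_space \<Rightarrow> complex" where
  "lin_map a i j v = Complex (fst (a (i, j)) \<bullet> v) (snd (a (i, j)) \<bullet> v)"

text \<open>The scalar counterpart of \<open>ampl\<close>, with the blocks flattened to pairs of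
  indices.\<close>

definition amplify :: "(nat \<Rightarrow> nat \<Rightarrow> 'v \<Rightarrow> complex) \<Rightarrow> ('v \<times> 'v) mat \<Rightarrow> nat \<times> nat \<Rightarrow> nat \<times> nat \<Rightarrow> complex" where
  "amplify \<phi> X p q = \<phi> (snd p) (snd q) (fst (X $$ (fst p, fst q))) + \<i> * \<phi> (snd p) (snd q) (snd (X $$ (fst p, fst q)))"

lemma lin_map_add: "lin_map a i j (v + w) = lin_map a i j v + lin_map a i j w"
  and lin_map_diff: "lin_map a i j (v - w) = lin_map a i j v - lin_map a i j w"
  and lin_map_minus: "lin_map a i j (- v) = - lin_map a i j v"
  and lin_map_scale: "lin_map a i j (r *\<^sub>R v) = of_real r * lin_map a i j v"
  and lin_map_zero: "lin_map a i j 0 = 0"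
  by (simp_all add: lin_map_def complex_eq_iff inner_simps)

lemma ev_sum: "lin_map a i j (sum f S) = (\<Sum>l\<in>S. lin_map a i j (f l))"
  by (simp add: lin_map_def complex_eq_iff inner_sum_right)

text \<open>An elementary tensor is sent to a Kronecker product of positive kernels. Positivity at
  level one therefore suffices, which is why every positive map may join a detecting family.\<close>

lemma min_cone_psd:
  assumes X: "X \<in> min_cone F s" and pos: "\<And>c. c \<in> F \<Longrightarrow> psd_on {..<d} (\<lambda>i j. lin_map a i j c)"
  shows "psd_on (blocks s d) (amplify (lin_map a) X)"
proof -
  obtain k :: nat and r A c where X: "X = Matrix.mat s s (\<lambda>(i, j). \<Sum>l<k. r l *\<^sub>R (elem_tensor (A l) (c l) $$ (i, j)))"
    and k: "\<And>l. l < k \<Longrightarrow> 0 \<le> r l \<and> A l \<in> psd_mats s \<and> c l \<in> F"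
    using X unfolding min_cone_def by blast
  have psd: "psd_on (blocks s d) (\<lambda>p q. \<Sum>l<k. of_real (r l) * (A l $$ (fst p, fst q) * lin_map a (snd p) (snd q) (c l)))"
    unfolding blocks_def using k by (intro psd_sum psd_scale psd_kron pos) (auto simp: psd_mats_iff)
  have eq: "amplify (lin_map a) X p q = (\<Sum>l<k. of_real (r l) * (A l $$ (fst p, fst q) * lin_map a (snd p) (snd q) (c l)))"
    if pq: "p \<in> blocks s d" "q \<in> blocks s d" for p q
  proof -
    obtain i b j b' where ij: "p = (i, b)" "q = (j, b')" "i < s" "j < s"
      using pq by (auto simp: blocks_def)
    have et: "elem_tensor (A l) (c l) $$ (i, j) = (Re (A l $$ (i, j)) *\<^sub>R c l, Im (A l $$ (i, j)) *\<^sub>R c l)"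
      if "l < k" for l using k[OF that] ij by (auto simp: elem_tensor_def psd_mats_def)
    have Xij: "X $$ (i, j) = (\<Sum>l<k. r l *\<^sub>R (Re (A l $$ (i, j)) *\<^sub>R c l, Im (A l $$ (i, j)) *\<^sub>R c l))"
      using ij et by (simp add: X)
    have "amplify (lin_map a) X p q = (\<Sum>l<k. of_real (r l) * (of_real (Re (A l $$ (i, j))) * lin_map a b b' (c l)))
        + \<i> * (\<Sum>l<k. of_real (r l) * (of_real (Im (A l $$ (i, j))) * lin_map a b b' (c l)))"
      by (simp add: amplify_def ij Xij fst_sum snd_sum ev_sum lin_map_scale mult.assoc)
    also have "\<dots> = (\<Sum>l<k. of_real (r l) * ((of_real (Re (A l $$ (i, j))) + \<i> * of_real (Im (A l $$ (i, j)))) * lin_map a b b' (c l)))"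
      by (simp add: sum_distrib_left algebra_simps sum.distrib)
    finally show ?thesis by (simp add: ij complex_eq[symmetric])
  qed
  show ?thesis by (rule iffD2[OF psd_on_cong psd]) (rule eq)
qed

lemma HerD:
  assumes "X \<in> Her s V" "i < s" "j < s"
  shows "fst (X $$ (i, j)) \<in> V" "snd (X $$ (i, j)) \<in> V" "X $$ (j, i) = (fst (X $$ (i, j)), - snd (X $$ (i, j)))"
proof -
  have *: "X $$ (i, j) \<in> V \<times> V \<and> X $$ (j, i) = (fst (X $$ (i, j)), - snd (X $$ (i, j)))"
    using assms unfolding Her_def by blast
  then show "X $$ (j, i) = (fst (X $$ (i, j)), - snd (X $$ (i, j)))" by (rule conjunct2)
  from * have "X $$ (i, j) \<in> V \<times> V" by (rule conjunct1)
  then show "fst (X $$ (i, j)) \<in> V" "snd (X $$ (i, j)) \<in> V" by auto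
qed

lemma herm_on_amplify:
  assumes X: "X \<in> Her s V" and h: "\<And>v. v \<in> V \<Longrightarrow> herm_on {..<d} (\<lambda>i j. lin_map a i j v)"
  shows "herm_on (blocks s d) (amplify (lin_map a) X)"
proof (rule herm_onI)
  fix p q assume "p \<in> blocks s d" "q \<in> blocks s d"
  then obtain i b j b' where ij: "p = (i, b)" "q = (j, b')" "i < s" "j < s" "b < d" "b' < d"
    by (auto simp: blocks_def)
  note Xij = HerD(1,2)[OF X ij(3,4)] and Xji = HerD(3)[OF X ij(3,4)]
  from Xij show "cnj (amplify (lin_map a) X p q) = amplify (lin_map a) X q p"
    using herm_onD[OF h[OF Xij(1)], of b b'] herm_onD[OF h[OF Xij(2)], of b b'] ij(5,6)
    by (simp add: amplify_def Xji lin_map_minus ij(1,2))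
qed

text \<open>Extend from a basis of \<open>V\<close> to the whole space and take the Riesz vector.
  This lets maps that are known only on \<open>V\<close> be encoded by vectors.\<close>

lemma linear_functional_repr:
  fixes g :: "'v::euclidean_space \<Rightarrow> real"
  assumes V: "subspace V" and add: "\<And>v w. v \<in> V \<Longrightarrow> w \<in> V \<Longrightarrow> g (v + w) = g v + g w"
    and scale: "\<And>r v. v \<in> V \<Longrightarrow> g (r *\<^sub>R v) = r * g v"
  shows "\<exists>a. \<forall>v\<in>V. g v = a \<bullet> v"
proof -
  obtain B where B: "B \<subseteq> V" "independent B" "span B = V"
    using basis_exists[of V] V by (metis span_subspace)
  obtain f where f: "linear f" "\<And>x. x \<in> B \<Longrightarrow> f x = g x"
    using linear_independent_extend[OF B(2)] by metis
  have g0: "g 0 = 0" using scale[of 0 0] V by (simp add: subspace_0)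
  have "v \<in> V \<and> f v = g v" if "v \<in> span B" for v
    using that
  proof (induction rule: span_induct_alt)
    case base
    then show ?case using f(1) V g0 by (simp add: linear_0 subspace_0)
  next
    case (step c x y)
    then have x: "x \<in> V" "c *\<^sub>R x \<in> V" using B(1) V subspace_scale by blast+
    then show ?case using step f V add[OF x(2)] scale[OF x(1)]
      by (simp add: linear_add linear_scale subspace_add)
  qed
  then have fg: "f v = g v" if "v \<in> V" for v using that B(3) by blast
  have "f v = (\<Sum>b\<in>Basis. f b *\<^sub>R b) \<bullet> v" for v
  proof -
    have "f v = f (\<Sum>b\<in>Basis. (v \<bullet> b) *\<^sub>R b)" by (simp add: euclidean_representation)
    also have "\<dots> = (\<Sum>b\<in>Basis. (v \<bullet> b) * f b)" using f(1) by (simp add: linear_sum linear_scale)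
    also have "\<dots> = (\<Sum>b\<in>Basis. f b *\<^sub>R b) \<bullet> v" by (simp add: inner_sum_left inner_sum_right inner_commute mult.commute)
    finally show ?thesis .
  qed
  with fg show ?thesis by metis
qed

lemma lin_map_repr:
  fixes g :: "nat \<Rightarrow> nat \<Rightarrow> 'v::euclidean_space \<Rightarrow> complex"
  assumes V: "subspace V" and add: "\<And>i j v w. i < d \<Longrightarrow> j < d \<Longrightarrow> v \<in> V \<Longrightarrow> w \<in> V \<Longrightarrow> g i j (v + w) = g i j v + g i j w"
    and scale: "\<And>i j r v. i < d \<Longrightarrow> j < d \<Longrightarrow> v \<in> V \<Longrightarrow> g i j (r *\<^sub>R v) = of_real r * g i j v"
  obtains a where "\<And>i j v. i < d \<Longrightarrow> j < d \<Longrightarrow> v \<in> V \<Longrightarrow> lin_map a i j v = g i j v"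
proof -
  have "\<exists>b. \<forall>v\<in>V. Complex (fst b \<bullet> v) (snd b \<bullet> v) = g i j v" if ij: "i < d" "j < d" for i j
  proof -
    obtain b1 where b1: "\<forall>v\<in>V. Re (g i j v) = b1 \<bullet> v"
      using linear_functional_repr[OF V, of "\<lambda>v. Re (g i j v)"] add[OF ij] scale[OF ij] by auto
    obtain b2 where b2: "\<forall>v\<in>V. Im (g i j v) = b2 \<bullet> v"
      using linear_functional_repr[OF V, of "\<lambda>v. Im (g i j v)"] add[OF ij] scale[OF ij] by auto
    show ?thesis by (rule exI[of _ "(b1, b2)"]) (use b1 b2 in \<open>simp add: complex_eq_iff\<close>)
  qed
  then obtain b where b: "\<And>i j v. i < d \<Longrightarrow> j < d \<Longrightarrow> v \<in> V \<Longrightarrow> Complex (fst (b i j) \<bullet> v) (snd (b i j) \<bullet> v) = g i j v"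
    by metis
  show ?thesis by (rule that[of "\<lambda>p. b (fst p) (snd p)"]) (simp add: lin_map_def b)
qed

text \<open>What remains of an embedding when the algebra is forgotten. Unitality is kept apart,
  because the maps obtained from \<open>C\<close> are unital at \<open>u\<close> and must first be
  changed into maps that are unital at \<open>w\<close>.\<close>

definition detects :: "nat \<Rightarrow> 'v::euclidean_space set \<Rightarrow> 'v set \<Rightarrow> (nat \<times> nat \<Rightarrow> 'v \<times> 'v) set \<Rightarrow> bool" where
  "detects d V C P \<longleftrightarrow> (\<forall>a\<in>P. \<forall>v\<in>V. herm_on {..<d} (\<lambda>i j. lin_map a i j v)) \<and>
     (\<forall>s\<ge>1. \<forall>X\<in>Her s V. X \<in> min_cone C s \<longleftrightarrow> (\<forall>a\<in>P. psd_on (blocks s d) (amplify (lin_map a) X)))"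

context comm_cstar_algebra
begin

lemma ampl_mat_alg:
  assumes \<Phi>: "\<forall>v\<in>V. \<Phi> v \<in> carrier (mat_alg d A)" and X: "X \<in> Her s V"
  shows "ampl (mat_alg d A) \<Phi> X \<in> carrier (mat_alg s (mat_alg d A))"
    and "\<lbrakk>star_char A \<xi>; p \<in> blocks s d; q \<in> blocks s d\<rbrakk> \<Longrightarrow>
      \<xi> (entry (ampl (mat_alg d A) \<Phi> X) p q) = amplify (\<lambda>i j v. \<xi> (\<Phi> v $$ (i, j))) X p q"
proof -
  have Xc: "X \<in> carrier_mat s s" using X unfolding Her_def by blast
  have \<Phi>c: "\<Phi> v \<in> carrier_mat d d" "i < d \<Longrightarrow> j < d \<Longrightarrow> \<Phi> v $$ (i, j) \<in> carrier A" if "v \<in> V" for v i j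
    using \<Phi> that by (auto simp: mat_alg_carrier)
  have e: "ampl (mat_alg d A) \<Phi> X $$ (i, j) =
      \<Phi> (fst (X $$ (i, j))) \<oplus>\<^bsub>mat_alg d A\<^esub> \<i> \<odot>\<^bsub>mat_alg d A\<^esub> \<Phi> (snd (X $$ (i, j)))" if "i < s" "j < s" for i j
    using Xc that by (simp add: ampl_def)
  have e2: "ampl (mat_alg d A) \<Phi> X $$ (i, j) $$ (a, b) =
      \<Phi> (fst (X $$ (i, j))) $$ (a, b) \<oplus> \<i> \<odot> \<Phi> (snd (X $$ (i, j))) $$ (a, b)"
    if "i < s" "j < s" "a < d" "b < d" for i j a b
    using that by (simp add: e mat_alg_entry)
  have dm: "M \<oplus>\<^bsub>mat_alg d A\<^esub> N \<in> carrier_mat d d" for M N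
    by (simp add: mat_alg_def)
  have c: "ampl (mat_alg d A) \<Phi> X $$ (i, j) \<in> carrier (mat_alg d A)" if "i < s" "j < s" for i j
    unfolding mat_alg_carrier using HerD(1,2)[OF X that] that
    by (simp add: e dm mat_alg_entry \<Phi>c)
  have "ampl (mat_alg d A) \<Phi> X \<in> carrier_mat s s" using Xc by (simp add: ampl_def)
  then show "ampl (mat_alg d A) \<Phi> X \<in> carrier (mat_alg s (mat_alg d A))"
    unfolding mat_alg_carrier[of _ s] using c by blast
  assume \<xi>: "star_char A \<xi>" and pq: "p \<in> blocks s d" "q \<in> blocks s d"
  then obtain i a j b where ij: "p = (i, a)" "q = (j, b)" "i < s" "j < s" "a < d" "b < d"
    by (auto simp: blocks_def)
  then show "\<xi> (entry (ampl (mat_alg d A) \<Phi> X) p q) = amplify (\<lambda>i j v. \<xi> (\<Phi> v $$ (i, j))) X p q"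
    using HerD(1,2)[OF X ij(3,4)] by (simp add: entry_def amplify_def e2 star_charD[OF \<xi>] \<Phi>c)
qed

text \<open>Used twice: with all characters for the given embedding, and with point evaluations for
  the constructed one.\<close>

lemma embedding_iff:
  assumes N: "norming A N" and \<Phi>: "\<forall>v\<in>V. \<Phi> v \<in> carrier (mat_alg d A)" and X: "X \<in> Her s V"
  shows "ampl (mat_alg d A) \<Phi> X \<in> positive_elems (mat_alg s (mat_alg d A)) \<longleftrightarrow>
    (\<forall>\<xi>\<in>N. psd_on (blocks s d) (amplify (\<lambda>i j v. \<xi> (\<Phi> v $$ (i, j))) X))"
proof -
  have "psd_on (blocks s d) (\<lambda>p q. \<xi> (entry (ampl (mat_alg d A) \<Phi> X) p q)) \<longleftrightarrow>
      psd_on (blocks s d) (amplify (\<lambda>i j v. \<xi> (\<Phi> v $$ (i, j))) X)" if "\<xi> \<in> N" for \<xi>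
  proof (rule psd_on_cong)
    have "star_char A \<xi>" using N that unfolding norming_def by blast
    then show "p \<in> blocks s d \<Longrightarrow> q \<in> blocks s d \<Longrightarrow>
      \<xi> (entry (ampl (mat_alg d A) \<Phi> X) p q) = amplify (\<lambda>i j v. \<xi> (\<Phi> v $$ (i, j))) X p q" for p q
      by (rule ampl_mat_alg(2)[OF \<Phi> X])
  qed
  then show ?thesis
    using positive_elems_iff[OF N ampl_mat_alg(1)[OF \<Phi> X]] by simp
qed

text \<open>The members of \<open>P\<close> are the codes of the maps \<xi> \<circ> \<Phi>. The
  second conjunct records that the zero algebra has no characters; through it a nonempty
  \<open>P\<close> will show that the algebra is nonzero.\<close>

lemma embedding_detects:
  assumes V: "subspace V" and emb: "unital_complete_order_embedding (min_system V C u) d A \<Phi>"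
  shows "\<exists>P. detects d V C P \<and> (\<one> = \<zero> \<longrightarrow> P = {})"
proof -
  have herm: "v \<in> V \<Longrightarrow> \<Phi> v \<in> hermitian_elems (mat_alg d A)"
    and add: "v \<in> V \<Longrightarrow> w \<in> V \<Longrightarrow> \<Phi> (v + w) = \<Phi> v \<oplus>\<^bsub>mat_alg d A\<^esub> \<Phi> w"
    and scale: "v \<in> V \<Longrightarrow> \<Phi> (r *\<^sub>R v) = complex_of_real r \<odot>\<^bsub>mat_alg d A\<^esub> \<Phi> v" for v w r
    using emb unfolding unital_complete_order_embedding_def Let_def min_system_def by simp_all
  have iff: "X \<in> min_cone C s \<longleftrightarrow> ampl (mat_alg d A) \<Phi> X \<in> positive_elems (mat_alg s (mat_alg d A))"
    if "s \<ge> 1" "X \<in> Her s V" for s X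
    using emb that unfolding unital_complete_order_embedding_def Let_def min_system_def by simp
  have \<Phi>: "\<forall>v\<in>V. \<Phi> v \<in> carrier (mat_alg d A)"
    using herm unfolding hermitian_elems_def by blast
  then have \<Phi>c: "\<Phi> v $$ (i, j) \<in> carrier A" if "v \<in> V" "i < d" "j < d" for v i j
    using that by (simp add: mat_alg_carrier)
  define P where "P = {a. \<exists>\<xi>. star_char A \<xi> \<and> (\<forall>i<d. \<forall>j<d. \<forall>v\<in>V. lin_map a i j v = \<xi> (\<Phi> v $$ (i, j)))}"
  have ex: "\<exists>a\<in>P. \<forall>i<d. \<forall>j<d. \<forall>v\<in>V. lin_map a i j v = \<xi> (\<Phi> v $$ (i, j))" if \<xi>: "star_char A \<xi>" for \<xi>
  proof (rule lin_map_repr[OF V, of d "\<lambda>i j v. \<xi> (\<Phi> v $$ (i, j))"])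
    fix a assume "\<And>i j v. i < d \<Longrightarrow> j < d \<Longrightarrow> v \<in> V \<Longrightarrow> lin_map a i j v = \<xi> (\<Phi> v $$ (i, j))"
    then show ?thesis using \<xi> unfolding P_def by blast
  qed (simp_all add: add scale mat_alg_entry star_charD[OF \<xi>] \<Phi>c)
  have cong: "psd_on (blocks s d) (amplify (lin_map a) X) \<longleftrightarrow> psd_on (blocks s d) (amplify (\<lambda>i j v. \<xi> (\<Phi> v $$ (i, j))) X)"
    if "\<forall>i<d. \<forall>j<d. \<forall>v\<in>V. lin_map a i j v = \<xi> (\<Phi> v $$ (i, j))" "X \<in> Her s V" for a \<xi> X s
    by (rule psd_on_cong) (use that(1) HerD(1,2)[OF that(2)] in \<open>auto simp: blocks_def amplify_def\<close>)
  have "X \<in> min_cone C s \<longleftrightarrow> (\<forall>a\<in>P. psd_on (blocks s d) (amplify (lin_map a) X))" if s: "s \<ge> 1" and X: "X \<in> Her s V" for s X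
  proof -
    have "X \<in> min_cone C s \<longleftrightarrow> (\<forall>\<xi>. star_char A \<xi> \<longrightarrow> psd_on (blocks s d) (amplify (\<lambda>i j v. \<xi> (\<Phi> v $$ (i, j))) X))"
      using iff[OF s X] embedding_iff[OF gelfand_norming \<Phi> X] by simp
    also have "\<dots> \<longleftrightarrow> (\<forall>a\<in>P. psd_on (blocks s d) (amplify (lin_map a) X))"
      using ex cong[OF _ X] unfolding P_def by blast
    finally show ?thesis .
  qed
  moreover have "herm_on {..<d} (\<lambda>i j. lin_map a i j v)" if a: "a \<in> P" and v: "v \<in> V" for a v
  proof (rule herm_onI)
    fix i j assume ij: "i \<in> {..<d}" "j \<in> {..<d}"
    obtain \<xi> where \<xi>: "star_char A \<xi>" and e: "\<forall>i<d. \<forall>j<d. \<forall>v\<in>V. lin_map a i j v = \<xi> (\<Phi> v $$ (i, j))"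
      using a unfolding P_def by blast
    have "adj (mat_alg d A) (\<Phi> v) = \<Phi> v" using herm[OF v] unfolding hermitian_elems_def by blast
    then have "adj A (\<Phi> v $$ (i, j)) = \<Phi> v $$ (j, i)" using mat_alg_entry(5)[of j d i A "\<Phi> v"] ij by simp
    then show "cnj (lin_map a i j v) = lin_map a j i v"
      using e ij v star_charD(5)[OF \<xi> \<Phi>c[OF v], of i j] by simp
  qed
  ultimately have "detects d V C P" unfolding detects_def by simp
  moreover have "P = {}" if "\<one> = \<zero>"
    using that star_charD(4)[OF _ one_closed] star_char_zero unfolding P_def by force
  ultimately show ?thesis by blast
qed

end

text \<open>The entries of \<open>\<Phi> v\<close> are the functions
  \<open>a \<mapsto> lin_map a i j v\<close> on \<open>P\<close>, stored in the type by means of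
  \<open>J\<close>. They are bounded by assumption, and evaluation at \<open>a\<close> gives back
  the map encoded by \<open>a\<close>, so positivity in the algebra is detection by
  \<open>P\<close>.\<close>

lemma detects_imp_subhomogeneous:
  fixes J :: "((nat \<times> nat \<Rightarrow> 'v \<times> 'v::euclidean_space) \<Rightarrow> complex) \<Rightarrow> 'a" and V F :: "'v::euclidean_space set"
  assumes V: "subspace V" and det: "detects d V F P"
    and unital: "\<And>a i j. a \<in> P \<Longrightarrow> i < d \<Longrightarrow> j < d \<Longrightarrow> lin_map a i j w = kdelta i j"
    and bounded: "\<And>v. v \<in> V \<Longrightarrow> \<exists>B. \<forall>a\<in>P. \<forall>i<d. \<forall>j<d. cmod (lin_map a i j v) \<le> B"
    and J: "inj_on J (linf P)" and w: "w \<in> V"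
  shows "subhomogeneous TYPE('a) d (min_system V F w)"
proof -
  interpret L: linf_coding P "J ` linf P" "inv_into (linf P) J" J
    by unfold_locales (auto simp: J inv_into_into)
  interpret comm_cstar_algebra L.A by (rule L.comm_cstar_linf)
  let ?D = "inv_into (linf P) J"
  define f where "f = (\<lambda>v i j a. if a \<in> P then lin_map a i j v else 0)"
  have f: "f v i j \<in> linf P" if v: "v \<in> V" "i < d" "j < d" for v i j
  proof -
    obtain B where B: "\<And>a. a \<in> P \<Longrightarrow> cmod (lin_map a i j v) \<le> B" using bounded[OF v(1)] v(2,3) by blast
    have "cmod (f v i j a) \<le> max B 0" for a using B[of a] by (auto simp: f_def)
    moreover have "f v i j a = 0" if "a \<notin> P" for a using that by (simp add: f_def)
    ultimately show ?thesis unfolding linf_def by blast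
  qed
  define \<Phi> where "\<Phi> = (\<lambda>v. Matrix.mat d d (\<lambda>(i, j). J (f v i j)))"
  have \<Phi>e: "\<Phi> v $$ (i, j) = J (f v i j)" if "i < d" "j < d" for v i j using that by (simp add: \<Phi>_def)
  have \<Phi>: "\<forall>v\<in>V. \<Phi> v \<in> carrier (mat_alg d L.A)"
    using f by (auto simp: mat_alg_carrier \<Phi>_def)
  have D\<Phi>: "?D (\<Phi> v $$ (i, j)) = f v i j" if "v \<in> V" "i < d" "j < d" for v i j
    using L.DE[OF f[OF that]] that by (simp add: \<Phi>e)
  have JR: "J (f v i j) \<in> J ` linf P" if "v \<in> V" "i < d" "j < d" for v i j using f[OF that] by blast
  have mat_eqI: "M = N" if "M \<in> carrier (mat_alg d L.A)" "N \<in> carrier_mat d d"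
    "\<And>i j. i < d \<Longrightarrow> j < d \<Longrightarrow> M $$ (i, j) = N $$ (i, j)" for M N
    by (rule eq_matI) (use that in \<open>auto simp: mat_alg_carrier\<close>)
  have Vadd: "v + v' \<in> V" "r *\<^sub>R v \<in> V" if "v \<in> V" "v' \<in> V" for v v' r
    using V that by (auto intro: subspace_add subspace_scale)
  have herm: "herm_on {..<d} (\<lambda>i j. lin_map a i j v)" if "a \<in> P" "v \<in> V" for a v
    using det that unfolding detects_def by blast
  have 1: "\<Phi> v \<in> hermitian_elems (mat_alg d L.A)" if v: "v \<in> V" for v
  proof -
    have "\<Phi> v = adj (mat_alg d L.A) (\<Phi> v)"
    proof (rule mat_eqI)
      show "\<Phi> v \<in> carrier (mat_alg d L.A)" using \<Phi> v by blast
      show "adj (mat_alg d L.A) (\<Phi> v) \<in> carrier_mat d d" by (simp add: mat_alg_def)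
      fix i j assume ij: "i < d" "j < d"
      have "J (f v i j) = adj L.A (J (f v j i))"
      proof (rule L.eqI)
        fix a
        show "?D (J (f v i j)) a = ?D (adj L.A (J (f v j i))) a"
          using herm_onD[OF herm[OF _ v], of a j i] ij f v by (simp add: L.D_ops L.DE f_def)
      qed (use JR[OF v] ij L.R_ops in auto)
      then show "\<Phi> v $$ (i, j) = adj (mat_alg d L.A) (\<Phi> v) $$ (i, j)"
        using ij by (simp add: mat_alg_entry \<Phi>e)
    qed
    then show ?thesis unfolding hermitian_elems_def using \<Phi> v by auto
  qed
  have 2: "\<Phi> (v + v') = \<Phi> v \<oplus>\<^bsub>mat_alg d L.A\<^esub> \<Phi> v'" if v: "v \<in> V" "v' \<in> V" for v v'
  proof (rule mat_eqI)
    show "\<Phi> (v + v') \<in> carrier (mat_alg d L.A)" using \<Phi> Vadd v by blast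
    show "\<Phi> v \<oplus>\<^bsub>mat_alg d L.A\<^esub> \<Phi> v' \<in> carrier_mat d d" by (simp add: mat_alg_def)
    fix i j assume ij: "i < d" "j < d"
    have "J (f (v + v') i j) = J (f v i j) \<oplus>\<^bsub>L.A\<^esub> J (f v' i j)"
      by (rule L.eqI) (use JR Vadd v ij f in \<open>auto simp: L.R_ops L.D_ops L.DE f_def lin_map_add\<close>)
    then show "\<Phi> (v + v') $$ (i, j) = (\<Phi> v \<oplus>\<^bsub>mat_alg d L.A\<^esub> \<Phi> v') $$ (i, j)"
      using ij by (simp add: mat_alg_entry \<Phi>e)
  qed
  have 3: "\<Phi> (r *\<^sub>R v) = complex_of_real r \<odot>\<^bsub>mat_alg d L.A\<^esub> \<Phi> v" if v: "v \<in> V" for v r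
  proof (rule mat_eqI)
    show "\<Phi> (r *\<^sub>R v) \<in> carrier (mat_alg d L.A)" using \<Phi> Vadd v by blast
    show "complex_of_real r \<odot>\<^bsub>mat_alg d L.A\<^esub> \<Phi> v \<in> carrier_mat d d" by (simp add: mat_alg_def)
    fix i j assume ij: "i < d" "j < d"
    have "J (f (r *\<^sub>R v) i j) = complex_of_real r \<odot>\<^bsub>L.A\<^esub> J (f v i j)"
      by (rule L.eqI) (use JR Vadd v ij f in \<open>auto simp: L.R_ops L.D_ops L.DE f_def lin_map_scale\<close>)
    then show "\<Phi> (r *\<^sub>R v) $$ (i, j) = (complex_of_real r \<odot>\<^bsub>mat_alg d L.A\<^esub> \<Phi> v) $$ (i, j)"
      using ij by (simp add: mat_alg_entry \<Phi>e)
  qed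
  have 4: "\<Phi> w = \<one>\<^bsub>mat_alg d L.A\<^esub>"
  proof (rule mat_eqI)
    show "\<Phi> w \<in> carrier (mat_alg d L.A)" using \<Phi> w by blast
    show "\<one>\<^bsub>mat_alg d L.A\<^esub> \<in> carrier_mat d d" by (simp add: mat_alg_def)
    fix i j assume ij: "i < d" "j < d"
    have "f w i j = (if i = j then \<lambda>k. if k \<in> P then 1 else 0 else (\<lambda>k. 0))"
      using unital ij by (auto simp: f_def kdelta_def)
    then have "J (f w i j) = (if i = j then \<one>\<^bsub>L.A\<^esub> else \<zero>\<^bsub>L.A\<^esub>)" by (simp add: linf_alg_def)
    then show "\<Phi> w $$ (i, j) = \<one>\<^bsub>mat_alg d L.A\<^esub> $$ (i, j)"
      using ij by (simp add: mat_alg_entry \<Phi>e)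
  qed
  have 5: "X \<in> min_cone F s \<longleftrightarrow> ampl (mat_alg d L.A) \<Phi> X \<in> positive_elems (mat_alg s (mat_alg d L.A))"
    if s: "s \<ge> 1" and X: "X \<in> Her s V" for s X
  proof -
    have "psd_on (blocks s d) (amplify (lin_map a) X) \<longleftrightarrow> psd_on (blocks s d) (amplify (\<lambda>i j v. ?D (\<Phi> v $$ (i, j)) a) X)"
      if "a \<in> P" for a
      by (rule psd_on_cong) (use HerD(1,2)[OF X] that in \<open>auto simp: blocks_def amplify_def D\<Phi> f_def\<close>)
    then have "X \<in> min_cone F s \<longleftrightarrow> (\<forall>a\<in>P. psd_on (blocks s d) (amplify (\<lambda>i j v. ?D (\<Phi> v $$ (i, j)) a) X))"
      using det s X unfolding detects_def by blast
    then show ?thesis unfolding embedding_iff[OF L.norming_linf \<Phi> X] by simp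
  qed
  have "unital_complete_order_embedding (min_system V F w) d L.A \<Phi>"
    unfolding unital_complete_order_embedding_def Let_def min_system_def using 1 2 3 4 5 by simp
  then show ?thesis unfolding subhomogeneous_def using L.comm_cstar_linf by blast
qed

text \<open>A complex function on a countable set is coded by a set of natural numbers, hence by a
  real number, which \<open>g\<close> carries into the type. For empty \<open>K\<close> there is
  only the zero function, so any map is injective on \<open>linf K\<close>.\<close>

lemma linf_encodable:
  assumes K: "countable K" and g: "inj (g :: complex \<Rightarrow> 'a) \<or> K = {}"
  shows "\<exists>J :: ('k \<Rightarrow> complex) \<Rightarrow> 'a. inj_on J (linf K)"
proof (cases "K = {}")
  case True
  then have "linf K \<subseteq> {\<lambda>k. 0}" unfolding linf_def by auto
  then show ?thesis by (intro exI[of _ "\<lambda>_. undefined"] inj_onI) blast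
next
  case False
  then have g: "inj g" using g by blast
  obtain b :: "nat set \<Rightarrow> real" and b' :: "real \<Rightarrow> nat set" where b: "inj b" and b': "inj b'"
    using nat_sets_eqpoll_reals unfolding eqpoll_def by (meson bij_betw_def bij_betw_inv_into bij_is_inj)
  \<comment> \<open>In a triple \<open>(n, m, k)\<close> the first component numbers the point of
    \<open>K\<close>, the last selects real or imaginary part, and \<open>m\<close> runs through the
    set of naturals that codes this real number.\<close>
  define c where "c = (\<lambda>f :: 'k \<Rightarrow> complex. {(n, m, k :: nat). (k = 0 \<and> m \<in> b' (Re (f (from_nat_into K n)))) \<or>
     (k = 1 \<and> m \<in> b' (Im (f (from_nat_into K n))))})"
  have "inj_on c (linf K)"
  proof (rule inj_onI)
    fix f h assume f: "f \<in> linf K" and h: "h \<in> linf K" and eq: "c f = c h"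
    have "f k = h k" if k: "k \<in> K" for k
    proof -
      obtain n where n: "from_nat_into K n = k" using from_nat_into_surj[OF K k] by blast
      have "b' (Re (f k)) = {m. (n, m, 0) \<in> c f}" "b' (Im (f k)) = {m. (n, m, 1) \<in> c f}"
        "b' (Re (h k)) = {m. (n, m, 0) \<in> c h}" "b' (Im (h k)) = {m. (n, m, 1) \<in> c h}"
        by (simp_all add: c_def n)
      then show ?thesis using eq injD[OF b'] by (metis complex_eqI)
    qed
    moreover have "f k = h k" if "k \<notin> K" for k using f h that unfolding linf_def by simp
    ultimately show "f = h" by blast
  qed
  moreover have "inj (\<lambda>S :: (nat \<times> nat \<times> nat) set. g (of_real (b (to_nat ` S))))"
    by (rule injI) (metis b g inj_image_eq_iff inj_to_nat injD of_real_eq_iff)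
  ultimately have "inj_on ((\<lambda>S :: (nat \<times> nat \<times> nat) set. g (of_real (b (to_nat ` S)))) \<circ> c) (linf K)"
    by (intro comp_inj_on) (auto intro: inj_on_subset)
  then show ?thesis by blast
qed

section \<open>Faces\<close>

lemma face_of_coneD:
  assumes "face_of_cone F C"
  shows "F \<subseteq> C" "convex_cone F" "\<lbrakk>x \<in> C; y \<in> C; x + y \<in> F\<rbrakk> \<Longrightarrow> x \<in> F" "\<lbrakk>x \<in> C; y \<in> C; x + y \<in> F\<rbrakk> \<Longrightarrow> y \<in> F"
  using assms unfolding face_of_cone_def by blast+

lemma convex_cone_sum:
  assumes "convex_cone C" "\<And>l. l \<in> S \<Longrightarrow> c l \<in> C" shows "sum c S \<in> C"
  using assms(2)
  by (induction S rule: infinite_finite_induct) (auto simp: convex_cone_contains_0[OF assms(1)] convex_cone_add[OF assms(1)])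

lemma span_convex_cone:
  assumes F: "convex_cone F" and v: "v \<in> span F"
  obtains x y where "x \<in> F" "y \<in> F" "v = x - y"
proof -
  have "subspace {x - y |x y. x \<in> F \<and> y \<in> F}"
  proof (rule subspaceI)
    show "0 \<in> {x - y |x y. x \<in> F \<and> y \<in> F}" using convex_cone_contains_0[OF F] by force
  next
    fix v w assume "v \<in> {x - y |x y. x \<in> F \<and> y \<in> F}" "w \<in> {x - y |x y. x \<in> F \<and> y \<in> F}"
    then obtain x y x' y' where "v = x - y" "w = x' - y'" "x \<in> F" "y \<in> F" "x' \<in> F" "y' \<in> F" by blast
    moreover from this have "v + w = (x + x') - (y + y')" by simp
    ultimately show "v + w \<in> {x - y |x y. x \<in> F \<and> y \<in> F}" using convex_cone_add[OF F] by blast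
  next
    fix c :: real and v assume "v \<in> {x - y |x y. x \<in> F \<and> y \<in> F}"
    then obtain x y where v: "v = x - y" "x \<in> F" "y \<in> F" by blast
    show "c *\<^sub>R v \<in> {x - y |x y. x \<in> F \<and> y \<in> F}"
    proof (cases "c \<ge> 0")
      case True
      then have "c *\<^sub>R v = c *\<^sub>R x - c *\<^sub>R y" "c *\<^sub>R x \<in> F" "c *\<^sub>R y \<in> F"
        using v convex_cone_scaleR[OF F True] by (simp_all add: scaleR_diff_right)
      then show ?thesis by blast
    next
      case False
      then have "- c \<ge> 0" by simp
      then have "(- c) *\<^sub>R x \<in> F" "(- c) *\<^sub>R y \<in> F"
        using v convex_cone_scaleR[OF F] by blast+
      moreover have "c *\<^sub>R v = (- c) *\<^sub>R y - (- c) *\<^sub>R x"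
        by (simp add: v(1) scaleR_diff_right)
      ultimately show ?thesis by blast
    qed
  qed
  moreover have "F \<subseteq> {x - y |x y. x \<in> F \<and> y \<in> F}"
    using convex_cone_contains_0[OF F] by force
  ultimately have "span F \<subseteq> {x - y |x y. x \<in> F \<and> y \<in> F}" by (intro span_minimal)
  then show thesis using v that by blast
qed

text \<open>If \<open>v = x - y\<close> with \<open>x\<close> and \<open>y\<close> in
  \<open>F\<close>, then \<open>v + y = x\<close> is a sum of two elements of \<open>C\<close> that
  lies in \<open>F\<close>.\<close>

lemma face_span_Int:
  assumes face: "face_of_cone F C" and v: "v \<in> span F" "v \<in> C" shows "v \<in> F"
proof -
  note D = face_of_coneD[OF face]
  obtain x y where "x \<in> F" "y \<in> F" "v = x - y" by (rule span_convex_cone[OF D(2) v(1)])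
  then show ?thesis using D(3)[OF v(2), of y] D(1) by auto
qed

lemma face_sum:
  assumes C: "convex_cone C" and face: "face_of_cone F C" and "finite S" "\<And>l. l \<in> S \<Longrightarrow> c l \<in> C" "sum c S \<in> F" "l \<in> S"
  shows "c l \<in> F"
proof -
  have "c l + sum c (S - {l}) \<in> F" using assms by (simp add: sum.remove[symmetric])
  moreover have "sum c (S - {l}) \<in> C" using assms by (intro convex_cone_sum) auto
  ultimately show ?thesis using face_of_coneD(3)[OF face] assms by blast
qed

text \<open>A diagonal entry of \<open>K\<close> is the sum of the squared moduli in a column of its
  Gram factor. These vanish, so the factor does.\<close>

lemma psd_form_zero:
  assumes fin: "finite I" and K: "psd_on I K" and zero: "\<And>x. Re (ip_on I x (ap_on I K x)) = 0" and ij: "i \<in> I" "j \<in> I"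
  shows "K i j = 0"
proof -
  obtain Y where Y: "\<And>i j. i \<in> I \<Longrightarrow> j \<in> I \<Longrightarrow> K i j = (\<Sum>k\<in>I. cnj (Y k i) * Y k j)"
    using psd_sqrt[OF fin K] by blast
  have 0: "Y k i = 0" if k: "k \<in> I" and i: "i \<in> I" for k i
  proof -
    define e where "e = (\<lambda>l. if l = i then 1 else 0 :: complex)"
    have "ip_on I e (ap_on I K e) = K i i"
      using fin i by (simp add: ip_on_def ap_on_def e_def if_distrib[of cnj] if_distrib[of "(*) _"] if_distrib[of "\<lambda>x. x * _"] cong: if_cong)
    then have "Re (\<Sum>k\<in>I. cnj (Y k i) * Y k i) = 0" using zero[of e] Y[OF i i] by simp
    moreover have "(\<Sum>k\<in>I. cnj (Y k i) * Y k i) = of_real (\<Sum>k\<in>I. (cmod (Y k i))\<^sup>2)"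
      by (simp only: of_real_sum complex_norm_square mult.commute)
    ultimately have "(\<Sum>k\<in>I. (cmod (Y k i))\<^sup>2) = 0" by (simp only: Re_complex_of_real)
    then show ?thesis using fin k by (simp add: sum_nonneg_eq_0_iff)
  qed
  show ?thesis using Y[OF ij] 0 ij by simp
qed

text \<open>The real part of the sesquilinear form of \<open>X\<close> at \<open>x\<close>, with
  values in the vector space; for Hermitian \<open>X\<close> this form is real.\<close>

definition vform :: "nat \<Rightarrow> (nat \<Rightarrow> complex) \<Rightarrow> ('v::real_vector \<times> 'v) mat \<Rightarrow> 'v" where
  "vform s x X = (\<Sum>i<s. \<Sum>j<s. Re (cnj (x i) * x j) *\<^sub>R fst (X $$ (i, j)) - Im (cnj (x i) * x j) *\<^sub>R snd (X $$ (i, j)))"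

text \<open>Evaluating the form of \<open>X\<close> at \<open>x\<close> gives a sum of the vectors
  \<open>c l\<close> with coefficients \<open>r l * Q l x \<ge> 0\<close>. It lies in
  \<open>span F\<close> and in \<open>C\<close>, hence in \<open>F\<close>, and the face property
  puts each summand in \<open>F\<close>. So either \<open>c l\<close> is in \<open>F\<close>, or the
  coefficients vanish for all \<open>x\<close> and the term contributes nothing to
  \<open>X\<close>.\<close>

lemma min_cone_face:
  fixes F C :: "'v::euclidean_space set"
  assumes C: "convex_cone C" and face: "face_of_cone F C" and X: "X \<in> min_cone C s" and XF: "X \<in> Her s (span F)"
  shows "X \<in> min_cone F s"
proof -
  obtain k :: nat and r A c where X: "X = Matrix.mat s s (\<lambda>(i, j). \<Sum>l<k. r l *\<^sub>R (elem_tensor (A l) (c l) $$ (i, j)))"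
    and k: "\<And>l. l < k \<Longrightarrow> 0 \<le> r l \<and> A l \<in> psd_mats s \<and> c l \<in> C"
    using X unfolding min_cone_def by blast
  have et: "elem_tensor (A l) v $$ (i, j) = (Re (A l $$ (i, j)) *\<^sub>R v, Im (A l $$ (i, j)) *\<^sub>R v)"
    if "l < k" "i < s" "j < s" for l i j v using k[OF that(1)] that by (auto simp: elem_tensor_def psd_mats_def)
  define Q where "Q = (\<lambda>l x. Re (ip_on {..<s} x (ap_on {..<s} (\<lambda>i j. A l $$ (i, j)) x)))"
  have Q0: "0 \<le> Q l x" if "l < k" for l x
    using k[OF that] psd_onD(2) unfolding Q_def psd_mats_iff by blast
  have vf: "vform s x X = (\<Sum>l<k. (r l * Q l x) *\<^sub>R c l)" for x
  proof -
    have "vform s x X = (\<Sum>i<s. \<Sum>j<s. \<Sum>l<k. (r l * Re (cnj (x i) * (A l $$ (i, j) * x j))) *\<^sub>R c l)"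
      unfolding vform_def
    proof (intro sum.cong refl)
      fix i j assume "i \<in> {..<s}" "j \<in> {..<s}"
      then have ij: "i < s" "j < s" by auto
      have "X $$ (i, j) = (\<Sum>l<k. r l *\<^sub>R (elem_tensor (A l) (c l) $$ (i, j)))"
        using ij by (simp add: X)
      also have "\<dots> = (\<Sum>l<k. r l *\<^sub>R (Re (A l $$ (i, j)) *\<^sub>R c l, Im (A l $$ (i, j)) *\<^sub>R c l))"
        using ij by (intro sum.cong refl) (simp add: et)
      finally have "X $$ (i, j) = \<dots>" .
      then have f: "fst (X $$ (i, j)) = (\<Sum>l<k. (r l * Re (A l $$ (i, j))) *\<^sub>R c l)"
        and g: "snd (X $$ (i, j)) = (\<Sum>l<k. (r l * Im (A l $$ (i, j))) *\<^sub>R c l)"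
        by (simp_all add: fst_sum snd_sum)
      have eq: "Re (cnj (x i) * x j) * (a * Re z) - Im (cnj (x i) * x j) * (a * Im z) = a * Re (cnj (x i) * (z * x j))" for a z
        by (simp add: algebra_simps)
      show "Re (cnj (x i) * x j) *\<^sub>R fst (X $$ (i, j)) - Im (cnj (x i) * x j) *\<^sub>R snd (X $$ (i, j))
          = (\<Sum>l<k. (r l * Re (cnj (x i) * (A l $$ (i, j) * x j))) *\<^sub>R c l)"
        unfolding f g scaleR_sum_right sum_subtractf[symmetric] scaleR_scaleR scaleR_diff_left[symmetric] eq ..
    qed
    also have "\<dots> = (\<Sum>l<k. \<Sum>i<s. \<Sum>j<s. (r l * Re (cnj (x i) * (A l $$ (i, j) * x j))) *\<^sub>R c l)"
      by (subst sum.swap[of _ "{..<k}"]) (intro sum.cong refl sum.swap)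
    also have "\<dots> = (\<Sum>l<k. (r l * Q l x) *\<^sub>R c l)"
      unfolding Q_def ip_on_ap_on by (simp only: Re_sum scaleR_sum_left sum_distrib_left mult.assoc)
    finally show ?thesis .
  qed
  have vspan: "vform s x X \<in> span F" for x
    unfolding vform_def by (intro span_sum span_diff span_scale) (use HerD(1,2)[OF XF] in auto)
  have vC: "(r l * Q l x) *\<^sub>R c l \<in> C" if "l < k" for l x
    by (rule convex_cone_scaleR[OF C]) (use k[OF that] Q0[OF that, of x] in simp_all)
  have inF: "(r l * Q l x) *\<^sub>R c l \<in> F" if "l < k" for l x
  proof (rule face_sum[OF C face, of "{..<k}"])
    show "(\<Sum>l<k. (r l * Q l x) *\<^sub>R c l) \<in> F"
      using vspan[of x] unfolding vf 
      by (rule face_span_Int[OF face]) (rule convex_cone_sum[OF C], rule vC, simp)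
  qed (simp_all add: vC that)
  note F = face_of_coneD(2)[OF face]
  \<comment> \<open>Terms with \<open>c l\<close> outside \<open>F\<close> contribute zero, so their
    vector may be replaced by 0, which belongs to \<open>F\<close>.\<close>
  define c' where "c' = (\<lambda>l. if c l \<in> F then c l else 0)"
  have "r l *\<^sub>R (elem_tensor (A l) (c l) $$ (i, j)) = r l *\<^sub>R (elem_tensor (A l) (c' l) $$ (i, j))"
    if l: "l < k" and ij: "i < s" "j < s" for l i j
  proof (cases "c l \<in> F \<or> r l = 0")
    case False
    have "Q l x = 0" for x
    proof (rule ccontr)
      assume "Q l x \<noteq> 0"
      define q where "q = r l * Q l x"
      have q: "q > 0"
        using \<open>Q l x \<noteq> 0\<close> False k[OF l] Q0[OF l, of x] by (simp add: q_def less_le)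
      have "(1 / q) *\<^sub>R (q *\<^sub>R c l) \<in> F"
        unfolding q_def by (rule convex_cone_scaleR[OF F _ inF[OF l]]) (use q q_def in simp)
      then show False using False q by simp
    qed
    then have "A l $$ (i, j) = 0"
      using psd_form_zero[of "{..<s}" "\<lambda>i j. A l $$ (i, j)" i j] k[OF l] ij unfolding Q_def psd_mats_iff by blast
    then show ?thesis unfolding et[OF l ij] by simp
  qed (auto simp: c'_def)
  then have "X = Matrix.mat s s (\<lambda>(i, j). \<Sum>l<k. r l *\<^sub>R (elem_tensor (A l) (c' l) $$ (i, j)))"
    unfolding X by (intro eq_matI) (auto intro!: sum.cong)
  moreover have "\<forall>l<k. 0 \<le> r l \<and> A l \<in> psd_mats s \<and> c' l \<in> F"
    using k convex_cone_contains_0[OF F] by (simp add: c'_def)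
  ultimately show ?thesis unfolding min_cone_def by blast
qed

text \<open>The generators of \<open>C\<close> that lie in \<open>F\<close> generate
  \<open>F\<close>. The interior in \<open>span F\<close> is the relative interior, which is
  nonempty for a nonempty convex set.\<close>

lemma face_proper_polyhedral:
  assumes C: "proper_polyhedral_cone V C" and face: "face_of_cone F C"
  shows "proper_polyhedral_cone (span F) F"
proof -
  note D = face_of_coneD[OF face]
  obtain S where S: "finite S" "C = convex_cone hull S" and pt: "C \<inter> uminus ` C = {0}"
    using C unfolding proper_polyhedral_cone_def by blast
  have "convex_cone hull (S \<inter> F) \<subseteq> F" by (rule hull_minimal) (use D in auto)
  moreover have "F \<subseteq> convex_cone hull (S \<inter> F)"
  proof -
    \<comment> \<open>The face property makes \<open>?Q\<close> a convex cone. It contains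
      \<open>S\<close>, hence all of \<open>C\<close>.\<close>
    let ?H = "convex_cone hull (S \<inter> F)" and ?Q = "{c \<in> C. c \<in> F \<longrightarrow> c \<in> convex_cone hull (S \<inter> F)}"
    have H: "convex_cone ?H" and CC: "convex_cone C" unfolding S by (rule convex_cone_convex_cone_hull)+
    have "convex_cone ?Q"
    proof (rule iffD2[OF convex_cone_iff], intro conjI ballI allI impI)
      show "0 \<in> ?Q" using convex_cone_contains_0[OF H] convex_cone_contains_0[OF CC] by blast
      fix x y assume "x \<in> ?Q" "y \<in> ?Q"
      then show "x + y \<in> ?Q"
        using D(3,4)[of x y] convex_cone_add[OF H] convex_cone_add[OF CC] by blast
    next
      fix x and c :: real assume x: "x \<in> ?Q" and c: "0 \<le> c"
      show "c *\<^sub>R x \<in> ?Q"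
      proof (cases "c = 0")
        case True
        then show ?thesis using convex_cone_contains_0[OF H] convex_cone_contains_0[OF CC] by simp
      next
        case False
        have "x \<in> F" if "c *\<^sub>R x \<in> F"
          using convex_cone_scaleR[OF D(2), of "1 / c" "c *\<^sub>R x"] that False c by simp
        then show ?thesis using x c convex_cone_scaleR[OF H c] convex_cone_scaleR[OF CC c] by blast
      qed
    qed
    moreover have "S \<subseteq> ?Q" using S hull_subset[of S convex_cone] hull_subset[of "S \<inter> F" convex_cone] by blast
    ultimately have "C \<subseteq> ?Q" unfolding S(2) by (intro hull_minimal)
    then show ?thesis using D(1) by blast
  qed
  ultimately have "\<exists>S. finite S \<and> F = convex_cone hull S" using S(1) by (intro exI[of _ "S \<inter> F"]) auto
  moreover have "F \<inter> uminus ` F = {0}"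
  proof
    show "F \<inter> uminus ` F \<subseteq> {0}" using pt D(1) by blast
    show "{0} \<subseteq> F \<inter> uminus ` F" using convex_cone_contains_0[OF D(2)] by force
  qed
  moreover have "cone_interior (span F) F \<noteq> {}"
  proof -
    have "affine hull F = span F" using convex_cone_contains_0[OF D(2)] by (intro affine_hull_span_0) (rule hull_inc)
    moreover have "convex F" "F \<noteq> {}" using D(2) unfolding convex_cone_def by auto
    then have "rel_interior F \<noteq> {}" by (simp add: rel_interior_eq_empty)
    ultimately show ?thesis unfolding cone_interior_def rel_interior_def interior_of_def by auto
  qed
  ultimately show ?thesis unfolding proper_polyhedral_cone_def by (simp add: span_superset)
qed

section \<open>Congruences and their effect on amplified maps\<close>

lemma cong_form:
  "ip_on J y (ap_on J (\<lambda>a b. \<Sum>p\<in>I. \<Sum>q\<in>I. cnj (G p a) * K p q * G q b) z)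
    = ip_on I (\<lambda>p. \<Sum>a\<in>J. G p a * y a) (ap_on I K (\<lambda>p. \<Sum>a\<in>J. G p a * z a))"
proof -
  define t where "t = (\<lambda>p q a b. cnj (G p a * y a) * K p q * (G q b * z b))"
  have "ip_on J y (ap_on J (\<lambda>a b. \<Sum>p\<in>I. \<Sum>q\<in>I. cnj (G p a) * K p q * G q b) z)
      = (\<Sum>a\<in>J. \<Sum>b\<in>J. \<Sum>p\<in>I. \<Sum>q\<in>I. t p q a b)"
    by (simp add: ip_on_ap_on t_def sum_distrib_left sum_distrib_right mult_ac)
  also have "\<dots> = (\<Sum>a\<in>J. \<Sum>p\<in>I. \<Sum>b\<in>J. \<Sum>q\<in>I. t p q a b)"
    by (intro sum.cong refl sum.swap)
  also have "\<dots> = (\<Sum>p\<in>I. \<Sum>a\<in>J. \<Sum>b\<in>J. \<Sum>q\<in>I. t p q a b)" by (rule sum.swap)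
  also have "\<dots> = (\<Sum>p\<in>I. \<Sum>a\<in>J. \<Sum>q\<in>I. \<Sum>b\<in>J. t p q a b)"
    by (rule sum.cong[OF refl], rule sum.cong[OF refl], rule sum.swap)
  also have "\<dots> = (\<Sum>p\<in>I. \<Sum>q\<in>I. \<Sum>a\<in>J. \<Sum>b\<in>J. t p q a b)"
    by (rule sum.cong[OF refl], rule sum.swap)
  also have "\<dots> = (\<Sum>p\<in>I. \<Sum>q\<in>I. (\<Sum>a\<in>J. cnj (G p a * y a)) * K p q * (\<Sum>b\<in>J. G q b * z b))"
  proof (intro sum.cong refl)
    fix p q
    have "sum f J * k * sum g J = (\<Sum>a\<in>J. \<Sum>b\<in>J. f a * k * g b)" for f g :: "'a \<Rightarrow> complex" and k
      unfolding sum_distrib_right[of f J k] sum_product ..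
    then show "(\<Sum>a\<in>J. \<Sum>b\<in>J. t p q a b) = (\<Sum>a\<in>J. cnj (G p a * y a)) * K p q * (\<Sum>b\<in>J. G q b * z b)"
      unfolding t_def by simp
  qed
  finally show ?thesis by (simp add: ip_on_ap_on)
qed

lemma psd_congruence:
  assumes K: "psd_on I K"
  shows "psd_on J (\<lambda>a b. \<Sum>p\<in>I. \<Sum>q\<in>I. cnj (G p a) * K p q * G q b)"
  unfolding psd_on_def cong_form
proof (intro conjI allI herm_onI)
  show "0 \<le> Re (ip_on I (\<lambda>p. \<Sum>a\<in>J. G p a * x a) (ap_on I K (\<lambda>p. \<Sum>a\<in>J. G p a * x a)))" for x
    by (rule psd_onD(2)[OF K])
  fix a b
  have "cnj (\<Sum>p\<in>I. \<Sum>q\<in>I. cnj (G p a) * K p q * G q b) = (\<Sum>p\<in>I. \<Sum>q\<in>I. cnj (G q b) * K q p * G p a)"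
    unfolding cnj_sum
    by (intro sum.cong refl) (simp add: herm_onD[OF psd_onD(1)[OF K]])
  also have "\<dots> = (\<Sum>q\<in>I. \<Sum>p\<in>I. cnj (G q b) * K q p * G p a)" by (rule sum.swap)
  finally show "cnj (\<Sum>p\<in>I. \<Sum>q\<in>I. cnj (G p a) * K p q * G q b) = (\<Sum>p\<in>I. \<Sum>q\<in>I. cnj (G p b) * K p q * G q a)" .
qed

lemma blk_sum: "(\<Sum>p\<in>blocks s d. f p) = (\<Sum>i<s. \<Sum>a<d. f (i, a))"
  unfolding blocks_def sum.cartesian_product by (simp add: split_def)

lemma ip_on_blocks: "ip_on (blocks s d) x (ap_on (blocks s d) K y) =
    (\<Sum>i<s. \<Sum>j<s. ip_on {..<d} (\<lambda>a. x (i, a)) (ap_on {..<d} (\<lambda>a b. K (i, a) (j, b)) (\<lambda>b. y (j, b))))"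
proof -
  have "ip_on (blocks s d) x (ap_on (blocks s d) K y) = (\<Sum>i<s. \<Sum>a<d. \<Sum>j<s. \<Sum>b<d. cnj (x (i, a)) * K (i, a) (j, b) * y (j, b))"
    by (simp only: ip_on_ap_on blk_sum)
  also have "\<dots> = (\<Sum>i<s. \<Sum>j<s. \<Sum>a<d. \<Sum>b<d. cnj (x (i, a)) * K (i, a) (j, b) * y (j, b))"
    by (intro sum.cong refl sum.swap)
  finally show ?thesis by (simp add: ip_on_ap_on)
qed

text \<open>A congruence of the maps by \<open>Y\<close> amplifies to a congruence by the tensor
  product of the identity with \<open>Y\<close>, and this is moved onto the vector
  \<open>x\<close>.\<close>

lemma amplify_congruence:
  fixes Y :: "nat \<Rightarrow> nat \<Rightarrow> complex" and x :: "nat \<times> nat \<Rightarrow> complex"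
    and a b :: "nat \<times> nat \<Rightarrow> 'v::euclidean_space \<times> 'v"
  assumes eq: "\<And>i j v. i < d \<Longrightarrow> j < d \<Longrightarrow> v \<in> V \<Longrightarrow> lin_map a i j v = (\<Sum>k<d. \<Sum>l<d. cnj (Y k i) * lin_map b k l v * Y l j)"
    and X: "X \<in> Her s V"
  shows "ip_on (blocks s d) x (ap_on (blocks s d) (amplify (lin_map a) X) x)
    = ip_on (blocks s d) (\<lambda>p. \<Sum>m<d. Y (snd p) m * x (fst p, m)) (ap_on (blocks s d) (amplify (lin_map b) X) (\<lambda>p. \<Sum>m<d. Y (snd p) m * x (fst p, m)))"
proof -
  have "ip_on {..<d} (\<lambda>m. x (i, m)) (ap_on {..<d} (\<lambda>m n. amplify (lin_map a) X (i, m) (j, n)) (\<lambda>n. x (j, n)))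
      = ip_on {..<d} (\<lambda>k. \<Sum>m<d. Y k m * x (i, m)) (ap_on {..<d} (\<lambda>k l. amplify (lin_map b) X (i, k) (j, l)) (\<lambda>k. \<Sum>m<d. Y k m * x (j, m)))"
    if ij: "i < s" "j < s" for i j
  proof -
    note V = HerD(1,2)[OF X ij]
    have "ip_on {..<d} (\<lambda>m. x (i, m)) (ap_on {..<d} (\<lambda>m n. amplify (lin_map a) X (i, m) (j, n)) (\<lambda>n. x (j, n)))
        = ip_on {..<d} (\<lambda>m. x (i, m)) (ap_on {..<d} (\<lambda>m n. \<Sum>k<d. \<Sum>l<d. cnj (Y k m) * amplify (lin_map b) X (i, k) (j, l) * Y l n) (\<lambda>n. x (j, n)))"
    proof (intro ip_on_cong refl ap_on_cong)
      fix m n assume "m \<in> {..<d}" "n \<in> {..<d}"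
      then show "amplify (lin_map a) X (i, m) (j, n) = (\<Sum>k<d. \<Sum>l<d. cnj (Y k m) * amplify (lin_map b) X (i, k) (j, l) * Y l n)"
        using V ij by (simp add: amplify_def eq sum_distrib_left sum.distrib algebra_simps)
    qed
    also have "\<dots> = ip_on {..<d} (\<lambda>k. \<Sum>m<d. Y k m * x (i, m)) (ap_on {..<d} (\<lambda>k l. amplify (lin_map b) X (i, k) (j, l)) (\<lambda>k. \<Sum>m<d. Y k m * x (j, m)))"
      by (rule cong_form)
  finally show ?thesis .
  qed
  then have "(\<Sum>i<s. \<Sum>j<s. ip_on {..<d} (\<lambda>m. x (i, m)) (ap_on {..<d} (\<lambda>m n. amplify (lin_map a) X (i, m) (j, n)) (\<lambda>n. x (j, n))))
      = (\<Sum>i<s. \<Sum>j<s. ip_on {..<d} (\<lambda>k. \<Sum>m<d. Y k m * x (i, m))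
          (ap_on {..<d} (\<lambda>k l. amplify (lin_map b) X (i, k) (j, l)) (\<lambda>k. \<Sum>m<d. Y k m * x (j, m))))"
    by simp
  then show ?thesis by (simp only: ip_on_blocks fst_conv snd_conv)
qed

lemma ip_on_kdelta: "finite I \<Longrightarrow> ip_on I x (ap_on I kdelta x) = ip_on I x x"
  by (rule ip_on_cong) (simp_all add: ap_on_kdelta)

lemma psd_kdelta: "finite I \<Longrightarrow> psd_on I kdelta"
  unfolding psd_on_def by (simp add: ip_on_kdelta ip_on_self del: of_real_power) (simp add: herm_on_def kdelta_def)

lemma inverse_kernel:
  fixes Y :: "nat \<Rightarrow> nat \<Rightarrow> complex"
  assumes inj: "\<forall>x. (\<forall>k<d. (\<Sum>j<d. Y k j * x j) = 0) \<longrightarrow> (\<forall>j<d. x j = 0)"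
  shows "\<exists>G. (\<forall>i<d. \<forall>j<d. (\<Sum>k<d. Y i k * G k j) = kdelta i j) \<and> (\<forall>i<d. \<forall>j<d. (\<Sum>k<d. G i k * Y k j) = kdelta i j)"
proof -
  define M where "M = Matrix.mat d d (\<lambda>(i, j). Y i j)"
  have M: "M \<in> carrier_mat d d" by (simp add: M_def)
  have "Determinant.det M \<noteq> 0"
  proof
    assume "Determinant.det M = 0"
    then obtain v where v: "v \<in> carrier_vec d" "v \<noteq> 0\<^sub>v d" "M *\<^sub>v v = 0\<^sub>v d"
      unfolding det_0_iff_vec_prod_zero[OF M] by blast
    have "(\<Sum>j<d. Y k j * v $ j) = 0" if "k < d" for k
    proof -
      have "(M *\<^sub>v v) $ k = (\<Sum>j<d. Y k j * v $ j)"
        using that v(1) by (simp add: M_def scalar_prod_def lessThan_atLeast0)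
      then show ?thesis using v(3) that by simp
    qed
    then have "v $ j = 0" if "j < d" for j using spec[OF inj, of "\<lambda>j. v $ j"] that by blast
    then show False using v(1,2) by (auto intro!: eq_vecI)
  qed
  then have "M \<in> Units (ring_mat TYPE(complex) d ())" by (rule det_non_zero_imp_unit[OF M])
  then obtain N where N: "N \<in> carrier_mat d d" "M * N = 1\<^sub>m d" "N * M = 1\<^sub>m d"
    unfolding Units_def ring_mat_def by auto
  have "(\<Sum>k<d. Y i k * N $$ (k, j)) = kdelta i j" if "i < d" "j < d" for i j
  proof -
    have "(M * N) $$ (i, j) = (\<Sum>k<d. Y i k * N $$ (k, j))"
      using that N(1) by (simp add: M_def scalar_prod_def lessThan_atLeast0)
    then show ?thesis using that by (simp add: N(2) kdelta_def)
  qed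
  moreover have "(\<Sum>k<d. N $$ (i, k) * Y k j) = kdelta i j" if "i < d" "j < d" for i j
  proof -
    have "(N * M) $$ (i, j) = (\<Sum>k<d. N $$ (i, k) * Y k j)"
      using that N(1) by (simp add: M_def scalar_prod_def lessThan_atLeast0)
    then show ?thesis using that by (simp add: N(3) kdelta_def)
  qed
  ultimately show ?thesis by (intro exI[of _ "\<lambda>i j. N $$ (i, j)"]) blast
qed

text \<open>If \<open>Y\<close> kills \<open>x\<close>, then the form of \<open>N\<close> at
  \<open>x\<close> plus \<open>\<eta>\<close> times the squared length of \<open>x\<close> is zero.
  Both terms are nonnegative, so \<open>x\<close> vanishes and \<open>Y\<close> is
  invertible.\<close>

lemma posdef_factorization:
  fixes d :: nat
  assumes N: "psd_on {..<d} N" and e: "\<eta> > 0"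
  shows "\<exists>Y G. (\<forall>i<d. \<forall>j<d. N i j + of_real \<eta> * kdelta i j = (\<Sum>k<d. cnj (Y k i) * Y k j)) \<and>
    (\<forall>i<d. \<forall>j<d. (\<Sum>k<d. Y i k * G k j) = kdelta i j) \<and> (\<forall>i<d. \<forall>j<d. (\<Sum>k<d. G i k * Y k j) = kdelta i j)"
proof -
  let ?K = "\<lambda>i j. N i j + of_real \<eta> * kdelta i j"
  have K: "psd_on {..<d} ?K" using e by (intro psd_add N psd_scale psd_kdelta) auto
  obtain Y where Y: "\<And>i j. i < d \<Longrightarrow> j < d \<Longrightarrow> ?K i j = (\<Sum>k<d. cnj (Y k i) * Y k j)"
    using psd_sqrt[OF finite_lessThan K] by auto
  have "x j = 0" if Yx: "\<forall>k<d. (\<Sum>j<d. Y k j * x j) = 0" and j: "j < d" for x j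
  proof -
    have "ap_on {..<d} ?K x i = 0" if "i < d" for i
    proof -
      have "ap_on {..<d} ?K x i = (\<Sum>j<d. \<Sum>k<d. cnj (Y k i) * (Y k j * x j))"
        using that by (simp add: ap_on_def Y sum_distrib_right mult.assoc)
      also have "\<dots> = (\<Sum>k<d. \<Sum>j<d. cnj (Y k i) * (Y k j * x j))" by (rule sum.swap)
      also have "\<dots> = 0" by (simp add: sum_distrib_left[symmetric] Yx)
      finally show ?thesis .
    qed
    then have "ip_on {..<d} x (ap_on {..<d} ?K x) = 0" by (simp add: ip_on_def)
    moreover have "ip_on {..<d} x (ap_on {..<d} ?K x) = ip_on {..<d} x (ap_on {..<d} N x) + of_real \<eta> * ip_on {..<d} x (ap_on {..<d} kdelta x)"
      by (simp add: ip_on_ap_on algebra_simps sum.distrib sum_distrib_left)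
    ultimately have "Re (ip_on {..<d} x (ap_on {..<d} N x)) + \<eta> * Re (ip_on {..<d} x x) = 0"
      by (simp add: ip_on_kdelta complex_eq_iff)
    moreover have "0 \<le> Re (ip_on {..<d} x (ap_on {..<d} N x))" by (rule psd_onD(2)[OF N])
    moreover have "0 \<le> \<eta> * Re (ip_on {..<d} x x)" using e by (simp add: ip_on_self del: of_real_power)
    ultimately have "\<eta> * Re (ip_on {..<d} x x) = 0" by linarith
    then have "Re (ip_on {..<d} x x) = 0" using e by simp
    then have "L2_set (\<lambda>i. cmod (x i)) {..<d} = 0" by (simp add: ip_on_self del: of_real_power)
    then show ?thesis using j by (simp add: L2_set_eq_0_iff)
  qed
  then obtain G where "\<forall>i<d. \<forall>j<d. (\<Sum>k<d. Y i k * G k j) = kdelta i j"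
    "\<forall>i<d. \<forall>j<d. (\<Sum>k<d. G i k * Y k j) = kdelta i j"
    using inverse_kernel[of d Y] by blast
  with Y show ?thesis by (intro exI[of _ Y] exI[of _ G]) simp
qed

section \<open>Unital positive maps on the span of a face\<close>

lemma min_cone_unit:
  assumes c: "c \<in> C" and V: "c \<in> V" "0 \<in> V"
  shows "Matrix.mat 1 1 (\<lambda>_. (c, 0)) \<in> min_cone C 1" "Matrix.mat 1 1 (\<lambda>_. (c, 0)) \<in> Her 1 V"
proof -
  have "psd_on {..<1::nat} (\<lambda>i j. 1\<^sub>m 1 $$ (i, j))"
    by (rule iffD2[OF psd_on_cong psd_kdelta]) (auto simp: kdelta_def)
  then have "1\<^sub>m 1 \<in> psd_mats 1" by (simp add: psd_mats_iff)
  moreover have "Matrix.mat 1 1 (\<lambda>_. (c, 0)) = Matrix.mat 1 1 (\<lambda>(i, j). \<Sum>l<(1::nat). 1 *\<^sub>R (elem_tensor (1\<^sub>m 1) c $$ (i, j)))"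
    by (rule eq_matI) (auto simp: elem_tensor_def)
  ultimately show "Matrix.mat 1 1 (\<lambda>_. (c, 0)) \<in> min_cone C 1"
    unfolding min_cone_def using c
    by (intro CollectI exI[of _ 1] exI[of _ "\<lambda>_. 1"] exI[of _ "\<lambda>_. 1\<^sub>m 1"] exI[of _ "\<lambda>_. c"]) auto
  show "Matrix.mat 1 1 (\<lambda>_. (c, 0)) \<in> Her 1 V" using V by (simp add: Her_def)
qed

text \<open>Together with \<open>min_cone_unit\<close> this reads off positivity of a map on the
  cone from detection at level one. A congruence by \<open>kdelta\<close> removes the trivial outer
  index.\<close>

lemma amplify_one:
  assumes "psd_on (blocks 1 d) (amplify (lin_map a) (Matrix.mat 1 1 (\<lambda>_. (c, 0))))"
  shows "psd_on {..<d} (\<lambda>i j. lin_map a i j c)"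
proof -
  have e: "amplify (lin_map a) (Matrix.mat 1 1 (\<lambda>_. (c, 0))) (0, i) (0, j) = lin_map a i j c" for i j
    by (simp add: amplify_def lin_map_zero)
  have psd: "psd_on {..<d} (\<lambda>i j. \<Sum>p\<in>blocks 1 d. \<Sum>q\<in>blocks 1 d.
      cnj (kdelta (snd p) i) * amplify (lin_map a) (Matrix.mat 1 1 (\<lambda>_. (c, 0))) p q * kdelta (snd q) j)"
    by (rule psd_congruence[OF assms])
  have eq: "(\<Sum>p\<in>blocks 1 d. \<Sum>q\<in>blocks 1 d.
      cnj (kdelta (snd p) i) * amplify (lin_map a) (Matrix.mat 1 1 (\<lambda>_. (c, 0))) p q * kdelta (snd q) j) = lin_map a i j c"
    if "i < d" "j < d" for i j
  proof -
    have "(\<Sum>p\<in>blocks 1 d. \<Sum>q\<in>blocks 1 d. cnj (kdelta (snd p) i) * amplify (lin_map a) (Matrix.mat 1 1 (\<lambda>_. (c, 0))) p q * kdelta (snd q) j)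
        = (\<Sum>m<d. \<Sum>n<d. cnj (kdelta m i) * lin_map a m n c * kdelta n j)"
      unfolding blk_sum using e by simp
    also have "\<dots> = lin_map a i j c"
      using that by (simp add: kdelta_def if_distrib[of cnj] if_distrib[of "(*) _"] if_distrib[of "\<lambda>x. x * _"] cong: if_cong)
    finally show ?thesis .
  qed
  show ?thesis by (rule iffD1[OF psd_on_cong psd]) (rule eq, auto)
qed

text \<open>Taking all such maps gives a family that does not depend on the matrix to be excluded,
  nor on the perturbation chosen for it.\<close>

definition unital_positive :: "nat \<Rightarrow> 'v::euclidean_space set \<Rightarrow> 'v \<Rightarrow> (nat \<times> nat \<Rightarrow> 'v \<times> 'v) set" where
  "unital_positive d F w = {a. (\<forall>c\<in>F. psd_on {..<d} (\<lambda>i j. lin_map a i j c)) \<and> (\<forall>i<d. \<forall>j<d. lin_map a i j w = kdelta i j)}"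

lemma unital_positive_herm:
  assumes F: "convex_cone F" and a: "\<forall>c\<in>F. psd_on {..<d} (\<lambda>i j. lin_map a i j c)" and v: "v \<in> span F"
  shows "herm_on {..<d} (\<lambda>i j. lin_map a i j v)"
proof (rule span_convex_cone[OF F v])
  fix x y assume xy: "x \<in> F" "y \<in> F" "v = x - y"
  have h: "herm_on {..<d} (\<lambda>i j. lin_map a i j c)" if "c \<in> F" for c using a psd_onD(1) that by blast
  show ?thesis
    by (rule herm_onI) (simp add: xy(3) lin_map_diff herm_onD[OF h[OF xy(1)]] herm_onD[OF h[OF xy(2)]])
qed

lemma cone_interior_absorbing:
  assumes w: "w \<in> cone_interior (span F) F" and v: "v \<in> span F"
  obtains t where "t > 0" "w + t *\<^sub>R v \<in> F" "w - t *\<^sub>R v \<in> F"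
proof -
  obtain T where T: "openin (top_of_set (span F)) T" "w \<in> T" "T \<subseteq> F"
    using w unfolding cone_interior_def interior_of_def by blast
  then obtain e where e: "e > 0" "\<And>x. x \<in> span F \<Longrightarrow> dist x w < e \<Longrightarrow> x \<in> T"
    unfolding openin_euclidean_subtopology_iff by blast
  have ws: "w \<in> span F" using T span_superset by blast
  \<comment> \<open>Chosen so that \<open>t * norm v < e\<close>; adding 1 keeps the denominator
    positive for \<open>v = 0\<close>.\<close>
  define t where "t = e / (2 * (norm v + 1))"
  have t: "t > 0" unfolding t_def using e(1) by (simp add: add_nonneg_pos)
  have "t * norm v < e"
  proof -
    have "t * norm v \<le> t * (norm v + 1)" using t by (simp add: mult_left_mono)
    also have "\<dots> = e / 2" unfolding t_def by (simp add: add_nonneg_eq_0_iff field_simps)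
    also have "\<dots> < e" using e(1) by simp
    finally show ?thesis .
  qed
  then have "w + t *\<^sub>R v \<in> T" "w - t *\<^sub>R v \<in> T"
    using t by (intro e(2) span_add span_diff span_scale ws v; simp add: dist_norm)+
  then show thesis using that[OF t] T(3) by blast
qed

text \<open>Half the values at \<open>w + t v\<close> and at \<open>w - t v\<close> are positive
  matrices with sum 1, so each is a contraction. The entries at \<open>w + t v\<close> are thus at
  most 2 in modulus, and removing the entry of the identity gives \<open>3 / t\<close> for every map
  at once.\<close>

lemma unital_positive_bounded:
  assumes w: "w \<in> cone_interior (span F) F" and v: "v \<in> span F"
  shows "\<exists>B. \<forall>a\<in>unital_positive d F w. \<forall>i<d. \<forall>j<d. cmod (lin_map a i j v) \<le> B"
proof -
  obtain t where t: "t > 0" "w + t *\<^sub>R v \<in> F" "w - t *\<^sub>R v \<in> F" by (rule cone_interior_absorbing[OF w v])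
  have "cmod (lin_map a i j v) \<le> 3 / t" if a: "a \<in> unital_positive d F w" and ij: "i < d" "j < d" for a i j
  proof -
    have pos: "psd_on {..<d} (\<lambda>i j. lin_map a i j c)" if "c \<in> F" for c
      using a that unfolding unital_positive_def by blast
    have un: "lin_map a i j w = kdelta i j" if "i < d" "j < d" for i j
      using a that unfolding unital_positive_def by blast
    have p1: "psd_on {..<d} (\<lambda>i j. of_real (1/2) * lin_map a i j (w + t *\<^sub>R v))"
      by (intro psd_scale pos t) simp
    have p2: "psd_on {..<d} (\<lambda>i j. of_real (1/2) * lin_map a i j (w - t *\<^sub>R v))"
      by (intro psd_scale pos t) simp
    have "psd_on {..<d} (\<lambda>i j. kdelta i j - of_real (1/2) * lin_map a i j (w + t *\<^sub>R v))"
      by (rule iffD1[OF psd_on_cong p2]) (simp add: lin_map_add lin_map_diff un field_simps)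
    then have "op_bound {..<d} 1 (\<lambda>i j. of_real (1/2) * lin_map a i j (w + t *\<^sub>R v))"
      by (intro psd_contraction p1) auto
    from op_bound_entry[OF finite_lessThan this, of i j] ij
    have "cmod (of_real (1/2) * lin_map a i j (w + t *\<^sub>R v)) \<le> 1" by simp
    then have "cmod (kdelta i j + of_real t * lin_map a i j v) \<le> 2"
      using ij by (simp add: norm_mult lin_map_add lin_map_scale un)
    moreover have "cmod (kdelta i j) \<le> 1" by (simp add: kdelta_def)
    ultimately have "cmod (of_real t * lin_map a i j v) \<le> 3"
      using norm_triangle_ineq4[of "kdelta i j + of_real t * lin_map a i j v" "kdelta i j"] by simp
    then show ?thesis using t(1) by (simp add: norm_mult pos_le_divide_eq mult.commute)
  qed
  then show ?thesis by blast
qed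

lemma psd_fails:
  assumes "herm_on I K" "\<not> psd_on I K" obtains x where "Re (ip_on I x (ap_on I K x)) < 0"
  using assms unfolding psd_on_def by (meson not_le)

text \<open>Failure of positivity is witnessed by a vector \<open>x\<close> at which the form is
  negative. For fixed \<open>x\<close> this is an open condition on the code \<open>a\<close> in the
  product topology, so it holds at some code in \<open>T\<close>.\<close>

lemma dense_detection:
  assumes F: "convex_cone F" and T: "T \<subseteq> unital_positive d F w" and dense: "unital_positive d F w \<subseteq> closure T"
    and a: "a \<in> unital_positive d F w" and X: "X \<in> Her s (span F)" and not_psd: "\<not> psd_on (blocks s d) (amplify (lin_map a) X)"
  shows "\<exists>b\<in>T. \<not> psd_on (blocks s d) (amplify (lin_map b) X)"
proof -
  have "herm_on (blocks s d) (amplify (lin_map a) X)"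
    by (rule herm_on_amplify[OF X]) (rule unital_positive_herm[OF F], use a in \<open>auto simp: unital_positive_def\<close>)
  then obtain x where x: "Re (ip_on (blocks s d) x (ap_on (blocks s d) (amplify (lin_map a) X) x)) < 0"
    using not_psd by (rule psd_fails)
  define g where "g = (\<lambda>a. Re (ip_on (blocks s d) x (ap_on (blocks s d) (amplify (lin_map a) X) x)))"
  have "continuous_on UNIV (\<lambda>a :: nat \<times> nat \<Rightarrow> 'a \<times> 'a. lin_map a i j v)" for i j v
  proof -
    have eq: "(\<lambda>a :: nat \<times> nat \<Rightarrow> 'a \<times> 'a. lin_map a i j v) = (\<lambda>a. of_real (inner (fst (a (i, j))) v) + \<i> * of_real (inner (snd (a (i, j))) v))"
      by (simp add: lin_map_def fun_eq_iff complex_eq_iff)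
    show ?thesis
      unfolding eq by (intro continuous_intros continuous_on_product_coordinates)
  qed
  then have "continuous_on UNIV g"
    unfolding g_def ip_on_ap_on amplify_def by (intro continuous_intros) auto
  then have "open (g -` {..<0})" by (intro open_vimage) auto
  moreover have "a \<in> g -` {..<0}" using x by (simp add: g_def)
  moreover have "a \<in> closure T" using a dense by blast
  ultimately obtain b where b: "b \<in> T" "g b < 0"
    unfolding closure_iff_nhds_not_empty by (metis Int_emptyI lessThan_iff subset_refl vimageD)
  then have "\<not> psd_on (blocks s d) (amplify (lin_map b) X)"
    unfolding g_def using psd_onD(2) by (meson not_le)
  with b show ?thesis by blast
qed

text \<open>Pointedness keeps \<open>- w\<close> out of \<open>C\<close>, and \<open>C\<close> is
  closed because it is finitely generated, so a hyperplane separates them strictly.\<close>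

lemma separating_functional:
  assumes C: "proper_polyhedral_cone V C" and w: "w \<in> C" "w \<noteq> 0"
  obtains h where "inner h w > 0" "\<And>c. c \<in> C \<Longrightarrow> inner h c \<ge> 0"
proof -
  obtain S where S: "finite S" "C = convex_cone hull S" and pt: "C \<inter> uminus ` C = {0}"
    using C unfolding proper_polyhedral_cone_def by blast
  have CC: "convex_cone C" unfolding S by (rule convex_cone_convex_cone_hull)
  have "- w \<notin> C"
  proof
    assume "- w \<in> C"
    then have "w \<in> uminus ` C" by force
    then show False using pt w by blast
  qed
  moreover have "convex C" using CC unfolding convex_cone_def by blast
  moreover have "closed C" unfolding S using S(1) by (rule closed_convex_cone_hull)
  ultimately obtain h b where h: "inner h (- w) < b" "\<And>x. x \<in> C \<Longrightarrow> inner h x > b"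
    using separating_hyperplane_closed_point by metis
  have b: "b < 0" using h(2)[OF convex_cone_contains_0[OF CC]] by simp
  have "inner h c \<ge> 0" if c: "c \<in> C" for c
  proof (rule ccontr)
    assume "\<not> inner h c \<ge> 0"
    then have neg: "inner h c < 0" by simp
    \<comment> \<open>Rescaling \<open>c\<close> brings its value to exactly \<open>b\<close>,
      against the strict bound on \<open>C\<close>.\<close>
    then have "inner h ((b / inner h c) *\<^sub>R c) > b"
      using b by (intro h(2) convex_cone_scaleR[OF CC _ c]) (simp add: divide_nonpos_neg)
    then show False using neg by simp
  qed
  moreover have "inner h w > 0" using h(1) b by simp
  ultimately show thesis using that by blast
qed

text \<open>A positive map \<open>\<phi>\<close> that detects \<open>X\<close> is turned into a unital one: \<open>\<phi> + \<delta> h\<close> still detects \<open>X\<close> for small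
  \<open>\<delta> > 0\<close> but is positive definite at \<open>w\<close>, so that it can be normalised by a congruence.\<close>

lemma unital_positive_detects:
  assumes C: "proper_polyhedral_cone V C" and face: "face_of_cone F C" and w: "w \<in> F" "w \<noteq> 0"
    and pos: "\<And>c. c \<in> C \<Longrightarrow> psd_on {..<d} (\<lambda>i j. lin_map a i j c)"
    and X: "X \<in> Her s (span F)" and not_psd: "\<not> psd_on (blocks s d) (amplify (lin_map a) X)"
  shows "\<exists>b\<in>unital_positive d F w. \<not> psd_on (blocks s d) (amplify (lin_map b) X)"
proof -
  note D = face_of_coneD[OF face]
  obtain h where h: "inner h w > 0" "\<And>c. c \<in> C \<Longrightarrow> inner h c \<ge> 0"
    by (rule separating_functional[OF C _ w(2)]) (use w D in auto)
  have posF: "\<forall>c\<in>F. psd_on {..<d} (\<lambda>i j. lin_map a i j c)" using pos D(1) by blast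
  have "herm_on (blocks s d) (amplify (lin_map a) X)"
    by (rule herm_on_amplify[OF X]) (rule unital_positive_herm[OF D(2) posF])
  then obtain x where x: "Re (ip_on (blocks s d) x (ap_on (blocks s d) (amplify (lin_map a) X) x)) < 0"
    using not_psd by (rule psd_fails)
  \<comment> \<open>The amplification at \<open>X\<close> of the map that sends \<open>v\<close> to
    \<open>inner h v\<close> times the identity.\<close>
  define L where "L = (\<lambda>p q :: nat \<times> nat. kdelta (snd p) (snd q) * (of_real (inner h (fst (X $$ (fst p, fst q)))) + \<i> * of_real (inner h (snd (X $$ (fst p, fst q))))))"
  define r where "r = Re (ip_on (blocks s d) x (ap_on (blocks s d) (amplify (lin_map a) X) x))"
  define m where "m = Re (ip_on (blocks s d) x (ap_on (blocks s d) L x))"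
  \<comment> \<open>Since \<open>r < 0\<close>, this choice is positive and keeps the correction
    \<open>\<delta> * m\<close> at or below \<open>- r / 2\<close>.\<close>
  define \<delta> where "\<delta> = - r / (2 * (\<bar>m\<bar> + 1))"
  have \<delta>: "\<delta> > 0" unfolding \<delta>_def using x by (intro divide_pos_pos) (auto simp: r_def)
  have "\<delta> * m \<le> \<delta> * (\<bar>m\<bar> + 1)" using \<delta> by (intro mult_left_mono) auto
  also have "\<dots> = - r / 2" by (simp add: \<delta>_def field_simps add_nonneg_eq_0_iff)
  finally have rm: "r + \<delta> * m < 0" using x by (simp add: r_def)
  \<comment> \<open>Adding \<open>\<delta> *\<^sub>R h\<close> to the real parts on the diagonal
    encodes the perturbed map.\<close>
  define a' where "a' = (\<lambda>p. if fst p = snd p then (fst (a p) + \<delta> *\<^sub>R h, snd (a p)) else a p)"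
  have eva: "lin_map a' i j v = lin_map a i j v + of_real (\<delta> * (inner h v)) * kdelta i j" for i j v
    by (simp add: lin_map_def a'_def kdelta_def complex_eq_iff inner_simps)
  have ampa: "amplify (lin_map a') X p q = amplify (lin_map a) X p q + of_real \<delta> * L p q" for p q
    by (simp add: amplify_def eva L_def algebra_simps)
  have "ip_on (blocks s d) x (ap_on (blocks s d) (amplify (lin_map a') X) x)
      = ip_on (blocks s d) x (ap_on (blocks s d) (amplify (lin_map a) X) x) + of_real \<delta> * ip_on (blocks s d) x (ap_on (blocks s d) L x)"
    by (simp add: ip_on_ap_on ampa algebra_simps sum.distrib sum_distrib_left)
  then have neg: "Re (ip_on (blocks s d) x (ap_on (blocks s d) (amplify (lin_map a') X) x)) < 0"
    using rm by (simp add: r_def m_def)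
  have pos': "psd_on {..<d} (\<lambda>i j. lin_map a' i j c)" if "c \<in> F" for c
    unfolding eva using that h(2) D(1) \<delta> by (intro psd_add psd_scale psd_kdelta) (auto simp: posF)
  define \<eta> where "\<eta> = \<delta> * (inner h w)"
  have "\<eta> > 0" using \<delta> h(1) by (simp add: \<eta>_def)
  moreover have "psd_on {..<d} (\<lambda>i j. lin_map a i j w)" using posF w by blast
  ultimately obtain Y G where Y: "\<forall>i<d. \<forall>j<d. lin_map a i j w + of_real \<eta> * kdelta i j = (\<Sum>k<d. cnj (Y k i) * Y k j)"
    and YG: "\<forall>i<d. \<forall>j<d. (\<Sum>k<d. Y i k * G k j) = kdelta i j" and GY: "\<forall>i<d. \<forall>j<d. (\<Sum>k<d. G i k * Y k j) = kdelta i j"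
    using posdef_factorization[of d "\<lambda>i j. lin_map a i j w" \<eta>] by blast
  \<comment> \<open>The matrix of the perturbed map at \<open>w\<close> is the product of the
    adjoint of \<open>Y\<close> with \<open>Y\<close>, so the congruence by the inverse
    \<open>G\<close> of \<open>Y\<close> makes it the identity.\<close>
  have "\<exists>b. \<forall>i<d. \<forall>j<d. \<forall>v. lin_map b i j v = (\<Sum>k<d. \<Sum>l<d. cnj (G k i) * lin_map a' k l v * G l j)"
  proof (rule lin_map_repr[OF subspace_UNIV, of d "\<lambda>i j v. \<Sum>k<d. \<Sum>l<d. cnj (G k i) * lin_map a' k l v * G l j"])
    show "(\<Sum>k<d. \<Sum>l<d. cnj (G k i) * lin_map a' k l (v + v') * G l j)
      = (\<Sum>k<d. \<Sum>l<d. cnj (G k i) * lin_map a' k l v * G l j) + (\<Sum>k<d. \<Sum>l<d. cnj (G k i) * lin_map a' k l v' * G l j)" for i j v v'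
      by (simp add: lin_map_add algebra_simps sum.distrib)
    show "(\<Sum>k<d. \<Sum>l<d. cnj (G k i) * lin_map a' k l (r *\<^sub>R v) * G l j)
      = of_real r * (\<Sum>k<d. \<Sum>l<d. cnj (G k i) * lin_map a' k l v * G l j)" for i j r v
      by (simp add: lin_map_scale sum_distrib_left mult_ac)
    show ?thesis if "\<And>i j v. i < d \<Longrightarrow> j < d \<Longrightarrow> v \<in> UNIV \<Longrightarrow>
        lin_map b i j v = (\<Sum>k<d. \<Sum>l<d. cnj (G k i) * lin_map a' k l v * G l j)" for b
      using that by (intro exI[of _ b]) simp
  qed
  then obtain b where b: "\<And>i j v. i < d \<Longrightarrow> j < d \<Longrightarrow>
      lin_map b i j v = (\<Sum>k<d. \<Sum>l<d. cnj (G k i) * lin_map a' k l v * G l j)"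
    by blast
  have dbl: "(\<Sum>k<d. \<Sum>l<d. cnj (P k i) * (\<Sum>m<d. \<Sum>n<d. cnj (Q m k) * K m n * Q n l) * P l j)
      = (\<Sum>m<d. \<Sum>n<d. cnj (\<Sum>k<d. Q m k * P k i) * K m n * (\<Sum>l<d. Q n l * P l j))" for P Q K :: "nat \<Rightarrow> nat \<Rightarrow> complex" and i j
    using cong_form[where J="{..<d}" and y="\<lambda>k. P k i" and I="{..<d}" and G=Q and K=K and z="\<lambda>l. P l j"] by (simp add: ip_on_ap_on)
  have delta: "(\<Sum>m<d. \<Sum>n<d. cnj (kdelta m i) * K m n * kdelta n j) = K i j" if "i < d" "j < d" for K i j
    using that by (simp add: kdelta_def if_distrib[of cnj] if_distrib[of "(*) _"] if_distrib[of "\<lambda>x. x * _"] cong: if_cong)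
  \<comment> \<open>The congruence is reversible by \<open>Y\<close>. Hence
    \<open>amplify_congruence\<close> carries the vector \<open>x\<close> of negative form for
    \<open>a'\<close> to one for \<open>b\<close>.\<close>
  have inv: "lin_map a' i j v = (\<Sum>k<d. \<Sum>l<d. cnj (Y k i) * lin_map b k l v * Y l j)" if ij: "i < d" "j < d" for i j v
  proof -
    have "(\<Sum>k<d. \<Sum>l<d. cnj (Y k i) * lin_map b k l v * Y l j)
        = (\<Sum>k<d. \<Sum>l<d. cnj (Y k i) * (\<Sum>m<d. \<Sum>n<d. cnj (G m k) * lin_map a' m n v * G n l) * Y l j)"
      by (simp add: b)
    also have "\<dots> = (\<Sum>m<d. \<Sum>n<d. cnj (kdelta m i) * lin_map a' m n v * kdelta n j)"
      using GY ij by (simp add: dbl[where P=Y and Q=G and K="\<lambda>m n. lin_map a' m n v" and i=i and j=j])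
    finally show ?thesis by (simp add: delta ij)
  qed
  have "\<not> psd_on (blocks s d) (amplify (lin_map b) X)"
  proof
    assume "psd_on (blocks s d) (amplify (lin_map b) X)"
    from psd_onD(2)[OF this] neg amplify_congruence[of d "span F" a' Y b X s x] inv X show False by (simp add: not_less[symmetric])
  qed
  moreover have "b \<in> unital_positive d F w"
    unfolding unital_positive_def
  proof (intro CollectI conjI ballI allI impI)
    fix c assume "c \<in> F"
    show "psd_on {..<d} (\<lambda>i j. lin_map b i j c)"
      by (rule iffD1[OF psd_on_cong psd_congruence[OF pos'[OF \<open>c \<in> F\<close>], of "{..<d}" G]]) (simp add: b)
  next
    fix i j assume ij: "i < d" "j < d"
    have aw: "lin_map a' k l w = (\<Sum>m<d. \<Sum>n<d. cnj (Y m k) * kdelta m n * Y n l)" if "k < d" "l < d" for k l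
    proof -
      have "(\<Sum>m<d. \<Sum>n<d. cnj (Y m k) * kdelta m n * Y n l) = (\<Sum>m<d. cnj (Y m k) * Y m l)"
        by (intro sum.cong refl) (simp add: kdelta_def if_distrib[of "(*) _"] if_distrib[of "\<lambda>x. x * _"] cong: if_cong)
      then show ?thesis using Y that by (simp add: eva \<eta>_def)
    qed
    have "lin_map b i j w = (\<Sum>k<d. \<Sum>l<d. cnj (G k i) * (\<Sum>m<d. \<Sum>n<d. cnj (Y m k) * kdelta m n * Y n l) * G l j)"
      using ij by (simp add: b aw)
    also have "\<dots> = (\<Sum>m<d. \<Sum>n<d. cnj (kdelta m i) * kdelta m n * kdelta n j)"
      using YG ij by (simp add: dbl[where P=G and Q=Y and K=kdelta and i=i and j=j])
    finally show "lin_map b i j w = kdelta i j" by (simp add: delta ij)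
  qed
  ultimately show ?thesis by blast
qed

section \<open>Degenerate cases and conclusion\<close>

lemma Her_mono:
  assumes "V \<subseteq> W" shows "Her s V \<subseteq> Her s W"
proof
  fix X assume X: "X \<in> Her s V"
  show "X \<in> Her s W"
    unfolding Her_def
  proof (intro CollectI conjI allI impI)
    show "X \<in> carrier_mat s s" using X unfolding Her_def by blast
    fix i j assume ij: "i < s" "j < s"
    show "X $$ (i, j) \<in> W \<times> W" using HerD(1,2)[OF X ij] assms by (auto simp: mem_Times_iff)
    show "X $$ (j, i) = (fst (X $$ (i, j)), - snd (X $$ (i, j)))" by (rule HerD(3)[OF X ij])
  qed
qed

lemma zero_mat_min_cone:
  assumes "X \<in> Her s {0}" shows "X \<in> min_cone F s"
proof -
  have "X = Matrix.mat s s (\<lambda>(i, j). \<Sum>l<(0::nat). 0 *\<^sub>R (elem_tensor (1\<^sub>m s) 0 $$ (i, j)))"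
  proof (rule eq_matI)
    fix i j
    assume "i < dim_row (Matrix.mat s s (\<lambda>(i, j). \<Sum>l<(0::nat). 0 *\<^sub>R (elem_tensor (1\<^sub>m s) (0::'a) $$ (i, j))))"
      "j < dim_col (Matrix.mat s s (\<lambda>(i, j). \<Sum>l<(0::nat). 0 *\<^sub>R (elem_tensor (1\<^sub>m s) (0::'a) $$ (i, j))))"
    then have ij: "i < s" "j < s" by auto
    have "X $$ (i, j) = 0" using HerD(1,2)[OF assms ij] by (simp add: prod_eq_iff)
    then show "X $$ (i, j) = Matrix.mat s s (\<lambda>(i, j). \<Sum>l<(0::nat). 0 *\<^sub>R (elem_tensor (1\<^sub>m s) 0 $$ (i, j))) $$ (i, j)"
      using ij by simp
  qed (use assms in \<open>auto simp: Her_def\<close>)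
  then show ?thesis unfolding min_cone_def
    by (intro CollectI exI[of _ 0] exI[of _ "\<lambda>_. 0"] exI[of _ "\<lambda>_. 1\<^sub>m s"] exI[of _ "\<lambda>_. 0"]) auto
qed

text \<open>Around an interior point 0 the cone contains a positive multiple of each
  \<open>v\<close> and of its negative, which pointedness allows only for
  \<open>v = 0\<close>.\<close>

lemma cone_interior_zero:
  assumes pt: "F \<inter> uminus ` F = {0}" and 0: "0 \<in> cone_interior (span F) F"
  shows "span F = {0}"
proof -
  have "v = 0" if "v \<in> span F" for v
  proof -
    obtain t where t: "t > 0" "0 + t *\<^sub>R v \<in> F" "0 - t *\<^sub>R v \<in> F" by (rule cone_interior_absorbing[OF 0 \<open>v \<in> span F\<close>])
    have "t *\<^sub>R v \<in> uminus ` F" by (rule image_eqI[where x="0 - t *\<^sub>R v"]) (simp, rule t(3))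
    moreover have "t *\<^sub>R v \<in> F" using t(2) by simp
    ultimately have "t *\<^sub>R v \<in> {0}" unfolding pt[symmetric] by (rule IntI[rotated])
    then show ?thesis using t(1) by simp
  qed
  then show ?thesis using span_zero by blast
qed

lemma detects_pos:
  assumes "subspace V" "C \<subseteq> V" "detects d V C P" "a \<in> P" "c \<in> C"
  shows "psd_on {..<d} (\<lambda>i j. lin_map a i j c)"
proof -
  have c: "c \<in> V" "0 \<in> V" using assms by (auto simp: subspace_0)
  show ?thesis
    using assms(3,4) min_cone_unit[OF assms(5) c] unfolding detects_def by (intro amplify_one) simp
qed

text \<open>An empty family would admit every Hermitian matrix, in particular \<open>- w\<close> at
  level one. The functional \<open>h\<close>, regarded as a positive map into
  \<open>1 \<times> 1\<close> matrices, shows that \<open>- w\<close> is not in the cone.\<close>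

lemma detects_nonempty:
  assumes C: "proper_polyhedral_cone V C" and det: "detects d V C P" and w: "w \<in> C" "w \<noteq> 0"
  shows "P \<noteq> {}"
proof
  assume P: "P = {}"
  have V: "subspace V" "C \<subseteq> V" using C unfolding proper_polyhedral_cone_def by blast+
  obtain h where h: "inner h w > 0" "\<And>c. c \<in> C \<Longrightarrow> inner h c \<ge> 0"
    by (rule separating_functional[OF C w]) blast
  define a :: "nat \<times> nat \<Rightarrow> 'a \<times> 'a" where "a = (\<lambda>_. (h, 0))"
  have eva: "lin_map a i j v = of_real (inner h v) * kdelta i j" if "i < 1" "j < 1" for i j v
    using that by (simp add: lin_map_def a_def kdelta_def complex_eq_iff)
  have pos: "psd_on {..<1} (\<lambda>i j. lin_map a i j c)" if "c \<in> C" for c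
    by (rule iffD2[OF psd_on_cong psd_scale[OF psd_kdelta h(2)[OF that]]]) (auto simp: eva)
  have "- w \<in> V" "0 \<in> V" using V w by (auto simp: subspace_neg subspace_0)
  then have "Matrix.mat 1 1 (\<lambda>_. (- w, 0)) \<in> Her 1 V" by (simp add: Her_def)
  then have "Matrix.mat 1 1 (\<lambda>_. (- w, 0)) \<in> min_cone C 1"
    using det P unfolding detects_def by auto
  then have "psd_on {..<1} (\<lambda>i j. lin_map a i j (- w))" by (intro amplify_one[OF min_cone_psd[OF _ pos]])
  from psd_onD(2)[OF this, of "\<lambda>_. 1"] h(1) show False
    by (simp add: ip_on_def ap_on_def eva kdelta_def)
qed

theorem proposition4p1:
  fixes V C F :: "'v::euclidean_space set" and u :: 'v and d :: nat
  assumes "proper_polyhedral_cone V C"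
    and "u \<in> cone_interior V C"
    and "face_of_cone F C"
    and "d \<ge> 1"
    and "subhomogeneous TYPE('a) d (min_system V C u)"
  shows "proper_polyhedral_cone (span F) F \<and>
    (\<forall>w \<in> cone_interior (span F) F.
      subhomogeneous TYPE('a) d (min_system (span F) F w))"
proof (intro conjI ballI)
  note C = assms(1) and face = assms(3)
  show PF: "proper_polyhedral_cone (span F) F" by (rule face_proper_polyhedral[OF C face])
  fix w assume w: "w \<in> cone_interior (span F) F"
  note D = face_of_coneD[OF face]
  have V: "subspace V" "C \<subseteq> V" using C unfolding proper_polyhedral_cone_def by blast+
  have "\<exists>S. C = convex_cone hull S" using C unfolding proper_polyhedral_cone_def by blast
  then have CC: "convex_cone C" by (elim exE) (simp only: convex_cone_convex_cone_hull)
  have wF: "w \<in> F" 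
    using w interior_of_subset[of "top_of_set (span F)" F] unfolding cone_interior_def by blast
  have FV: "span F \<subseteq> V" using D(1) V by (intro span_minimal) auto
  obtain A :: "'a cstar_alg" and \<Phi> where A: "comm_cstar_algebra A"
    and emb: "unital_complete_order_embedding (min_system V C u) d A \<Phi>"
    using assms(5) unfolding subhomogeneous_def by blast
  obtain P where P: "detects d V C P" "\<one>\<^bsub>A\<^esub> = \<zero>\<^bsub>A\<^esub> \<Longrightarrow> P = {}"
    using comm_cstar_algebra.embedding_detects[OF A V(1) emb] by blast
  \<comment> \<open>The codes form a countable product of Euclidean spaces, so a countable set is
    dense in all the unital positive ones.\<close>
  obtain T where T: "countable T" "T \<subseteq> unital_positive d F w" "unital_positive d F w \<subseteq> closure T"
    by (rule separable)
  have posT: "psd_on {..<d} (\<lambda>i j. lin_map a i j c)" if "a \<in> unital_positive d F w" "c \<in> F" for a c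
    using that unfolding unital_positive_def by blast
  \<comment> \<open>No map is unital at \<open>w = 0\<close>, since \<open>d \<ge> 1\<close>, so
    \<open>T\<close> is empty in this case and all Hermitian matrices over \<open>span F\<close>
    must lie in the cone. They do, because the span is zero.\<close>
  have w0: "X \<in> min_cone F s" if X: "X \<in> Her s (span F)" and "w = 0" for X s
  proof -
    have "F \<inter> uminus ` F = {0}" using PF unfolding proper_polyhedral_cone_def by blast
    then have "span F = {0}" by (rule cone_interior_zero) (use w \<open>w = 0\<close> in simp)
    then show ?thesis using X by (simp only: zero_mat_min_cone)
  qed
  have detT: "detects d (span F) F T"
    unfolding detects_def
  proof (intro conjI ballI allI impI)
    show "herm_on {..<d} (\<lambda>i j. lin_map a i j v)" if "a \<in> T" "v \<in> span F" for a v
      by (rule unital_positive_herm[OF D(2) _ that(2)]) (use posT T(2) that(1) in blast)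
    fix s X assume s: "1 \<le> s" and X: "X \<in> Her s (span F)"
    show "X \<in> min_cone F s \<longleftrightarrow> (\<forall>a\<in>T. psd_on (blocks s d) (amplify (lin_map a) X))"
    proof
      assume "X \<in> min_cone F s"
      then show "\<forall>a\<in>T. psd_on (blocks s d) (amplify (lin_map a) X)"
        using posT T(2) by (intro ballI min_cone_psd) auto
    next
      assume psd: "\<forall>a\<in>T. psd_on (blocks s d) (amplify (lin_map a) X)"
      show "X \<in> min_cone F s"
      proof (rule ccontr)
        assume notF: "X \<notin> min_cone F s"
        then have "w \<noteq> 0" using w0[OF X] by blast
        have "X \<notin> min_cone C s" using notF min_cone_face[OF CC face _ X] by blast
        moreover have "X \<in> Her s V" using Her_mono[OF FV] X by blast
        ultimately obtain a where a: "a \<in> P" "\<not> psd_on (blocks s d) (amplify (lin_map a) X)"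
          using P(1) s unfolding detects_def by blast
        obtain b where b: "b \<in> unital_positive d F w" "\<not> psd_on (blocks s d) (amplify (lin_map b) X)"
          using unital_positive_detects[OF C face wF \<open>w \<noteq> 0\<close> detects_pos[OF V P(1) a(1)] X a(2)] by blast
        show False using dense_detection[OF D(2) T(2,3) b(1) X b(2)] psd by blast
      qed
    qed
  qed
  \<comment> \<open>Only a nonempty \<open>T\<close> requires room in the type. It contains a map
    with value 1 in the entry (0, 0) at \<open>w\<close>, so \<open>w\<close> is nonzero; then
    \<open>P\<close> is nonempty, the given algebra is nonzero, and its scalars embed the complex
    numbers.\<close>
  have "inj (\<lambda>c. c \<odot>\<^bsub>A\<^esub> \<one>\<^bsub>A\<^esub>) \<or> T = {}"
  proof (cases "T = {}")
    case False
    then obtain a where "a \<in> unital_positive d F w" using T(2) by blast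
    then have "lin_map a 0 0 w = 1" using assms(4) unfolding unital_positive_def by (simp add: kdelta_def)
    then have "w \<noteq> 0" by (auto simp: lin_map_zero)
    then have "P \<noteq> {}" using detects_nonempty[OF C P(1)] wF D(1) by blast
    then have ne: "\<one>\<^bsub>A\<^esub> \<noteq> \<zero>\<^bsub>A\<^esub>" using P(2) by blast
    then show ?thesis using comm_cstar_algebra.inj_scalars[OF A] by blast
  qed simp
  then obtain J :: "((nat \<times> nat \<Rightarrow> 'v \<times> 'v) \<Rightarrow> complex) \<Rightarrow> 'a" where J: "inj_on J (linf T)"
    using linf_encodable[OF T(1)] by blast
  show "subhomogeneous TYPE('a) d (min_system (span F) F w)"
  proof (rule detects_imp_subhomogeneous[OF subspace_span detT _ _ J])
    show "lin_map a i j w = kdelta i j" if "a \<in> T" "i < d" "j < d" for a i j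
      using that T(2) unfolding unital_positive_def by blast
    show "\<exists>B. \<forall>a\<in>T. \<forall>i<d. \<forall>j<d. cmod (lin_map a i j v) \<le> B" if "v \<in> span F" for v
      using unital_positive_bounded[OF w that, of d] T(2) by blast
    show "w \<in> span F" using wF by (rule span_base)
  qed
qed

end
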